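(* Let $p,q\geqslant 0$ be integers with $q\neq p+1$, let $\lambda,\mu\in\mathbb{R}$ and $\delta=\mu-\lambda$. If $\delta$ is not critical, then the map $Q\colon\mathcal{S}_\delta\to\mathcal{D}_{\lambda,\mu}$ defined by $$Q(S)(f)=\sum_{r=0}^kC_{k,r}\,Q_{\mathrm{Aff}}(\mathrm{div}^rS)(f)\quad\text{for all }S\in\mathcal{S}^k_\delta$$ is the unique $\mathfrak{sl}(p+1|q)$-equivariant quantization over $\mathbb{R}^{p|q}$ if $$C_{k,r}=\frac{\prod_{j=1}^r\big((p-q+1)\lambda+k-j\big)}{r!\,\prod_{j=1}^r\big(p-q+2k-j-(p-q+1)\delta\big)}\quad\text{for all }r\geqslant 1,\qquad C_{k,0}=1.$$
   Context: All Lie superalgebras are over $\mathbb{R}$. The parity of a homogeneous object $a$ is $\tilde a$; for an index $i\in\{1,\ldots,p+q\}$, $\tilde i=0$ if $i\leqslant p$ and $\tilde i=1$ otherwise. The coordinates of $\mathbb{R}^{p|q}$ are $y^1,\ldots,y^{p+q}$, where $y^1=x^1,\ldots,y^p=x^p$ are even and $y^{p+1}=\theta^1,\ldots,y^{p+q}=\theta^q$ are odd (anticommuting), so $\tilde{y^i}=\tilde i$. $\mathcal{F}=C^\infty(\mathbb{R}^{p|q})=C^\infty(\mathbb{R}^p)\otimes\Lambda(\theta^1,\ldots,\theta^q)$, and $\mathrm{Vect}(\mathbb{R}^{p|q})$ is the Lie superalgebra of vector fields $X=\sum_i X^i\partial_{y^i}$, $X^i\in\mathcal{F}$. Formulas with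 signs are written for homogeneous elements and extended linearly. Let $e_1,\ldots,e_{p+q}$ be the standard basis of the superspace $\mathbb{R}^{p|q}$ (parity of $e_i$ is $\tilde i$), $\varepsilon^1,\ldots,\varepsilon^{p+q}$ the standard basis of row vectors of $(\mathbb{R}^{p|q})^*$ (parity of $\varepsilon^i$ is $\tilde i$), and let $\mathrm{str}(A)=\sum_i(-1)^{\tilde i}A^i_i$ for $A\in\mathfrak{gl}(p|q)$. Densities. For $X=\sum_i X^i\partial_{y^i}$ put $\mathrm{div}(X)=\sum_i(-1)^{\tilde{y^i}\widetilde{X^i}}\partial_{y^i}X^i$. $\mathcal{F}_\lambda$ is the space $\mathcal{F}$ with the action $L^\lambda_Xf=X(f)+\lambda\,\mathrm{div}(X)f$ of $\mathrm{Vect}(\mathbb{R}^{p|q})$. Symbols. $S^k$ is the degree $k$ part of the (super)symmetric algebra of $\mathbb{R}^{p|q}$, with product $\vee$ satisfying $v\vee w=(-1)^{\tilde v\tilde w}w\vee v$. $\mathfrak{gl}(p|q)$ acts on $S^k$ by $\rho(A)(v_1\vee\cdots\vee v_k)=\sum_j(-1)^{\tilde A(\tilde v_1+\cdots+\tilde v_{j-1})}v_1\vee\cdots\vee Av_j\vee\cdots\vee v_k$. $B^\delta$ is the space of dimension $1|0$ spanned by $u$ with $\rho(A)u=-\delta\,\mathrm{str}(A)u$, and $S^k_\delta=B^\delta\otimes S^k$ with the tensor product representation $\rho$. $\mathcal{S}^k_\delta=\mathcal{F}\otimes S^k_\delta$ with the action $$L_X(f\otimes v)=X(f)\otimes v+(-1)^{\widetilde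 X\tilde f}\sum_{i,j}fJ_i^j\otimes\rho(e^i_j)v,\qquad J_i^j=(-1)^{\tilde{y^i}\widetilde X+1}\partial_{y^i}X^j,$$ where $e^i_j(e_k)=\delta^i_ke_j$; and $\mathcal{S}_\delta=\bigoplus_{k\geqslant 0}\mathcal{S}^k_\delta$. The generator $u$ is omitted from the notation. Differential operators. $\mathcal{D}_{\lambda,\mu}$ is the space of linear differential operators $\mathcal{F}_\lambda\to\mathcal{F}_\mu$ with action $\mathcal{L}_XD=L^\mu_X\circ D-(-1)^{\widetilde X\widetilde D}D\circ L^\lambda_X$; $\mathcal{D}^k_{\lambda,\mu}$ is the subspace of operators of order at most $k$. Every $D\in\mathcal{D}^k_{\lambda,\mu}$ is uniquely $D=\sum_{|\alpha|\leqslant k}f_\alpha\,\partial_{y^1}^{\alpha_1}\cdots\partial_{y^{p+q}}^{\alpha_{p+q}}$ with $f_\alpha\in\mathcal{F}$ and $\alpha_{p+1},\ldots,\alpha_{p+q}\in\{0,1\}$. The principal symbol is $\sigma_k\colon\mathcal{D}^k_{\lambda,\mu}\to\mathcal{S}^k_\delta$, $D\mapsto\sum_{|\alpha|=k}f_\alpha\otimes e_1^{\alpha_1}\vee\cdots\vee e_{p+q}^{\alpha_{p+q}}$, with $\delta=\mu-\lambda$. The affine quantization map $Q_{\mathrm{Aff}}\colon\mathcal{S}_\delta\to\mathcal{D}_{\lambda,\mu}$ is the linear bijection inverse to the total symbol map $D\mapsto\sum_{|\alpha|\leqslant k}f_\alpha\otimes e_1^{\alpha_1}\vee\cdots\vee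 e_{p+q}^{\alpha_{p+q}}$. A quantization is a linear bijection $Q\colon\mathcal{S}_\delta\to\mathcal{D}_{\lambda,\mu}$ such that $Q(T)\in\mathcal{D}^k_{\lambda,\mu}$ and $\sigma_k(Q(T))=T$ for all $T\in\mathcal{S}^k_\delta$ and all $k\in\mathbb{N}$. Divergence operator on symbols. For $h\in(\mathbb{R}^{p|q})^*$, the interior product is $i(h)(h_1\vee\cdots\vee h_k)=\sum_{j=1}^k(-1)^{\tilde h(\tilde h_1+\cdots+\tilde h_{j-1})}\langle h,h_j\rangle\,h_1\vee\cdots\widehat{j}\cdots\vee h_k$, where $\langle h,x\rangle$ is the matrix product of the row $h$ by the column $x$ and $\widehat{j}$ means that $h_j$ is omitted; it is extended to $\mathcal{S}_\delta$ by $i(h)u=0$ and as a differential operator of order zero and parity $\tilde h$, i.e. $i(h)(f\otimes w)=(-1)^{\tilde h\tilde f}f\otimes i(h)w$. Then $\mathrm{div}\colon\mathcal{S}^k_\delta\to\mathcal{S}^{k-1}_\delta$ is $\mathrm{div}\,S=\sum_{j=1}^{p+q}(-1)^{\tilde{y^j}}i(\varepsilon^j)\partial_{y^j}S$, where $\partial_{y^j}(f\otimes w)=(\partial_{y^j}f)\otimes w$, and $\mathrm{div}^r$ is its $r$-th iterate. Projective superalgebra. $\mathfrak{pgl}(p+1|q)=\mathfrak{gl}(p+1|q)/\mathbb{R}\,\mathrm{Id}$ is isomorphic to $\mathfrak{sl}(p+1|q)$ for $q\neq p+1$, and is denoted $\mathfrak{sl}(p+1|q)$ in that case. It is identified with $\mathfrak{g}_{-1}\oplus\mathfrak{g}_0\oplus\mathfrak{g}_1$,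 $\mathfrak{g}_{-1}=\mathbb{R}^{p|q}$ (columns), $\mathfrak{g}_0=\mathfrak{gl}(p|q)$, $\mathfrak{g}_1=(\mathbb{R}^{p|q})^*$ (rows), through $\left[\begin{pmatrix}a&\xi\\ h&A\end{pmatrix}\right]\mapsto(h,A-a\,\mathrm{Id},\xi)$. It is realized in $\mathrm{Vect}(\mathbb{R}^{p|q})$ by the linear map $h\mapsto X^h$ with $X^v=-\sum_iv^i\partial_{y^i}$ for $v\in\mathfrak{g}_{-1}$, $X^A=-\sum_{i,j}(-1)^{\tilde j(\tilde i+\tilde j)}A^i_jy^j\partial_{y^i}$ for $A\in\mathfrak{g}_0$, and $X^\xi=\sum_j\xi_jy^j(-1)^{\tilde j}\mathcal{E}$ for $\xi\in\mathfrak{g}_1$, where $\mathcal{E}=\sum_iy^i\partial_{y^i}$. A quantization $Q\colon\mathcal{S}_\delta\to\mathcal{D}_{\lambda,\mu}$ is $\mathfrak{sl}(p+1|q)$-equivariant if $\mathcal{L}_{X^h}\circ Q=Q\circ L_{X^h}$ for every $h$ in this algebra. Critical values ($q\neq p+1$). Set $\alpha(k,\delta)=\frac{p-q}{2}\delta^2-\frac{2k+p-q}{2}\delta+\frac{k(k+(p-q))}{p-q+1}$. The value $\delta$ is critical if there exist $k,l\in\mathbb{N}$ with $l<k$ and $\alpha(k,\delta)=\alpha(l,\delta)$. *)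

theory Defs
  imports "HOL-Analysis.Analysis" "HOL-Library.Function_Algebras"
begin

text \<open>
  The dimension \<open>p|q\<close> varies over all pairs of natural numbers (zero included), so the spaces
  depending on it are carrier sets inside fixed types, and linear combinations are formed with
  the pointwise vector space structure on functions.
\<close>

instantiation "fun" :: (type, real_vector) real_vector
begin

definition scaleR_fun_def: "c *\<^sub>R f = (\<lambda>x. c *\<^sub>R f x)"

instance
  by standard (simp_all add: scaleR_fun_def fun_eq_iff scaleR_add_right scaleR_add_left)

end

text \<open>
  The coordinates \<open>y\<^sup>1,\<dots>,y\<^sup>p\<^sup>+\<^sup>q\<close> have the indices \<open>1..p+q\<close>. The index \<open>0\<close>, which has even parity,
  is the additional row and column of \<open>gl(p+1|q)\<close>.
\<close>

definition par :: "nat \<Rightarrow> nat \<Rightarrow> nat" where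
  "par p i = (if i \<le> p then 0 else 1)"

section \<open>Superfunctions\<close>

text \<open>
  A point of \<open>R\<^sup>p\<close> is given by the coordinates \<open>1..p\<close> of a sequence; functions on \<open>R\<^sup>p\<close> are
  those that ignore the other entries. For these, continuity in the product topology is
  continuity on \<open>R\<^sup>p\<close>.
\<close>

type_synonym point = "nat \<Rightarrow> real"

definition pderivative :: "nat \<Rightarrow> (point \<Rightarrow> real) \<Rightarrow> point \<Rightarrow> real" where
  "pderivative i g = (\<lambda>x. deriv (\<lambda>t. g (x(i := t))) (x i))"

text \<open>\<open>C\<^sup>\<infinity>(R\<^sup>p)\<close>: all iterated partial derivatives exist and are continuous.\<close>

definition smooth :: "nat \<Rightarrow> (point \<Rightarrow> real) \<Rightarrow> bool" where
  "smooth p g \<longleftrightarrow>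
     (\<forall>x y. (\<forall>i\<in>{1..p}. x i = y i) \<longrightarrow> g x = g y) \<and>
     (\<forall>is\<in>lists {1..p}.
        continuous_on UNIV (foldr pderivative is g) \<and>
        (\<forall>i\<in>{1..p}. \<forall>x. (\<lambda>t. foldr pderivative is g (x(i := t))) differentiable (at (x i))))"

text \<open>
  \<open>f :: sfun\<close> is the superfunction \<open>\<Sum>\<^sub>I f\<^sub>I y\<^sup>I\<close>, where \<open>I\<close> ranges over the sets of odd indices
  and \<open>y\<^sup>I\<close> is the product of the odd coordinates \<open>y\<^sup>i\<close>, \<open>i \<in> I\<close>, in increasing order.
\<close>

type_synonym sfun = "nat set \<Rightarrow> point \<Rightarrow> real"

definition SF :: "nat \<Rightarrow> nat \<Rightarrow> sfun set" where
  "SF p q = {f. (\<forall>I. smooth p (f I)) \<and> (\<forall>I. \<not> I \<subseteq> {p+1..p+q} \<longrightarrow> f I = 0)}"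

text \<open>\<open>y\<^sup>I y\<^sup>J = ksign I J \<cdot> y\<^sup>I\<^sup>\<union>\<^sup>J\<close> for disjoint \<open>I\<close> and \<open>J\<close>.\<close>

definition ksign :: "nat set \<Rightarrow> nat set \<Rightarrow> real" where
  "ksign I J = (- 1) ^ card {(i, j). i \<in> I \<and> j \<in> J \<and> j < i}"

definition sprod :: "sfun \<Rightarrow> sfun \<Rightarrow> sfun" where
  "sprod f g = (\<lambda>K x. \<Sum>I\<in>Pow K. ksign I (K - I) * f I x * g (K - I) x)"

definition sone :: sfun where
  "sone = (\<lambda>I x. if I = {} then 1 else 0)"

definition coord :: "nat \<Rightarrow> nat \<Rightarrow> sfun" where
  "coord p i = (if i \<le> p then (\<lambda>I x. if I = {} then x i else 0)
                else (\<lambda>I x. if I = {i} then 1 else 0))"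

definition hpart :: "nat \<Rightarrow> sfun \<Rightarrow> sfun" where
  "hpart a f = (\<lambda>I. if card I mod 2 = a mod 2 then f I else 0)"

text \<open>The odd partial derivatives are left derivatives.\<close>

definition sderiv :: "nat \<Rightarrow> nat \<Rightarrow> sfun \<Rightarrow> sfun" where
  "sderiv p i f =
     (if i \<le> p then (\<lambda>I. pderivative i (f I))
      else (\<lambda>I. if i \<in> I then 0 else (- 1) ^ card {j\<in>I. j < i} *\<^sub>R f (insert i I)))"

section \<open>Vector fields and densities\<close>

text \<open>
  \<open>X :: vfield\<close> is the vector field \<open>\<Sum>\<^sub>i X\<^sup>i \<partial>\<^sub>i\<close>. Formulas whose signs refer to the parity of an
  object are applied to the homogeneous components of that object and summed up.
\<close>

type_synonym vfield = "nat \<Rightarrow> sfun"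

definition vpart :: "nat \<Rightarrow> nat \<Rightarrow> vfield \<Rightarrow> vfield" where
  "vpart p a X = (\<lambda>i. hpart (a + par p i) (X i))"

definition vact :: "nat \<Rightarrow> nat \<Rightarrow> vfield \<Rightarrow> sfun \<Rightarrow> sfun" where
  "vact p q X f = (\<Sum>i\<in>{1..p+q}. sprod (X i) (sderiv p i f))"

definition vdiv :: "nat \<Rightarrow> nat \<Rightarrow> vfield \<Rightarrow> sfun" where
  "vdiv p q X =
     (\<Sum>i\<in>{1..p+q}. \<Sum>a\<in>{0,1}. (- 1) ^ (par p i * a) *\<^sub>R sderiv p i (hpart a (X i)))"

definition density_lie :: "nat \<Rightarrow> nat \<Rightarrow> real \<Rightarrow> vfield \<Rightarrow> sfun \<Rightarrow> sfun" where
  "density_lie p q lam X f = vact p q X f + lam *\<^sub>R sprod (vdiv p q X) f"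

section \<open>The supersymmetric algebra\<close>

text \<open>
  \<open>v :: symv\<close> is \<open>\<Sum>\<^sub>\<alpha> v\<^sub>\<alpha> e\<^sup>\<alpha>\<close> with \<open>e\<^sup>\<alpha> = e\<^sub>1\<^sup>\<alpha>\<^sup>1 \<or> \<dots> \<or> e\<^sub>p\<^sub>+\<^sub>q\<^sup>\<alpha>\<^sup>p\<^sup>+\<^sup>q\<close>, the
  sum being over the multi-indices \<open>\<alpha>\<close> in \<open>MI p q\<close>; these \<open>e\<^sup>\<alpha>\<close> form a basis.
\<close>

type_synonym midx = "nat \<Rightarrow> nat"
type_synonym symv = "midx \<Rightarrow> real"

definition MI :: "nat \<Rightarrow> nat \<Rightarrow> midx set" where
  "MI p q = {\<alpha>. (\<forall>i. i \<notin> {1..p+q} \<longrightarrow> \<alpha> i = 0) \<and> (\<forall>i\<in>{p+1..p+q}. \<alpha> i \<le> 1)}"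

definition mdeg :: "nat \<Rightarrow> nat \<Rightarrow> midx \<Rightarrow> nat" where
  "mdeg p q \<alpha> = (\<Sum>i\<in>{1..p+q}. \<alpha> i)"

definition mono :: "midx \<Rightarrow> symv" where
  "mono \<alpha> = (\<lambda>\<beta>. if \<beta> = \<alpha> then 1 else 0)"

definition odd_supp :: "nat \<Rightarrow> nat \<Rightarrow> midx \<Rightarrow> nat set" where
  "odd_supp p q \<alpha> = {i\<in>{p+1..p+q}. \<alpha> i = 1}"

definition vee :: "nat \<Rightarrow> nat \<Rightarrow> symv \<Rightarrow> symv \<Rightarrow> symv" where
  "vee p q v w = (\<lambda>\<gamma>. if \<gamma> \<in> MI p q
     then \<Sum>\<alpha>\<in>{\<alpha>. \<forall>i. \<alpha> i \<le> \<gamma> i}.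
            ksign (odd_supp p q \<alpha>) (odd_supp p q (\<lambda>i. \<gamma> i - \<alpha> i)) * v \<alpha> * w (\<lambda>i. \<gamma> i - \<alpha> i)
     else 0)"

text \<open>Vectors \<open>\<Sum>\<^sub>i v\<^sup>i e\<^sub>i\<close> as elements of degree one, and products \<open>v\<^sub>1 \<or> \<dots> \<or> v\<^sub>k\<close>.\<close>

definition unit_vec :: "nat \<Rightarrow> nat \<Rightarrow> real" where
  "unit_vec i = (\<lambda>j. if j = i then 1 else 0)"

definition deg_one :: "nat \<Rightarrow> nat \<Rightarrow> (nat \<Rightarrow> real) \<Rightarrow> symv" where
  "deg_one p q v = (\<Sum>i\<in>{1..p+q}. v i *\<^sub>R mono (\<lambda>j. if j = i then 1 else 0))"

definition vee_list :: "nat \<Rightarrow> nat \<Rightarrow> (nat \<Rightarrow> real) list \<Rightarrow> symv" where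
  "vee_list p q vs = foldr (\<lambda>v. vee p q (deg_one p q v)) vs (mono (\<lambda>_. 0))"

text \<open>The increasing list of indices \<open>i\<^sub>1 \<le> \<dots> \<le> i\<^sub>k\<close> with \<open>e\<^sup>\<alpha> = e\<^sub>i\<^sub>1 \<or> \<dots> \<or> e\<^sub>i\<^sub>k\<close>.\<close>

definition word :: "nat \<Rightarrow> nat \<Rightarrow> midx \<Rightarrow> nat list" where
  "word p q \<alpha> = concat (map (\<lambda>i. replicate (\<alpha> i) i) [1..<p+q+1])"

text \<open>
  \<open>A i j\<close> is the entry in row \<open>i\<close> and column \<open>j\<close>. The operators \<open>\<rho>(A)\<close> and \<open>i(h)\<close> are given by
  their formulas on the basis elements \<open>e\<^sup>\<alpha>\<close>. The sum over \<open>a\<close> is over the homogeneous components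
  of \<open>A\<close>, resp. \<open>h\<close>.
\<close>

type_synonym mat = "nat \<Rightarrow> nat \<Rightarrow> real"

definition mpart :: "nat \<Rightarrow> nat \<Rightarrow> mat \<Rightarrow> mat" where
  "mpart p a A = (\<lambda>i j. if (par p i + par p j) mod 2 = a mod 2 then A i j else 0)"

definition supertrace :: "nat \<Rightarrow> nat \<Rightarrow> mat \<Rightarrow> real" where
  "supertrace p q A = (\<Sum>i\<in>{1..p+q}. (- 1) ^ par p i * A i i)"

definition rho_sym :: "nat \<Rightarrow> nat \<Rightarrow> mat \<Rightarrow> midx \<Rightarrow> symv" where
  "rho_sym p q A \<alpha> =
     (let w = word p q \<alpha> in
        \<Sum>a\<in>{0,1}. \<Sum>m<length w.
          (- 1) ^ (a * (\<Sum>l<m. par p (w ! l))) *\<^sub>R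
          vee_list p q ((map unit_vec w)[m := (\<lambda>i. mpart p a A i (w ! m))]))"

text \<open>The representation on \<open>S\<^sup>k\<^sub>\<delta> = B\<^sup>\<delta> \<otimes> S\<^sup>k\<close>; the even generator \<open>u\<close> of \<open>B\<^sup>\<delta>\<close> is omitted.\<close>

definition rho :: "nat \<Rightarrow> nat \<Rightarrow> real \<Rightarrow> mat \<Rightarrow> midx \<Rightarrow> symv" where
  "rho p q \<delta> A \<alpha> = (- \<delta> * supertrace p q A) *\<^sub>R mono \<alpha> + rho_sym p q A \<alpha>"

text \<open>\<open>elem_mat i j\<close> is \<open>e\<^sup>i\<^sub>j\<close>, which maps \<open>e\<^sub>i\<close> to \<open>e\<^sub>j\<close>.\<close>

definition elem_mat :: "nat \<Rightarrow> nat \<Rightarrow> mat" where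
  "elem_mat i j = (\<lambda>r c. if r = j \<and> c = i then 1 else 0)"

definition rpart :: "nat \<Rightarrow> nat \<Rightarrow> (nat \<Rightarrow> real) \<Rightarrow> nat \<Rightarrow> real" where
  "rpart p a h = (\<lambda>i. if par p i = a then h i else 0)"

definition interior_hom :: "nat \<Rightarrow> nat \<Rightarrow> nat \<Rightarrow> (nat \<Rightarrow> real) \<Rightarrow> midx \<Rightarrow> symv" where
  "interior_hom p q a h \<alpha> =
     (let w = word p q \<alpha> in
        \<Sum>m<length w.
          ((- 1) ^ (a * (\<Sum>l<m. par p (w ! l))) * h (w ! m)) *\<^sub>R
          vee_list p q (map unit_vec (take m w @ drop (Suc m) w)))"

section \<open>Symbols\<close>

text \<open>\<open>T :: symbol\<close> is \<open>\<Sum>\<^sub>\<alpha> T\<^sub>\<alpha> \<otimes> e\<^sup>\<alpha>\<close>. The underlying space of symbols does not depend on \<open>\<delta>\<close>.\<close>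

type_synonym symbol = "midx \<Rightarrow> sfun"

definition Sym :: "nat \<Rightarrow> nat \<Rightarrow> symbol set" where
  "Sym p q = {T. (\<forall>\<alpha>. T \<alpha> \<in> SF p q) \<and> {\<alpha>. T \<alpha> \<noteq> 0} \<subseteq> MI p q \<and> finite {\<alpha>. T \<alpha> \<noteq> 0}}"

definition SymK :: "nat \<Rightarrow> nat \<Rightarrow> nat \<Rightarrow> symbol set" where
  "SymK p q k = {T\<in>Sym p q. \<forall>\<alpha>. T \<alpha> \<noteq> 0 \<longrightarrow> mdeg p q \<alpha> = k}"

definition kpart :: "nat \<Rightarrow> nat \<Rightarrow> nat \<Rightarrow> symbol \<Rightarrow> symbol" where
  "kpart p q k T = (\<lambda>\<alpha>. if mdeg p q \<alpha> = k then T \<alpha> else 0)"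

definition tens :: "sfun \<Rightarrow> symv \<Rightarrow> symbol" where
  "tens f v = (\<lambda>\<alpha>. v \<alpha> *\<^sub>R f)"

text \<open>\<open>J\<^sub>i\<^sup>j\<close> for a homogeneous vector field \<open>X\<close> of parity \<open>a\<close>.\<close>

definition jac :: "nat \<Rightarrow> nat \<Rightarrow> vfield \<Rightarrow> nat \<Rightarrow> nat \<Rightarrow> sfun" where
  "jac p a X i j = (- 1) ^ (par p i * a + 1) *\<^sub>R sderiv p i (X j)"

text \<open>\<open>L\<^sub>X (f \<otimes> e\<^sup>\<alpha>)\<close> for homogeneous \<open>X\<close> of parity \<open>a\<close> and \<open>f\<close> of parity \<open>b\<close>.\<close>

definition symbol_lie_hom ::
  "nat \<Rightarrow> nat \<Rightarrow> real \<Rightarrow> nat \<Rightarrow> nat \<Rightarrow> vfield \<Rightarrow> sfun \<Rightarrow> midx \<Rightarrow> symbol" where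
  "symbol_lie_hom p q \<delta> a b X f \<alpha> =
     tens (vact p q X f) (mono \<alpha>) +
     (- 1) ^ (a * b) *\<^sub>R
       (\<Sum>i\<in>{1..p+q}. \<Sum>j\<in>{1..p+q}. tens (sprod f (jac p a X i j)) (rho p q \<delta> (elem_mat i j) \<alpha>))"

definition symbol_lie :: "nat \<Rightarrow> nat \<Rightarrow> real \<Rightarrow> vfield \<Rightarrow> symbol \<Rightarrow> symbol" where
  "symbol_lie p q \<delta> X T =
     (\<Sum>\<alpha> | T \<alpha> \<noteq> 0. \<Sum>a\<in>{0,1}. \<Sum>b\<in>{0,1}.
        symbol_lie_hom p q \<delta> a b (vpart p a X) (hpart b (T \<alpha>)) \<alpha>)"

definition interior :: "nat \<Rightarrow> nat \<Rightarrow> (nat \<Rightarrow> real) \<Rightarrow> symbol \<Rightarrow> symbol" where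
  "interior p q h T =
     (\<Sum>\<alpha> | T \<alpha> \<noteq> 0. \<Sum>a\<in>{0,1}. \<Sum>b\<in>{0,1}.
        (- 1) ^ (a * b) *\<^sub>R tens (hpart b (T \<alpha>)) (interior_hom p q a (rpart p a h) \<alpha>))"

definition symbol_div :: "nat \<Rightarrow> nat \<Rightarrow> symbol \<Rightarrow> symbol" where
  "symbol_div p q S =
     (\<Sum>j\<in>{1..p+q}. (- 1) ^ par p j *\<^sub>R interior p q (unit_vec j) (\<lambda>\<alpha>. sderiv p j (S \<alpha>)))"

section \<open>Differential operators\<close>

text \<open>
  Operators on the carrier \<open>SF p q\<close> are represented by functions that vanish outside of it.
  The underlying space of differential operators does not depend on the density weights.
\<close>

type_synonym oper = "sfun \<Rightarrow> sfun"

definition mderiv :: "nat \<Rightarrow> nat \<Rightarrow> midx \<Rightarrow> sfun \<Rightarrow> sfun" where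
  "mderiv p q \<alpha> f = foldr (\<lambda>i. sderiv p i ^^ \<alpha> i) [1..<p+q+1] f"

definition diffop :: "nat \<Rightarrow> nat \<Rightarrow> symbol \<Rightarrow> oper" where
  "diffop p q c = (\<lambda>f. if f \<in> SF p q then \<Sum>\<alpha> | c \<alpha> \<noteq> 0. sprod (c \<alpha>) (mderiv p q \<alpha> f) else 0)"

definition DO :: "nat \<Rightarrow> nat \<Rightarrow> oper set" where
  "DO p q = diffop p q ` Sym p q"

definition DOK :: "nat \<Rightarrow> nat \<Rightarrow> nat \<Rightarrow> oper set" where
  "DOK p q k = diffop p q ` {c\<in>Sym p q. \<forall>\<alpha>. c \<alpha> \<noteq> 0 \<longrightarrow> mdeg p q \<alpha> \<le> k}"

definition opart :: "nat \<Rightarrow> nat \<Rightarrow> nat \<Rightarrow> oper \<Rightarrow> oper" where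
  "opart p q b D = (\<lambda>f. if f \<in> SF p q then \<Sum>c\<in>{0,1}. hpart (b + c) (D (hpart c f)) else 0)"

definition oper_lie :: "nat \<Rightarrow> nat \<Rightarrow> real \<Rightarrow> real \<Rightarrow> vfield \<Rightarrow> oper \<Rightarrow> oper" where
  "oper_lie p q lam mu X D = (\<lambda>f. if f \<in> SF p q then
     \<Sum>a\<in>{0,1}. \<Sum>b\<in>{0,1}.
       density_lie p q mu (vpart p a X) (opart p q b D f)
       - (- 1) ^ (a * b) *\<^sub>R opart p q b D (density_lie p q lam (vpart p a X) f)
     else 0)"

definition total_symbol :: "nat \<Rightarrow> nat \<Rightarrow> oper \<Rightarrow> symbol" where
  "total_symbol p q D = (THE c. c \<in> Sym p q \<and> D = diffop p q c)"

definition principal_symbol :: "nat \<Rightarrow> nat \<Rightarrow> nat \<Rightarrow> oper \<Rightarrow> symbol" where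
  "principal_symbol p q k D = kpart p q k (total_symbol p q D)"

definition Q_Aff :: "nat \<Rightarrow> nat \<Rightarrow> symbol \<Rightarrow> oper" where
  "Q_Aff p q = the_inv_into (DO p q) (total_symbol p q)"

section \<open>The projective superalgebra and quantizations\<close>

definition field_minus :: "(nat \<Rightarrow> real) \<Rightarrow> vfield" where
  "field_minus v = (\<lambda>i. - v i *\<^sub>R sone)"

definition field_zero :: "nat \<Rightarrow> nat \<Rightarrow> mat \<Rightarrow> vfield" where
  "field_zero p q A =
     (\<lambda>i. - (\<Sum>j\<in>{1..p+q}. ((- 1) ^ (par p j * (par p i + par p j)) * A i j) *\<^sub>R coord p j))"

definition field_plus :: "nat \<Rightarrow> nat \<Rightarrow> (nat \<Rightarrow> real) \<Rightarrow> vfield" where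
  "field_plus p q \<xi> =
     (\<lambda>i. sprod (\<Sum>j\<in>{1..p+q}. (\<xi> j * (- 1) ^ par p j) *\<^sub>R coord p j) (coord p i))"

text \<open>
  The vector field of the class of \<open>M\<close> in \<open>gl(p+1|q)/R Id\<close>, where the rows and columns of \<open>M\<close> are
  indexed by \<open>0..p+q\<close>; other entries are not used. In the notation of block matrices,
  \<open>a = M 0 0\<close>, \<open>\<xi>\<close> is the rest of row \<open>0\<close> and \<open>h\<close> is the rest of column \<open>0\<close>.
\<close>

definition proj_field :: "nat \<Rightarrow> nat \<Rightarrow> mat \<Rightarrow> vfield" where
  "proj_field p q M =
     field_minus (\<lambda>i. M i 0) +
     field_zero p q (\<lambda>i j. M i j - (if i = j then M 0 0 else 0)) +
     field_plus p q (\<lambda>j. M 0 j)"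

definition quantization :: "nat \<Rightarrow> nat \<Rightarrow> (symbol \<Rightarrow> oper) \<Rightarrow> bool" where
  "quantization p q Q \<longleftrightarrow>
     (\<forall>S\<in>Sym p q. \<forall>T\<in>Sym p q. Q (S + T) = Q S + Q T) \<and>
     (\<forall>c. \<forall>T\<in>Sym p q. Q (c *\<^sub>R T) = c *\<^sub>R Q T) \<and>
     bij_betw Q (Sym p q) (DO p q) \<and>
     (\<forall>k. \<forall>T\<in>SymK p q k. Q T \<in> DOK p q k \<and> principal_symbol p q k (Q T) = T)"

text \<open>\<open>M\<close> ranges over representatives of the classes in \<open>gl(p+1|q)/R Id\<close>.\<close>

definition sl_equivariant ::
  "nat \<Rightarrow> nat \<Rightarrow> real \<Rightarrow> real \<Rightarrow> (symbol \<Rightarrow> oper) \<Rightarrow> bool" where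
  "sl_equivariant p q lam mu Q \<longleftrightarrow>
     (\<forall>M. \<forall>T\<in>Sym p q.
        oper_lie p q lam mu (proj_field p q M) (Q T) =
        Q (symbol_lie p q (mu - lam) (proj_field p q M) T))"

definition crit_alpha :: "nat \<Rightarrow> nat \<Rightarrow> nat \<Rightarrow> real \<Rightarrow> real" where
  "crit_alpha p q k \<delta> =
     (real p - real q) / 2 * \<delta>\<^sup>2
     - (2 * real k + real p - real q) / 2 * \<delta>
     + real k * (real k + (real p - real q)) / (real p - real q + 1)"

definition critical :: "nat \<Rightarrow> nat \<Rightarrow> real \<Rightarrow> bool" where
  "critical p q \<delta> \<longleftrightarrow> (\<exists>k l. l < k \<and> crit_alpha p q k \<delta> = crit_alpha p q l \<delta>)"

text \<open>
  The linear map with \<open>S \<mapsto> \<Sum>\<^sub>r\<^sub>\<le>\<^sub>k C\<^sub>k\<^sub>,\<^sub>r Q\<^sub>A\<^sub>f\<^sub>f (div\<^sup>r S)\<close> for \<open>S\<close> of degree \<open>k\<close>; the outer sum is over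
  the homogeneous components of \<open>S\<close>.
\<close>

definition div_map :: "nat \<Rightarrow> nat \<Rightarrow> (nat \<Rightarrow> nat \<Rightarrow> real) \<Rightarrow> symbol \<Rightarrow> oper" where
  "div_map p q C S = (\<lambda>f.
     \<Sum>k\<in>mdeg p q ` {\<alpha>. S \<alpha> \<noteq> 0}. \<Sum>r=0..k.
       C k r *\<^sub>R Q_Aff p q ((symbol_div p q ^^ r) (kpart p q k S)) f)"

end

theory Submission
  imports Defs
begin

text \<open>
  Multiplication by \<open>y\<^sup>i\<close>, \<open>\<partial>\<^sub>i\<close>, \<open>e\<^sub>i \<or> _\<close> and \<open>i(\<epsilon>\<^sup>i)\<close> generate a super Weyl algebra of operators on
  symbols, and a projective vector field acts on symbols by an element of it. Carried over to
  symbols by the total symbol map, the action on differential operators agrees with the action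
  on symbols for \<open>g\<^sub>-\<^sub>1\<close> and \<open>g\<^sub>0\<close>; for \<open>\<epsilon>\<^sup>j \<in> g\<^sub>1\<close> and symbols of degree \<open>k\<close> it differs by
  \<open>- (k - 1 + (p-q+1) \<lambda>) i(\<epsilon>\<^sup>j)\<close>. The divergence commutes with \<open>g\<^sub>-\<^sub>1\<close> and \<open>g\<^sub>0\<close>, while
  \<open>[div, L\<^sub>j] = - (p-q+2k-1-(p-q+1) \<delta>) i(\<epsilon>\<^sup>j)\<close> for \<open>L\<^sub>j\<close> the action of \<open>\<epsilon>\<^sup>j\<close> in degree \<open>k\<close>. Hence
  \<open>\<Sum>\<^sub>r C\<^sub>k\<^sub>,\<^sub>r div\<^sup>r\<close> intertwines the two actions as soon as
  \<open>r (p-q+2k-r-(p-q+1) \<delta>) C\<^sub>k\<^sub>,\<^sub>r = ((p-q+1) \<lambda> + k - r) C\<^sub>k\<^sub>,\<^sub>r\<^sub>-\<^sub>1\<close>.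

  For uniqueness, the Casimir operator acts on \<open>S\<^sup>k\<^sub>\<delta>\<close> as a scalar that is an affine function of
  \<open>\<alpha>(k,\<delta>)\<close>. If \<open>\<delta>\<close> is not critical, these scalars are distinct, so two equivariant quantizations
  send \<open>S\<^sup>k\<^sub>\<delta>\<close> to the same eigenspace of the Casimir operator on differential operators, where the
  principal symbol determines the operator.
\<close>

section \<open>Smooth functions\<close>

text \<open>Existence and uniqueness rest on the same numbers. On degree k the Casimir operator is
  the scalar 2(p-q+1) \<alpha>(k,\<delta>), and (p-q+1)(\<alpha>(k,\<delta>) -
  \<alpha>(k-r,\<delta>)) = r (p-q+2k-r-(p-q+1) \<delta>) is the left-hand factor of the recursion
  for \<open>C k r\<close>. So non-criticality keeps the denominators with r \<le> k away from 0 and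
  separates the degrees.

  The obstacle is the bookkeeping of signs: the definitions split fields, functions, matrices and
  operators into homogeneous parts, with signs depending on all of them. Two devices remove this.
  The grading automorphism \<open>twist\<close> produces (-1)^(ab) on a function of parity b without
  splitting it. Each action then becomes one word in generators whose only signs are (-1)^(par i *
  par j), and commutators are computed abstractly in the locale \<open>super_weyl\<close>. For
  operators, composition with y^i and d_i on either side must be expressed by the same generators;
  composition on the right is the harder one and is found by induction on the total symbol.\<close>

definition smooth0 :: "nat \<Rightarrow> (point \<Rightarrow> real) \<Rightarrow> bool" where
  "smooth0 p g \<longleftrightarrow> (\<forall>x y. (\<forall>i\<in>{1..p}. x i = y i) \<longrightarrow> g x = g y) \<and> continuous_on UNIV g \<and>
     (\<forall>i\<in>{1..p}. \<forall>x. (\<lambda>t. g (x(i := t))) differentiable (at (x i)))"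

text \<open>\<open>smooth0\<close> speaks only of the point's own coordinate; moving the point to
  \<open>x(i := s)\<close> frees the place of differentiation.\<close>

lemma smooth0_differentiable:
  assumes "smooth0 p g" "i \<in> {1..p}"
  shows "(\<lambda>t. g (x(i := t))) differentiable (at s)"
proof -
  have "(\<lambda>t. g ((x(i := s))(i := t))) differentiable (at ((x(i := s)) i))"
    using assms unfolding smooth0_def by blast
  then show ?thesis
    by simp
qed

lemma smooth0_has_derivative:
  assumes "smooth0 p g" "i \<in> {1..p}"
  shows "((\<lambda>t. g (x(i := t))) has_real_derivative pderivative i g (x(i := s))) (at s)"
  using smooth0_differentiable[OF assms, of x s]
  by (simp add: pderivative_def DERIV_deriv_iff_real_differentiable)

lemma smooth_imp_smooth0: "smooth p g \<Longrightarrow> smooth0 p g"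
  unfolding smooth_def smooth0_def by (auto dest!: bspec[of _ _ "[]"])

lemma pderivative_dep:
  assumes "\<And>x y. (\<forall>i\<in>{1..p}. x i = y i) \<Longrightarrow> g x = g y" "\<forall>i\<in>{1..p}. x i = y i" "i \<in> {1..p}"
  shows "pderivative i g x = pderivative i g y"
proof -
  have "(\<lambda>t. g (x(i := t))) = (\<lambda>t. g (y(i := t)))"
    using assms by (intro ext assms(1)) auto
  then show ?thesis
    unfolding pderivative_def using assms(2,3) by metis
qed

lemma smooth_pderivative:
  assumes "smooth p g" "i \<in> {1..p}"
  shows "smooth p (pderivative i g)"
proof -
  have "continuous_on UNIV (foldr pderivative is (pderivative i g)) \<and>
        (\<forall>j\<in>{1..p}. \<forall>x. (\<lambda>t. foldr pderivative is (pderivative i g) (x(j := t))) differentiable (at (x j)))"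
    if "is \<in> lists {1..p}" for "is"
  proof -
    \<comment> \<open>\<open>foldr\<close> applies the last entry first, so the derivative taken
      before all others goes to the end of the list.\<close>
    have "is @ [i] \<in> lists {1..p}"
      using that assms by auto
    then have "continuous_on UNIV (foldr pderivative (is @ [i]) g) \<and>
        (\<forall>j\<in>{1..p}. \<forall>x. (\<lambda>t. foldr pderivative (is @ [i]) g (x(j := t))) differentiable (at (x j)))"
      using assms(1) unfolding smooth_def by blast
    then show ?thesis
      by simp
  qed
  then show ?thesis
    using assms pderivative_dep[of p g _ _ i] unfolding smooth_def by blast
qed

text \<open>\<open>smooth\<close> is the greatest predicate below \<open>smooth0\<close> that is
  stable under partial derivatives. A class closed under \<open>pderivative\<close> is thus shown to
  be smooth without any formula for iterated derivatives.\<close>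

lemma smooth_coinduct:
  assumes "P g" "\<And>g. P g \<Longrightarrow> smooth0 p g" "\<And>g i. P g \<Longrightarrow> i \<in> {1..p} \<Longrightarrow> P (pderivative i g)"
  shows "smooth p g"
proof -
  have *: "P (foldr pderivative is g)" if "is \<in> lists {1..p}" for "is"
    using that by induction (simp_all add: assms)
  show ?thesis
    unfolding smooth_def using assms(2)[OF assms(1)] assms(2)[OF *] by (auto simp: smooth0_def)
qed

section \<open>Smoothness of coordinates, sums and products\<close>

lemma pderivative_const [simp]: "pderivative i (\<lambda>x. c) = (\<lambda>x. 0)"
  by (simp add: pderivative_def)

lemma pderivative_coord: "pderivative i (\<lambda>x. x j) = (\<lambda>x. if i = j then 1 else 0)"
  by (auto simp: pderivative_def fun_eq_iff)

lemma pderivative_add: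
  assumes "smooth0 p f" "smooth0 p g" "i \<in> {1..p}"
  shows "pderivative i (\<lambda>x. f x + g x) = (\<lambda>x. pderivative i f x + pderivative i g x)"
proof
  fix x :: point
  show "pderivative i (\<lambda>x. f x + g x) x = pderivative i f x + pderivative i g x"
    using DERIV_imp_deriv[OF DERIV_add[OF smooth0_has_derivative[OF assms(1,3), of x "x i"]
          smooth0_has_derivative[OF assms(2,3), of x "x i"]]]
    by (simp add: pderivative_def)
qed

lemma pderivative_mult:
  assumes "smooth0 p f" "smooth0 p g" "i \<in> {1..p}"
  shows "pderivative i (\<lambda>x. f x * g x) = (\<lambda>x. pderivative i f x * g x + f x * pderivative i g x)"
proof
  fix x :: point
  show "pderivative i (\<lambda>x. f x * g x) x = pderivative i f x * g x + f x * pderivative i g x"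
    using DERIV_imp_deriv[OF DERIV_mult[OF smooth0_has_derivative[OF assms(1,3), of x "x i"]
          smooth0_has_derivative[OF assms(2,3), of x "x i"]]]
    by (simp add: pderivative_def mult.commute)
qed

lemma smooth0_add: "smooth0 p f \<Longrightarrow> smooth0 p g \<Longrightarrow> smooth0 p (\<lambda>x. f x + g x)"
  unfolding smooth0_def by (auto intro!: continuous_intros derivative_intros) metis

lemma smooth0_mult: "smooth0 p f \<Longrightarrow> smooth0 p g \<Longrightarrow> smooth0 p (\<lambda>x. f x * g x)"
  unfolding smooth0_def by (auto intro!: continuous_intros derivative_intros) metis

text \<open>Products alone are not stable under partial derivatives, because the Leibniz rule
  creates sums. Finite sums of products are, so coinduction applies to them.\<close>

inductive smooth_alg :: "nat \<Rightarrow> (point \<Rightarrow> real) \<Rightarrow> bool" for p where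
  prod: "smooth p f \<Longrightarrow> smooth p g \<Longrightarrow> smooth_alg p (\<lambda>x. f x * g x)"
| sum: "smooth_alg p f \<Longrightarrow> smooth_alg p g \<Longrightarrow> smooth_alg p (\<lambda>x. f x + g x)"

lemma smooth_alg_smooth0: "smooth_alg p f \<Longrightarrow> smooth0 p f"
  by (induction rule: smooth_alg.induct) (auto intro: smooth0_add smooth0_mult smooth_imp_smooth0)

lemma smooth_alg_pderivative: "smooth_alg p f \<Longrightarrow> i \<in> {1..p} \<Longrightarrow> smooth_alg p (pderivative i f)"
proof (induction rule: smooth_alg.induct)
  case (prod f g)
  then show ?case
    by (simp add: pderivative_mult[of p] smooth_imp_smooth0 smooth_alg.intros smooth_pderivative)
next
  case (sum f g)
  then show ?case
    by (simp add: pderivative_add[of p] smooth_alg_smooth0 smooth_alg.intros)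
qed

lemma smooth_alg_smooth: "smooth_alg p f \<Longrightarrow> smooth p f"
  using smooth_coinduct[of "smooth_alg p"] smooth_alg_smooth0 smooth_alg_pderivative by blast

lemma smooth_const [simp]: "smooth p (\<lambda>x. c)"
  by (rule smooth_coinduct[of "\<lambda>g. \<exists>c. g = (\<lambda>x. c)"]) (auto simp: smooth0_def)

lemma differentiable_upd: "(\<lambda>t. if i = j then t else c) differentiable at (s::real)"
  by (cases "i = j") auto

lemma smooth_coord: "i \<in> {1..p} \<Longrightarrow> smooth p (\<lambda>x. x i)"
  by (rule smooth_coinduct[of "\<lambda>g. g = (\<lambda>x. x i) \<or> (\<exists>c. g = (\<lambda>x. c))"])
     (auto simp: smooth0_def pderivative_coord differentiable_upd)

lemma smooth_mult: "smooth p f \<Longrightarrow> smooth p g \<Longrightarrow> smooth p (\<lambda>x. f x * g x)"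
  by (simp add: smooth_alg_smooth smooth_alg.prod)

lemma smooth_add: "smooth p f \<Longrightarrow> smooth p g \<Longrightarrow> smooth p (\<lambda>x. f x + g x)"
  \<comment> \<open>A sum enters \<open>smooth_alg\<close> in the form f * 1 + g * 1.\<close>
  using smooth_alg_smooth[OF smooth_alg.sum[OF smooth_alg.prod[of p f "\<lambda>_. 1"] smooth_alg.prod[of p g "\<lambda>_. 1"]]]
  by simp

lemma smooth_cmult: "smooth p f \<Longrightarrow> smooth p (\<lambda>x. c * f x)"
  using smooth_mult[of p "\<lambda>_. c"] by simp

lemma pderivative_cmult:
  assumes "smooth0 p f" "i \<in> {1..p}"
  shows "pderivative i (\<lambda>x. c * f x) = (\<lambda>x. c * pderivative i f x)"
  using pderivative_mult[OF smooth_imp_smooth0[OF smooth_const[of p c]] assms] by simp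

lemma smooth_sum: "(\<And>a. a \<in> A \<Longrightarrow> smooth p (f a)) \<Longrightarrow> smooth p (\<lambda>x. \<Sum>a\<in>A. f a x)"
  by (induction A rule: infinite_finite_induct) (auto intro: smooth_add)

lemma pderivative_sum:
  "(\<And>a. a \<in> A \<Longrightarrow> smooth p (f a)) \<Longrightarrow> i \<in> {1..p} \<Longrightarrow>
    pderivative i (\<lambda>x. \<Sum>a\<in>A. f a x) = (\<lambda>x. \<Sum>a\<in>A. pderivative i (f a) x)"
  by (induction A rule: infinite_finite_induct)
     (simp_all add: pderivative_add[of p] smooth_imp_smooth0 smooth_sum)

section \<open>Symmetry of mixed partial derivatives\<close>

lemma mixed_second_difference:
  fixes G Gs Gst :: "real \<Rightarrow> real \<Rightarrow> real"
  assumes "\<And>s t. ((\<lambda>s. G s t) has_real_derivative Gs s t) (at s)"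
    and "\<And>s t. ((\<lambda>t. Gs s t) has_real_derivative Gst s t) (at t)"
    and "h > 0"
  shows "\<exists>u v. s < u \<and> u < s + h \<and> t < v \<and> v < t + h \<and>
     G (s + h) (t + h) - G (s + h) t - G s (t + h) + G s t = h * (h * Gst u v)"
proof -
  have "((\<lambda>s. G s (t + h) - G s t) has_real_derivative Gs u (t + h) - Gs u t) (at u)" for u
    by (intro derivative_intros assms)
  from MVT2[OF _ this, of s "s + h"] obtain u where u: "s < u" "u < s + h"
    "G (s + h) (t + h) - G (s + h) t - (G s (t + h) - G s t) = h * (Gs u (t + h) - Gs u t)"
    using assms(3) by auto
  from MVT2[OF _ assms(2), of t "t + h" u] obtain v where v: "t < v" "v < t + h"
    "Gs u (t + h) - Gs u t = h * Gst u v"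
    using assms(3) by auto
  show ?thesis
    by (rule exI[of _ u], rule exI[of _ v]) (use u v in auto)
qed

text \<open>The second difference over a square of side h is symmetric in the two variables. The
  mean value theorem, used in either order, makes it h^2 times one or the other mixed derivative at
  an inner point; continuity of both at the corner (a, b) forces their values there to
  agree.\<close>

lemma mixed_second_derivatives:
  fixes G Gs Gt Gst Gts :: "real \<Rightarrow> real \<Rightarrow> real"
  assumes Gs: "\<And>s t. ((\<lambda>s. G s t) has_real_derivative Gs s t) (at s)"
    and Gt: "\<And>s t. ((\<lambda>t. G s t) has_real_derivative Gt s t) (at t)"
    and Gst: "\<And>s t. ((\<lambda>t. Gs s t) has_real_derivative Gst s t) (at t)"
    and Gts: "\<And>s t. ((\<lambda>s. Gt s t) has_real_derivative Gts s t) (at s)"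
    and "isCont (\<lambda>z. Gst (fst z) (snd z)) (a, b)" and "isCont (\<lambda>z. Gts (fst z) (snd z)) (a, b)"
  shows "Gst a b = Gts a b"
proof (rule ccontr)
  assume ne: "Gst a b \<noteq> Gts a b"
  \<comment> \<open>Half the supposed gap: two equal numbers cannot each be closer than this to
    their own end of the gap.\<close>
  define e where "e = \<bar>Gst a b - Gts a b\<bar> / 2"
  have e: "e > 0"
    using ne by (simp add: e_def)
  obtain d1 where d1: "d1 > 0" "\<And>z. dist z (a, b) < d1 \<Longrightarrow> dist (Gst (fst z) (snd z)) (Gst a b) < e"
    using assms(5) e unfolding continuous_at_eps_delta by fastforce
  obtain d2 where d2: "d2 > 0" "\<And>z. dist z (a, b) < d2 \<Longrightarrow> dist (Gts (fst z) (snd z)) (Gts a b) < e"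
    using assms(6) e unfolding continuous_at_eps_delta by fastforce
  define h where "h = min d1 d2 / 2"
  have h: "h > 0" "2 * h \<le> d1" "2 * h \<le> d2"
    using d1(1) d2(1) by (auto simp: h_def)
  obtain u v where uv: "a < u" "u < a + h" "b < v" "v < b + h"
    "G (a + h) (b + h) - G (a + h) b - G a (b + h) + G a b = h * (h * Gst u v)"
    using mixed_second_difference[of G Gs Gst h a b, OF Gs Gst h(1)] by auto
  \<comment> \<open>The same second difference with the roles of the two variables
    exchanged.\<close>
  obtain w z where wz: "b < w" "w < b + h" "a < z" "z < a + h"
    "G (a + h) (b + h) - G a (b + h) - G (a + h) b + G a b = h * (h * Gts z w)"
    using mixed_second_difference[of "\<lambda>s t. G t s" "\<lambda>s t. Gt t s" "\<lambda>s t. Gts t s" h b a, OF Gt Gts h(1)] by auto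
  have dist_lt: "dist (x, y) (a, b) < 2 * h" if "a < x" "x < a + h" "b < y" "y < b + h" for x y
  proof -
    have "dist (x, y) (a, b) \<le> dist x a + dist y b"
      by (simp add: dist_Pair_Pair sqrt_sum_squares_le_sum)
    then show ?thesis
      using that by (simp add: dist_real_def)
  qed
  have "Gst u v = Gts z w"
    using uv(5) wz(5) h(1) by (simp add: algebra_simps)
  moreover have "dist (Gst u v) (Gst a b) < e"
    using d1(2)[of "(u, v)"] dist_lt[of u v] uv h by simp
  moreover have "dist (Gts z w) (Gts a b) < e"
    using d2(2)[of "(z, w)"] dist_lt[of z w] wz h by simp
  ultimately show False
    by (simp add: e_def dist_real_def) argo
qed

text \<open>Freezing all coordinates except i and j reduces the claim to a function of two real
  variables.\<close>

lemma pderivative_commute: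
  assumes "smooth p g" "i \<in> {1..p}" "j \<in> {1..p}"
  shows "pderivative i (pderivative j g) = pderivative j (pderivative i g)"
proof (cases "i = j")
  case False
  show ?thesis
  proof
    fix x :: point
    have cont: "isCont (\<lambda>z. f (x(i := fst z, j := snd z))) w" if "smooth p f" for f and w :: "real \<times> real"
    proof -
      have "continuous_on UNIV f"
        using smooth_imp_smooth0[OF that] by (simp add: smooth0_def)
      moreover have "continuous_on UNIV (\<lambda>z::real \<times> real. x(i := fst z, j := snd z))"
      proof (rule continuous_on_coordinatewise_then_product)
        show "continuous_on UNIV (\<lambda>z::real \<times> real. (x(i := fst z, j := snd z)) l)" for l
          by (cases "l = j"; cases "l = i") (auto intro!: continuous_intros)
      qed
      ultimately have "continuous_on UNIV (\<lambda>z::real \<times> real. f (x(i := fst z, j := snd z)))"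
        by (metis continuous_on_compose2 subset_UNIV)
      then show ?thesis
        by (simp add: continuous_on_eq_continuous_at del: split_paired_All)
    qed
    have der: "((\<lambda>t. f (x(i := s, j := t))) has_real_derivative pderivative j f (x(i := s, j := t))) (at t)"
      "((\<lambda>s. f (x(i := s, j := t))) has_real_derivative pderivative i f (x(i := s, j := t))) (at s)"
      if "smooth p f" for f s t
      using smooth0_has_derivative[OF smooth_imp_smooth0[OF that] assms(3), of "x(i := s)"]
        smooth0_has_derivative[OF smooth_imp_smooth0[OF that] assms(2), of "x(j := t)"] False
      by (simp_all add: fun_upd_twist)
    have "pderivative j (pderivative i g) (x(i := x i, j := x j)) =
        pderivative i (pderivative j g) (x(i := x i, j := x j))"
      by (rule mixed_second_derivatives[where
            G = "\<lambda>s t. g (x(i := s, j := t))" and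
            Gs = "\<lambda>s t. pderivative i g (x(i := s, j := t))" and
            Gt = "\<lambda>s t. pderivative j g (x(i := s, j := t))" and
            Gst = "\<lambda>s t. pderivative j (pderivative i g) (x(i := s, j := t))" and
            Gts = "\<lambda>s t. pderivative i (pderivative j g) (x(i := s, j := t))"])
         (use assms in \<open>auto intro!: der cont smooth_pderivative\<close>)
    then show "pderivative i (pderivative j g) x = pderivative j (pderivative i g) x"
      by simp
  qed
qed simp

section \<open>Super Weyl algebras\<close>

text \<open>On symbols, \<open>Y\<close> is multiplication by the coordinates, \<open>D\<close> are the partial derivatives, \<open>E\<close> is
  \<open>e\<^sub>i \<or> _\<close> and \<open>I\<close> is \<open>i(\<epsilon>\<^sup>i)\<close>. Composing operators with coordinates and derivatives on the
  right is expressed by the same four families.\<close>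

locale super_weyl =
  fixes V :: "'v::real_vector set" and N :: "nat set" and par :: "nat \<Rightarrow> nat"
    and Y D E I :: "nat \<Rightarrow> 'v \<Rightarrow> 'v"
  assumes subspace_V: "subspace V" and finite_N: "finite N"
    and closed [simp]: "i \<in> N \<Longrightarrow> x \<in> V \<Longrightarrow> Y i x \<in> V" "i \<in> N \<Longrightarrow> x \<in> V \<Longrightarrow> D i x \<in> V"
      "i \<in> N \<Longrightarrow> x \<in> V \<Longrightarrow> E i x \<in> V" "i \<in> N \<Longrightarrow> x \<in> V \<Longrightarrow> I i x \<in> V"
    and op_add [simp]: "i \<in> N \<Longrightarrow> x \<in> V \<Longrightarrow> y \<in> V \<Longrightarrow> Y i (x + y) = Y i x + Y i y"
      "i \<in> N \<Longrightarrow> x \<in> V \<Longrightarrow> y \<in> V \<Longrightarrow> D i (x + y) = D i x + D i y"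
      "i \<in> N \<Longrightarrow> x \<in> V \<Longrightarrow> y \<in> V \<Longrightarrow> E i (x + y) = E i x + E i y"
      "i \<in> N \<Longrightarrow> x \<in> V \<Longrightarrow> y \<in> V \<Longrightarrow> I i (x + y) = I i x + I i y"
    and op_scaleR [simp]: "i \<in> N \<Longrightarrow> x \<in> V \<Longrightarrow> Y i (c *\<^sub>R x) = c *\<^sub>R Y i x"
      "i \<in> N \<Longrightarrow> x \<in> V \<Longrightarrow> D i (c *\<^sub>R x) = c *\<^sub>R D i x"
      "i \<in> N \<Longrightarrow> x \<in> V \<Longrightarrow> E i (c *\<^sub>R x) = c *\<^sub>R E i x"
      "i \<in> N \<Longrightarrow> x \<in> V \<Longrightarrow> I i (c *\<^sub>R x) = c *\<^sub>R I i x"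
    and YY: "\<And>i j x. i \<in> N \<Longrightarrow> j \<in> N \<Longrightarrow> x \<in> V \<Longrightarrow> Y i (Y j x) = (- 1) ^ (par i * par j) *\<^sub>R Y j (Y i x)"
    and DD: "\<And>i j x. i \<in> N \<Longrightarrow> j \<in> N \<Longrightarrow> x \<in> V \<Longrightarrow> D i (D j x) = (- 1) ^ (par i * par j) *\<^sub>R D j (D i x)"
    and EE: "\<And>i j x. i \<in> N \<Longrightarrow> j \<in> N \<Longrightarrow> x \<in> V \<Longrightarrow> E i (E j x) = (- 1) ^ (par i * par j) *\<^sub>R E j (E i x)"
    and II: "\<And>i j x. i \<in> N \<Longrightarrow> j \<in> N \<Longrightarrow> x \<in> V \<Longrightarrow> I i (I j x) = (- 1) ^ (par i * par j) *\<^sub>R I j (I i x)"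
    and EY: "\<And>i j x. i \<in> N \<Longrightarrow> j \<in> N \<Longrightarrow> x \<in> V \<Longrightarrow> E i (Y j x) = (- 1) ^ (par i * par j) *\<^sub>R Y j (E i x)"
    and IY: "\<And>i j x. i \<in> N \<Longrightarrow> j \<in> N \<Longrightarrow> x \<in> V \<Longrightarrow> I i (Y j x) = (- 1) ^ (par i * par j) *\<^sub>R Y j (I i x)"
    and DE: "\<And>i j x. i \<in> N \<Longrightarrow> j \<in> N \<Longrightarrow> x \<in> V \<Longrightarrow> D i (E j x) = (- 1) ^ (par i * par j) *\<^sub>R E j (D i x)"
    and ID: "\<And>i j x. i \<in> N \<Longrightarrow> j \<in> N \<Longrightarrow> x \<in> V \<Longrightarrow> I i (D j x) = (- 1) ^ (par i * par j) *\<^sub>R D j (I i x)"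
    and DY: "\<And>i j x. i \<in> N \<Longrightarrow> j \<in> N \<Longrightarrow> x \<in> V \<Longrightarrow>
      D i (Y j x) = (- 1) ^ (par i * par j) *\<^sub>R Y j (D i x) + (if i = j then x else 0)"
    and IE: "\<And>i j x. i \<in> N \<Longrightarrow> j \<in> N \<Longrightarrow> x \<in> V \<Longrightarrow>
      I i (E j x) = (- 1) ^ (par i * par j) *\<^sub>R E j (I i x) + (if i = j then x else 0)"
begin

text \<open>The Euler field, the degree of a symbol, multiplication by the symbol of the Euler
  field, and the divergence. With D to the left of I the divergence carries no sign: the usual
  factor (-1)^(par i) belongs to the opposite order.\<close>

definition "Eul x = (\<Sum>i\<in>N. Y i (D i x))"
definition "Deg x = (\<Sum>i\<in>N. E i (I i x))"
definition "YE x = (\<Sum>i\<in>N. Y i (E i x))"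
definition "Div x = (\<Sum>i\<in>N. D i (I i x))"

lemma V_closed [simp]: "0 \<in> V" "x \<in> V \<Longrightarrow> y \<in> V \<Longrightarrow> x + y \<in> V" "x \<in> V \<Longrightarrow> c *\<^sub>R x \<in> V"
  "x \<in> V \<Longrightarrow> y \<in> V \<Longrightarrow> x - y \<in> V" "x \<in> V \<Longrightarrow> - x \<in> V"
  "(\<And>a. a \<in> A \<Longrightarrow> f a \<in> V) \<Longrightarrow> sum f A \<in> V"
  using subspace_V by (auto simp: subspace_0 subspace_add subspace_scale subspace_diff subspace_neg intro: subspace_sum)

lemma Eul_in [simp]: "x \<in> V \<Longrightarrow> Eul x \<in> V"
  and Deg_in [simp]: "x \<in> V \<Longrightarrow> Deg x \<in> V"
  and YE_in [simp]: "x \<in> V \<Longrightarrow> YE x \<in> V"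
  and Div_in [simp]: "x \<in> V \<Longrightarrow> Div x \<in> V"
  by (simp_all add: Eul_def Deg_def YE_def Div_def)

text \<open>The operators are total functions whose values matter on the carrier only, so linearity
  is asked for there.\<close>

definition linop :: "('v \<Rightarrow> 'v) \<Rightarrow> bool" where
  "linop T \<longleftrightarrow> (\<forall>x\<in>V. T x \<in> V) \<and> (\<forall>x\<in>V. \<forall>y\<in>V. T (x + y) = T x + T y) \<and> (\<forall>c. \<forall>x\<in>V. T (c *\<^sub>R x) = c *\<^sub>R T x)"

lemma linopD:
  assumes "linop T"
  shows "x \<in> V \<Longrightarrow> T x \<in> V" "x \<in> V \<Longrightarrow> y \<in> V \<Longrightarrow> T (x + y) = T x + T y"
    "x \<in> V \<Longrightarrow> T (c *\<^sub>R x) = c *\<^sub>R T x" "T 0 = 0" "x \<in> V \<Longrightarrow> T (- x) = - T x"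
    "x \<in> V \<Longrightarrow> y \<in> V \<Longrightarrow> T (x - y) = T x - T y"
proof -
  show 1: "x \<in> V \<Longrightarrow> T x \<in> V" and 2: "x \<in> V \<Longrightarrow> y \<in> V \<Longrightarrow> T (x + y) = T x + T y"
    and 3: "x \<in> V \<Longrightarrow> T (c *\<^sub>R x) = c *\<^sub>R T x" for x y c
    using assms by (auto simp: linop_def)
  show "T 0 = 0"
    using 3[of 0 0] by simp
  show 4: "x \<in> V \<Longrightarrow> T (- x) = - T x" for x
    using 3[of x "-1"] by simp
  show "x \<in> V \<Longrightarrow> y \<in> V \<Longrightarrow> T (x - y) = T x - T y"
    using 2[of x "- y"] 4[of y] by simp
qed

lemma linop_sum:
  assumes "linop T"
  shows "(\<And>a. a \<in> A \<Longrightarrow> f a \<in> V) \<Longrightarrow> T (\<Sum>a\<in>A. f a) = (\<Sum>a\<in>A. T (f a))"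
  by (induction A rule: infinite_finite_induct) (simp_all add: linopD[OF assms])

lemma linop_gen: "i \<in> N \<Longrightarrow> linop (Y i)" "i \<in> N \<Longrightarrow> linop (D i)" "i \<in> N \<Longrightarrow> linop (E i)" "i \<in> N \<Longrightarrow> linop (I i)"
  by (simp_all add: linop_def)

lemma linop_quad: "linop Eul" "linop Deg" "linop YE" "linop Div"
  by (simp_all add: linop_def Eul_def Deg_def YE_def Div_def sum.distrib scaleR_right.sum)

lemmas gen_simps [simp] = linop_gen[THEN linopD(4)] linop_gen[THEN linopD(5)] linop_gen[THEN linopD(6)]
  linop_quad[THEN linopD(2)] linop_quad[THEN linopD(3)] linop_quad[THEN linopD(4)]
  linop_quad[THEN linopD(5)] linop_quad[THEN linopD(6)]

lemmas gen_sum = linop_gen[THEN linop_sum] linop_quad[THEN linop_sum]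

lemma sum_delta_N [simp]: "j \<in> N \<Longrightarrow> (\<Sum>i\<in>N. if i = j then f i else 0) = (f j :: 'v)"
  "j \<in> N \<Longrightarrow> (\<Sum>i\<in>N. if j = i then f i else 0) = (f j :: 'v)"
  by (simp_all add: finite_N)

lemma minus_one_power_square [simp]:
  "((- 1) ^ k * (- 1) ^ k :: real) = 1" "(- 1) ^ k *\<^sub>R (- 1) ^ k *\<^sub>R (x::'v) = x"
  "(- 1) ^ (k * l) *\<^sub>R (- 1) ^ (l * k) *\<^sub>R (x::'v) = x"
  by (simp_all add: power_mult_distrib[symmetric] mult.commute[of l k])

text \<open>A natural number and its square have the same parity.\<close>

lemma pm: "(- 1) ^ (par j * par j) = ((- 1) ^ par j :: real)"
  by (cases "even (par j)") auto

section \<open>Commutators of the generators with the quadratic elements\<close>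

context
  fixes j x assumes j: "j \<in> N" and x: "x \<in> V"
begin

text \<open>The quadratic elements are even: moving both factors past a generator gives the same
  sign twice, so ordinary commutators remain and only the Kronecker terms of \<open>DY\<close> and
  \<open>IE\<close> survive. The sign here is that of I passing Y before D contracts it.\<close>

lemma Div_Y: "Div (Y j x) = Y j (Div x) + (- 1) ^ par j *\<^sub>R I j x"
proof -
  have "D i (I i (Y j x)) = Y j (D i (I i x)) + (if i = j then (- 1) ^ par j *\<^sub>R I j x else 0)" if "i \<in> N" for i
    using j x that by (simp add: IY DY scaleR_add_right pm)
  then show ?thesis
    using j x by (simp add: Div_def sum.distrib gen_sum)
qed

lemma Div_E: "Div (E j x) = E j (Div x) + D j x"
proof -
  have "D i (I i (E j x)) = E j (D i (I i x)) + (if i = j then D i x else 0)" if "i \<in> N" for i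
    using j x that by (simp add: IE DE)
  then show ?thesis
    using j x by (simp add: Div_def sum.distrib gen_sum)
qed

lemma Div_D: "Div (D j x) = D j (Div x)"
proof -
  have "D i (I i (D j x)) = D j (D i (I i x))" if "i \<in> N" for i
    using j x that by (simp add: ID DD[of i j])
  then show ?thesis
    using j x by (simp add: Div_def gen_sum)
qed

lemma Div_I: "Div (I j x) = I j (Div x)"
proof -
  have "D i (I i (I j x)) = I j (D i (I i x))" if "i \<in> N" for i
    using j x that by (simp add: ID II[of i j] mult.commute[of "par j"])
  then show ?thesis
    using j x by (simp add: Div_def gen_sum)
qed

lemma D_Eul: "D j (Eul x) = Eul (D j x) + D j x"
proof -
  have "D j (Y i (D i x)) = Y i (D i (D j x)) + (if j = i then D i x else 0)" if "i \<in> N" for i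
    using j x that by (simp add: DY DD[of j i])
  then show ?thesis
    using j x by (simp add: Eul_def sum.distrib gen_sum)
qed

lemma Eul_I: "Eul (I j x) = I j (Eul x)"
proof -
  have "Y i (D i (I j x)) = I j (Y i (D i x))" if "i \<in> N" for i
    using j x that by (simp add: ID IY)
  then show ?thesis
    using j x by (simp add: Eul_def gen_sum)
qed

lemma Deg_E: "Deg (E j x) = E j (Deg x) + E j x"
proof -
  have "E i (I i (E j x)) = E j (E i (I i x)) + (if i = j then E i x else 0)" if "i \<in> N" for i
    using j x that by (simp add: IE EE[of i j])
  then show ?thesis
    using j x by (simp add: Deg_def sum.distrib gen_sum)
qed

lemma I_Deg: "I j (Deg x) = Deg (I j x) + I j x"
proof -
  have "I j (E i (I i x)) = E i (I i (I j x)) + (if j = i then I i x else 0)" if "i \<in> N" for i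
    using j x that by (simp add: IE II[of j i])
  then show ?thesis
    using j x by (simp add: Deg_def sum.distrib gen_sum)
qed

lemma Deg_Y: "Deg (Y j x) = Y j (Deg x)"
proof -
  have "E i (I i (Y j x)) = Y j (E i (I i x))" if "i \<in> N" for i
    using j x that by (simp add: IY EY)
  then show ?thesis
    using j x by (simp add: Deg_def gen_sum)
qed

lemma Deg_D: "Deg (D j x) = D j (Deg x)"
proof -
  have "E i (I i (D j x)) = D j (E i (I i x))" if "i \<in> N" for i
    using j x that by (simp add: ID DE mult.commute[of "par j"])
  then show ?thesis
    using j x by (simp add: Deg_def gen_sum)
qed

lemma YE_Y: "YE (Y j x) = Y j (YE x)"
proof -
  have "Y i (E i (Y j x)) = Y j (Y i (E i x))" if "i \<in> N" for i
    using j x that by (simp add: EY YY[of i j])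
  then show ?thesis
    using j x by (simp add: YE_def gen_sum)
qed

end

section \<open>The divergence and the projective action\<close>

definition "sdim = (\<Sum>i\<in>N. (- 1) ^ par i :: real)"

text \<open>The actions on symbols of weight \<delta> of the fields of e_i in g_-1, of the matrix
  unit in row i and column j of g_0, and of \<epsilon>^j in g_1; \<open>hlie_Fminus\<close>,
  \<open>hlie_Fzero\<close> and \<open>hlie_Fplus\<close> confirm this. The factor
  \<open>sdim + 1\<close> is that of the divergence of the quadratic fields.\<close>

definition "Lminus i x = - D i x"

definition "Lzero \<delta> i j x = E i (I j x) - (- 1) ^ (par j * (par i + par j)) *\<^sub>R Y j (D i x)
  - (\<delta> * (if i = j then (- 1) ^ par i else 0)) *\<^sub>R x"

definition "Lplus \<delta> j x =
  (- 1) ^ par j *\<^sub>R Y j (Eul x - Deg x + ((sdim + 1) * \<delta>) *\<^sub>R x) - YE (I j x)"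

lemma L_in [simp]: "i \<in> N \<Longrightarrow> x \<in> V \<Longrightarrow> Lminus i x \<in> V"
  "i \<in> N \<Longrightarrow> j \<in> N \<Longrightarrow> x \<in> V \<Longrightarrow> Lzero \<delta> i j x \<in> V" "j \<in> N \<Longrightarrow> x \<in> V \<Longrightarrow> Lplus \<delta> j x \<in> V"
  by (simp_all add: Lminus_def Lzero_def Lplus_def)

lemma ID_same: "i \<in> N \<Longrightarrow> x \<in> V \<Longrightarrow> (- 1) ^ par i *\<^sub>R I i (D i x) = D i (I i x)"
  by (simp add: ID pm)

lemma Div_Eul: "x \<in> V \<Longrightarrow> Div (Eul x) = Eul (Div x) + Div x"
proof -
  assume x: "x \<in> V"
  have "Div (Y i (D i x)) = Y i (D i (Div x)) + D i (I i x)" if "i \<in> N" for i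
    using that x by (simp add: Div_Y Div_D ID_same)
  then show ?thesis
    using x by (simp add: Eul_def gen_sum sum.distrib) (simp add: Div_def)
qed

lemma Div_Deg: "x \<in> V \<Longrightarrow> Div (Deg x) = Deg (Div x) + Div x"
proof -
  assume x: "x \<in> V"
  have "Div (E i (I i x)) = E i (I i (Div x)) + D i (I i x)" if "i \<in> N" for i
    using that x by (simp add: Div_E Div_I)
  then show ?thesis
    using x by (simp add: Deg_def gen_sum sum.distrib) (simp add: Div_def)
qed

text \<open>The scalar is an ordering effect: each index contributes (-1)^(par i) when I_i is moved
  past E_i, and these add up to the superdimension.\<close>

lemma Div_YE: "x \<in> V \<Longrightarrow> Div (YE x) = YE (Div x) + Eul x + Deg x + sdim *\<^sub>R x"
proof -
  assume x: "x \<in> V"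
  have "Div (Y i (E i x)) = Y i (E i (Div x)) + Y i (D i x) + E i (I i x) + (- 1) ^ par i *\<^sub>R x" if "i \<in> N" for i
    using that x by (simp add: Div_Y Div_E IE pm scaleR_add_right)
  then show ?thesis
    using x by (simp add: YE_def gen_sum sum.distrib) (simp add: Eul_def Deg_def sdim_def scaleR_left.sum)
qed

lemma Div_Lminus: "i \<in> N \<Longrightarrow> x \<in> V \<Longrightarrow> Div (Lminus i x) = Lminus i (Div x)"
  by (simp add: Lminus_def Div_D)

text \<open>The two halves of the divergence transform dually under g_0: the term D_i I_j that
  arises from E_i I_j cancels the one that arises from Y_j D_i.\<close>

lemma Div_Lzero:
  assumes "i \<in> N" "j \<in> N" "x \<in> V"
  shows "Div (Lzero \<delta> i j x) = Lzero \<delta> i j (Div x)"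
  using assms by (simp add: Lzero_def Div_Y Div_D Div_E Div_I ID)
    (auto simp: minus_one_power_iff)

text \<open>Free of any assumption on the degree, because the two terms with \<open>Deg\<close> are
  left unevaluated. On degree k they contribute k and k - 1, hence the 2k - 1 in the
  commutator.\<close>

lemma Div_Lplus:
  assumes "j \<in> N" "x \<in> V"
  shows "Div (Lplus \<delta> j x) = Lplus \<delta> j (Div x) - I j (Deg x) - Deg (I j x) + ((sdim + 1) * \<delta> - sdim) *\<^sub>R I j x"
  using assms
  by (simp add: Lplus_def Div_Y Div_I Div_YE Div_Eul Div_Deg Eul_I scaleR_add_right scaleR_diff_right)
    (simp add: algebra_simps)

lemma Div_pow_in [simp]: "x \<in> V \<Longrightarrow> (Div ^^ r) x \<in> V"
  by (induction r) auto

text \<open>The eigenvalue is a real number, not a truncated natural one. It can become negative,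
  and no nonzero symbol has a negative degree.\<close>

lemma Deg_Div:
  assumes "x \<in> V" "Deg x = k *\<^sub>R x"
  shows "Deg ((Div ^^ r) x) = (k - real r) *\<^sub>R (Div ^^ r) x"
proof (induction r)
  case (Suc r)
  have "Deg ((Div ^^ Suc r) x) = Div (Deg ((Div ^^ r) x)) - Div ((Div ^^ r) x)"
    using assms(1) by (simp add: Div_Deg)
  then show ?case
    using Suc assms(1) by (simp add: algebra_simps)
qed (use assms in simp)

lemma Div_pow_Lminus: "i \<in> N \<Longrightarrow> x \<in> V \<Longrightarrow> (Div ^^ r) (Lminus i x) = Lminus i ((Div ^^ r) x)"
  by (induction r) (simp_all add: Div_Lminus)

lemma Div_pow_Lzero:
  "i \<in> N \<Longrightarrow> j \<in> N \<Longrightarrow> x \<in> V \<Longrightarrow> (Div ^^ r) (Lzero \<delta> i j x) = Lzero \<delta> i j ((Div ^^ r) x)"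
  by (induction r) (simp_all add: Div_Lzero)

lemma Deg_I:
  assumes "j \<in> N" "x \<in> V" "Deg x = k *\<^sub>R x"
  shows "Deg (I j x) = (k - 1) *\<^sub>R I j x"
  using I_Deg[OF assms(1,2)] assms by (simp add: algebra_simps)

text \<open>Splits factors 2, so that rewriting recognizes \<open>2 *\<^sub>R v\<close> and
  \<open>v + v\<close> as equal when terms cancel.\<close>

lemma double: "2 *\<^sub>R v = v + (v::'v)" "(2 * d) *\<^sub>R v = d *\<^sub>R v + d *\<^sub>R v" "(c * 2) *\<^sub>R v = c *\<^sub>R v + c *\<^sub>R v"
  "(c * (d * 2)) *\<^sub>R v = (c * d) *\<^sub>R v + (c * d) *\<^sub>R v" "(c * (2 * d)) *\<^sub>R v = (c * d) *\<^sub>R v + (c * d) *\<^sub>R v"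
  "(c * (d * (2 * e))) *\<^sub>R v = (c * (d * e)) *\<^sub>R v + (c * (d * e)) *\<^sub>R v"
  by (simp_all add: scaleR_2 mult.left_commute[of _ 2] mult.commute[of _ 2] flip: scaleR_scaleR)

text \<open>The single commutators occur on the degrees k, k - 1, ..., k - r + 1. Over l < r the
  numbers 2(k - l) - 1 add up to r (2k - r), and the part independent of the degree is multiplied by
  r.\<close>

lemma Div_pow_Lplus:
  assumes "j \<in> N" "x \<in> V" "Deg x = k *\<^sub>R x"
  shows "(Div ^^ r) (Lplus \<delta> j x) = Lplus \<delta> j ((Div ^^ r) x)
    - (real r * (sdim + 2 * k - real r - (sdim + 1) * \<delta>)) *\<^sub>R I j ((Div ^^ (r - 1)) x)"
proof (induction r)
  case (Suc r)
  define z where "z = (Div ^^ r) x"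
  have z: "z \<in> V" "Deg z = (k - real r) *\<^sub>R z" "Deg (I j z) = (k - real r - 1) *\<^sub>R I j z"
    using assms Deg_Div Deg_I by (auto simp: z_def)
  \<comment> \<open>For r = 0 the exponent r - 1 is truncated to 0; the factor \<open>real r\<close>
    keeps the identity true.\<close>
  have "real r *\<^sub>R Div (I j ((Div ^^ (r - 1)) x)) = real r *\<^sub>R I j z"
  proof (cases r)
    case (Suc l)
    then show ?thesis
      using assms by (simp add: z_def Div_I)
  qed simp
  then have 1: "Div ((real r * c) *\<^sub>R I j ((Div ^^ (r - 1)) x)) = (real r * c) *\<^sub>R I j z" for c
    using assms by (simp add: mult.commute[of "real r"] flip: scaleR_scaleR)
  have "(Div ^^ Suc r) (Lplus \<delta> j x) = Div (Lplus \<delta> j z) -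
      (real r * (sdim + 2 * k - real r - (sdim + 1) * \<delta>)) *\<^sub>R I j z"
  proof -
    have "(Div ^^ Suc r) (Lplus \<delta> j x) = Div (Lplus \<delta> j z -
        (real r * (sdim + 2 * k - real r - (sdim + 1) * \<delta>)) *\<^sub>R I j ((Div ^^ (r - 1)) x))"
      using Suc by (simp add: z_def)
    also have "\<dots> = Div (Lplus \<delta> j z) -
        Div ((real r * (sdim + 2 * k - real r - (sdim + 1) * \<delta>)) *\<^sub>R I j ((Div ^^ (r - 1)) x))"
      using assms z(1) by (intro linopD(6)[OF linop_quad(4)]) simp_all
    finally show ?thesis
      by (simp only: 1)
  qed
  also have "\<dots> = Lplus \<delta> j (Div z) - (2 * (k - real r) - 1 - (sdim + 1) * \<delta> + sdim +
      real r * (sdim + 2 * k - real r - (sdim + 1) * \<delta>)) *\<^sub>R I j z"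
    using assms z by (simp add: Div_Lplus) (simp add: algebra_simps double)
  also have "2 * (k - real r) - 1 - (sdim + 1) * \<delta> + sdim +
      real r * (sdim + 2 * k - real r - (sdim + 1) * \<delta>) =
      real (Suc r) * (sdim + 2 * k - real (Suc r) - (sdim + 1) * \<delta>)"
    by (simp add: algebra_simps)
  finally show ?case
    by (simp add: z_def)
qed simp

section \<open>The Casimir operator on symbols\<close>

definition "Lid \<delta> x = - (\<Sum>i\<in>N. Lzero \<delta> i i x)"

text \<open>\<open>Lid\<close> is the action of the matrix unit at (0,0) of gl(p+1|q), whose class
  is -Id in g_0. For equal indices the sign in \<open>Lzero\<close> has an even exponent, so the
  sums are \<open>Eul\<close> and \<open>Deg\<close> themselves.\<close>

lemma Lid_eq: "x \<in> V \<Longrightarrow> Lid \<delta> x = Eul x - Deg x + (\<delta> * sdim) *\<^sub>R x"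
proof -
  have "Lzero \<delta> i i x = E i (I i x) - Y i (D i x) - (\<delta> * (- 1) ^ par i) *\<^sub>R x" for i
    by (auto simp: Lzero_def minus_one_power_iff)
  then show ?thesis
    by (simp add: Lid_def Eul_def Deg_def sdim_def sum_subtractf scaleR_left.sum sum_distrib_left)
qed

text \<open>The quadratic Casimir element of \<open>gl(p+1|q)\<close>, reordered so that \<open>Lminus\<close> acts first; the
  last term is the commutator this produces.\<close>

definition "casimir \<delta> x = 2 *\<^sub>R (\<Sum>j\<in>N. (- 1) ^ par j *\<^sub>R Lplus \<delta> j (Lminus j x))
  + (\<Sum>i\<in>N. \<Sum>j\<in>N. (- 1) ^ par j *\<^sub>R Lzero \<delta> i j (Lzero \<delta> j i x))
  + Lid \<delta> (Lid \<delta> x) - (sdim + 1) *\<^sub>R Lid \<delta> x"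

text \<open>The sign (-1)^(par j) is the one that brings D_j to the left of I_j; this is how
  \<open>Div\<close> appears.\<close>

lemma casimir_plus:
  assumes x: "x \<in> V"
  shows "(\<Sum>j\<in>N. (- 1) ^ par j *\<^sub>R Lplus \<delta> j (Lminus j x)) =
    YE (Div x) - Eul (Eul x) + Eul x + Eul (Deg x) - ((sdim + 1) * \<delta>) *\<^sub>R Eul x"
proof -
  have "(- 1) ^ par j *\<^sub>R Lplus \<delta> j (Lminus j x) = YE (D j (I j x)) - Y j (D j (Eul x)) + Y j (D j x)
      + Y j (D j (Deg x)) - ((sdim + 1) * \<delta>) *\<^sub>R Y j (D j x)" if j: "j \<in> N" for j
    using j x by (simp add: Lplus_def Lminus_def scaleR_diff_right scaleR_add_right D_Eul Deg_D flip: ID_same)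
  then show ?thesis
    using x by (simp add: sum.distrib sum_subtractf) (simp add: Div_def Eul_def gen_sum scaleR_right.sum)
qed

text \<open>Normal ordering, with all Y and E to the left of all D and I. In this order the double
  sums factor into compositions of the quadratic elements.\<close>

lemma casimir_zero_term:
  assumes "x \<in> V" "i \<in> N" "j \<in> N"
  shows "(- 1) ^ par j *\<^sub>R Lzero \<delta> i j (Lzero \<delta> j i x) =
    Y j (Y i (D i (D j x))) + (- 1) ^ par i *\<^sub>R Y j (D j x)
    + E i (E j (I j (I i x))) + (- 1) ^ par j *\<^sub>R E i (I i x)
    - Y j (E j (D i (I i x))) - Y i (E i (D j (I j x)))
    + (if i = j then (2 * \<delta>) *\<^sub>R Y j (D j x) - (2 * \<delta>) *\<^sub>R E j (I j x) + (\<delta> * \<delta> * (- 1) ^ par j) *\<^sub>R x else 0)"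
  using assms
  by (cases "even (par i)"; cases "even (par j)"; cases "i = j")
    (auto simp: Lzero_def minus_one_power_iff EY IY DE ID DY IE algebra_simps double)

lemma casimir_zero:
  assumes x: "x \<in> V"
  shows "(\<Sum>i\<in>N. \<Sum>j\<in>N. (- 1) ^ par j *\<^sub>R Lzero \<delta> i j (Lzero \<delta> j i x)) =
    Eul (Eul x) - Eul x + sdim *\<^sub>R Eul x + Deg (Deg x) - Deg x + sdim *\<^sub>R Deg x - 2 *\<^sub>R YE (Div x)
    + (2 * \<delta>) *\<^sub>R Eul x - (2 * \<delta>) *\<^sub>R Deg x + (\<delta> * \<delta> * sdim) *\<^sub>R x"
proof -
  \<comment> \<open>A normally ordered square differs from \<open>Eul (Eul x)\<close> by one
    contraction, the subtracted \<open>Eul x\<close>. The degree operator below behaves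
    alike.\<close>
  have 1: "(\<Sum>i\<in>N. \<Sum>j\<in>N. Y j (Y i (D i (D j x)))) = Eul (Eul x) - Eul x"
  proof -
    have "(\<Sum>j\<in>N. \<Sum>i\<in>N. Y j (Y i (D i (D j x)))) = (\<Sum>j\<in>N. Y j (Eul (D j x)))"
      using x by (simp add: Eul_def gen_sum)
    also have "\<dots> = (\<Sum>j\<in>N. Y j (D j (Eul x)) - Y j (D j x))"
      using x by (intro sum.cong) (simp_all add: D_Eul)
    also have "\<dots> = Eul (Eul x) - Eul x"
      by (subst Eul_def[of "Eul x"], subst Eul_def[of x]) (simp add: sum_subtractf)
    finally show ?thesis
      by (subst sum.swap)
  qed
  have 2: "(\<Sum>i\<in>N. \<Sum>j\<in>N. E i (E j (I j (I i x)))) = Deg (Deg x) - Deg x"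
  proof -
    have "(\<Sum>i\<in>N. \<Sum>j\<in>N. E i (E j (I j (I i x)))) = (\<Sum>i\<in>N. E i (Deg (I i x)))"
      using x by (simp add: Deg_def gen_sum)
    also have "\<dots> = (\<Sum>i\<in>N. E i (I i (Deg x)) - E i (I i x))"
      using x by (intro sum.cong) (simp_all add: I_Deg)
    also have "\<dots> = Deg (Deg x) - Deg x"
      by (subst Deg_def[of "Deg x"], subst Deg_def[of x]) (simp add: sum_subtractf)
    finally show ?thesis .
  qed
  have 3: "(\<Sum>i\<in>N. \<Sum>j\<in>N. Y j (E j (D i (I i x)))) = YE (Div x)"
    using x by (subst sum.swap) (simp add: YE_def Div_def gen_sum)
  have 4: "(\<Sum>i\<in>N. \<Sum>j\<in>N. Y i (E i (D j (I j x)))) = YE (Div x)"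
    using x by (simp add: YE_def Div_def gen_sum)
  have 5: "(\<Sum>i\<in>N. \<Sum>j\<in>N. (- 1) ^ par i *\<^sub>R Y j (D j x)) = sdim *\<^sub>R Eul x"
    by (subst sum.swap) (simp add: sdim_def Eul_def scaleR_left.sum scaleR_right.sum)
  have 6: "(\<Sum>i\<in>N. \<Sum>j\<in>N. (- 1) ^ par j *\<^sub>R E i (I i x)) = sdim *\<^sub>R Deg x"
    by (simp add: sdim_def Deg_def scaleR_left.sum scaleR_right.sum)
  have 7: "(\<Sum>i\<in>N. (2 * \<delta>) *\<^sub>R Y i (D i x)) - (\<Sum>i\<in>N. (2 * \<delta>) *\<^sub>R E i (I i x)) +
      (\<Sum>i\<in>N. (\<delta> * \<delta> * (- 1) ^ par i) *\<^sub>R x) =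
      (2 * \<delta>) *\<^sub>R Eul x - (2 * \<delta>) *\<^sub>R Deg x + (\<delta> * \<delta> * sdim) *\<^sub>R x"
    by (simp add: sum.distrib sum_subtractf sdim_def Eul_def Deg_def scaleR_right.sum sum_distrib_left
        scaleR_left.sum)
  show ?thesis
    using x by (simp add: casimir_zero_term sum.distrib sum_subtractf 1 2 3 4 5 6 7) (simp add: scaleR_2)
qed

text \<open>The terms \<open>YE (Div x)\<close> from the pairing of g_1 with g_-1 cancel those from
  g_0, and all terms with \<open>Eul\<close> cancel too, so a polynomial in the degree operator is
  left. The relative factors in \<open>casimir\<close> are the ones for which this happens.\<close>

lemma casimir_eq:
  assumes x: "x \<in> V"
  shows "casimir \<delta> x = 2 *\<^sub>R Deg (Deg x) + (2 * (sdim - (sdim + 1) * \<delta>)) *\<^sub>R Deg x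
    + ((sdim + sdim\<^sup>2) * \<delta>\<^sup>2 - (sdim + 1) * \<delta> * sdim) *\<^sub>R x"
proof -
  have 1: "Deg (Eul x) = Eul (Deg x)"
    using x by (simp add: Eul_def gen_sum Deg_Y Deg_D)
  show ?thesis
    unfolding casimir_def casimir_plus[OF x(1)] casimir_zero[OF x(1)] power2_eq_square
    using x 1 by (simp add: Lid_eq) (simp add: algebra_simps double)
qed

end

section \<open>The algebra of superfunctions\<close>

lemma scaleR_fun_apply [simp]: "(c *\<^sub>R f) x = c *\<^sub>R f x"
  by (simp add: scaleR_fun_def)

lemma sum_apply: "(\<Sum>a\<in>A. f a) x = (\<Sum>a\<in>A. f a x)"
  by (induction A rule: infinite_finite_induct) simp_all

lemma sum_additive_on:
  fixes T :: "'a::real_vector \<Rightarrow> 'b::comm_monoid_add"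
  assumes "subspace V" "\<And>x y. x \<in> V \<Longrightarrow> y \<in> V \<Longrightarrow> T (x + y) = T x + T y" "T 0 = 0"
    and "\<And>a. a \<in> A \<Longrightarrow> f a \<in> V"
  shows "T (\<Sum>a\<in>A. f a) = (\<Sum>a\<in>A. T (f a))"
  using assms(4)
  by (induction A rule: infinite_finite_induct) (simp_all add: assms(1-3) subspace_sum)

section \<open>Signs of reordering odd coordinates\<close>

definition inversions :: "nat set \<Rightarrow> nat set \<Rightarrow> (nat \<times> nat) set" where
  "inversions I J = {(i, j). i \<in> I \<and> j \<in> J \<and> j < i}"

lemma finite_inversions [simp]: "finite I \<Longrightarrow> finite J \<Longrightarrow> finite (inversions I J)"
  by (rule finite_subset[of _ "I \<times> J"]) (auto simp: inversions_def)

lemma ksign_eq: "ksign I J = (- 1) ^ card (inversions I J)"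
  by (simp add: ksign_def inversions_def)

lemma ksign_Un_left:
  assumes "finite I" "finite I'" "finite J" "I \<inter> I' = {}"
  shows "ksign (I \<union> I') J = ksign I J * ksign I' J"
proof -
  have "inversions (I \<union> I') J = inversions I J \<union> inversions I' J" "inversions I J \<inter> inversions I' J = {}"
    using assms by (auto simp: inversions_def)
  then show ?thesis
    using assms by (simp add: ksign_eq card_Un_disjoint power_add)
qed

lemma ksign_Un_right:
  assumes "finite I" "finite J" "finite J'" "J \<inter> J' = {}"
  shows "ksign I (J \<union> J') = ksign I J * ksign I J'"
proof -
  have "inversions I (J \<union> J') = inversions I J \<union> inversions I J'" "inversions I J \<inter> inversions I J' = {}"
    using assms by (auto simp: inversions_def)
  then show ?thesis
    using assms by (simp add: ksign_eq card_Un_disjoint power_add)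
qed

text \<open>For disjoint I and J each pair in \<open>I \<times> J\<close> is an inversion in exactly
  one of the two orders.\<close>

lemma ksign_commute:
  assumes "finite I" "finite J" "I \<inter> J = {}"
  shows "ksign J I = ksign I J * (- 1) ^ (card I * card J)"
proof -
  have "I \<times> J = inversions I J \<union> prod.swap ` inversions J I"
    using assms(3) by (force simp: inversions_def image_iff)
  moreover have "inversions I J \<inter> prod.swap ` inversions J I = {}"
    by (auto simp: inversions_def)
  ultimately have "card I * card J = card (inversions I J) + card (inversions J I)"
    using assms by (metis card_Un_disjoint card_cartesian_product card_image finite_imageI finite_inversions inj_swap)
  then show ?thesis
    by (simp add: ksign_eq power_add flip: power_mult_distrib)
qed

text \<open>The first is the sign in the odd case of \<open>sderiv\<close>, which makes left
  derivatives comparable with products.\<close>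

lemma ksign_singleton:
  "ksign {i} J = (- 1) ^ card {j\<in>J. j < i}" "ksign I {j} = (- 1) ^ card {i\<in>I. j < i}"
proof -
  have "inversions {i} J = Pair i ` {j\<in>J. j < i}" "inversions I {j} = (\<lambda>i. (i, j)) ` {i\<in>I. j < i}"
    by (auto simp: inversions_def)
  then show "ksign {i} J = (- 1) ^ card {j\<in>J. j < i}" "ksign I {j} = (- 1) ^ card {i\<in>I. j < i}"
    by (simp_all add: ksign_eq card_image inj_on_def)
qed

lemma ksign_empty [simp]: "ksign {} J = 1" "ksign I {} = 1"
  by (simp_all add: ksign_eq inversions_def)

lemma ksign_insert_left:
  "finite I \<Longrightarrow> finite J \<Longrightarrow> i \<notin> I \<Longrightarrow> ksign (insert i I) J = ksign {i} J * ksign I J"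
  using ksign_Un_left[of "{i}" I J] by simp

lemma ksign_insert_right:
  "finite I \<Longrightarrow> finite J \<Longrightarrow> j \<notin> J \<Longrightarrow> ksign I (insert j J) = ksign I {j} * ksign I J"
  using ksign_Un_right[of I "{j}" J] by simp

section \<open>The product of superfunctions\<close>

lemma sprod_add_left: "sprod (f + g) h = sprod f h + sprod g h"
  and sprod_add_right: "sprod f (g + h) = sprod f g + sprod f h"
  by (auto simp: sprod_def fun_eq_iff algebra_simps sum.distrib)

lemma sprod_scaleR_left [simp]: "sprod (c *\<^sub>R f) g = c *\<^sub>R sprod f g"
  and sprod_scaleR_right [simp]: "sprod f (c *\<^sub>R g) = c *\<^sub>R sprod f g"
  by (auto simp: sprod_def fun_eq_iff sum_distrib_left mult_ac)

lemma sprod_zero [simp]: "sprod 0 f = 0" "sprod f 0 = 0"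
  by (simp_all add: sprod_def fun_eq_iff)

lemma sprod_minus_left [simp]: "sprod (- f) g = - sprod f g"
  and sprod_minus_right [simp]: "sprod f (- g) = - sprod f g"
  using sprod_scaleR_left[of "-1" f g] sprod_scaleR_right[of f "-1" g] by simp_all

lemma sprod_sum_left: "sprod (\<Sum>a\<in>A. f a) g = (\<Sum>a\<in>A. sprod (f a) g)"
  and sprod_sum_right: "sprod g (\<Sum>a\<in>A. f a) = (\<Sum>a\<in>A. sprod g (f a))"
  by (induction A rule: infinite_finite_induct) (simp_all add: sprod_add_left sprod_add_right)

text \<open>An infinite K has infinitely many subsets, and the sum over them takes its default value
  0.\<close>

lemma sprod_infinite: "infinite K \<Longrightarrow> sprod f g K = (\<lambda>x. 0)"
  by (simp add: sprod_def)

text \<open>Both sides are sums over the ordered partitions of K into three blocks; on the left the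
  first two blocks are recorded by their union L. The signs agree since \<open>ksign\<close> is
  multiplicative over disjoint unions in either argument.\<close>

lemma sprod_assoc: "sprod (sprod f g) h = sprod f (sprod g h)"
proof (intro ext)
  fix K x
  show "sprod (sprod f g) h K x = sprod f (sprod g h) K x"
  proof (cases "finite K")
    case fin: True
    have "sprod (sprod f g) h K x =
        (\<Sum>(L, I)\<in>Sigma (Pow K) Pow. ksign L (K - L) * (ksign I (L - I) * f I x * g (L - I) x) * h (K - L) x)"
      using fin by (simp add: sprod_def sum_distrib_left sum_distrib_right finite_subset flip: sum.Sigma)
    also have "\<dots> = (\<Sum>(I, J)\<in>Sigma (Pow K) (\<lambda>I. Pow (K - I)).
        ksign I (K - I) * f I x * (ksign J (K - I - J) * g J x * h (K - I - J) x))"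
    proof (rule sum.reindex_bij_witness[where i = "\<lambda>(I, J). (I \<union> J, I)" and j = "\<lambda>(L, I). (I, L - I)"])
      fix z assume "z \<in> Sigma (Pow K) Pow"
      then obtain L I where z: "z = (L, I)" "I \<subseteq> L" "L \<subseteq> K"
        by auto
      have f: "finite I" "finite (L - I)" "finite (K - L)"
        using z by (auto intro!: rev_finite_subset[OF fin])
      have "ksign L (K - L) = ksign I (K - L) * ksign (L - I) (K - L)"
        using ksign_Un_left[of I "L - I" "K - L"] f z by (simp add: Un_absorb1)
      moreover have "ksign I (K - I) = ksign I (L - I) * ksign I (K - L)"
      proof -
        have "(L - I) \<union> (K - L) = K - I"
          using z by auto
        then show ?thesis
          using ksign_Un_right[of I "L - I" "K - L"] f by auto
      qed
      moreover have "K - I - (L - I) = K - L"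
        using z by auto
      ultimately show "(case case z of (L, I) \<Rightarrow> (I, L - I) of (I, J) \<Rightarrow>
            ksign I (K - I) * f I x * (ksign J (K - I - J) * g J x * h (K - I - J) x)) =
          (case z of (L, I) \<Rightarrow> ksign L (K - L) * (ksign I (L - I) * f I x * g (L - I) x) * h (K - L) x)"
        using z by simp
    next
      fix w assume "w \<in> Sigma (Pow K) (\<lambda>I. Pow (K - I))"
      then show "(case case w of (I, J) \<Rightarrow> (I \<union> J, I) of (L, I) \<Rightarrow> (I, L - I)) = w"
        and "(case w of (I, J) \<Rightarrow> (I \<union> J, I)) \<in> Sigma (Pow K) Pow"
        by auto
    qed auto
    also have "\<dots> = sprod f (sprod g h) K x"
      using fin by (simp add: sprod_def sum_distrib_left finite_subset flip: sum.Sigma)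
    finally show ?thesis .
  qed (simp add: sprod_infinite)
qed

text \<open>Powers of the grading automorphism: \<open>twist a\<close> produces the signs \<open>(-1)\<^bsup>a b\<^esup>\<close> for \<open>f\<close> of
  parity \<open>b\<close> without splitting \<open>f\<close> into homogeneous parts.\<close>

definition twist :: "nat \<Rightarrow> sfun \<Rightarrow> sfun" where
  "twist a f = (\<lambda>I. (- 1) ^ (a * card I) *\<^sub>R f I)"

lemma twist_linear [simp]: "twist a (f + g) = twist a f + twist a g" "twist a (c *\<^sub>R f) = c *\<^sub>R twist a f"
  "twist a 0 = 0" "twist a (- f) = - twist a f" "twist a (f - g) = twist a f - twist a g"
  by (auto simp: twist_def fun_eq_iff algebra_simps)

lemma twist_sum: "twist a (\<Sum>b\<in>A. f b) = (\<Sum>b\<in>A. twist a (f b))"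
  using sum_comp_morphism[of "twist a" f A] by (simp add: comp_def)

lemma twist_twist [simp]: "twist a (twist b f) = twist (a + b) f"
  by (simp add: twist_def fun_eq_iff add_mult_distrib power_add)

lemma twist_0 [simp]: "twist 0 f = f"
  by (simp add: twist_def)

lemma twist_double [simp]: "twist (a + a) f = f" "twist (a + (a + b)) f = twist b f" 
  by (simp_all add: twist_def fun_eq_iff add_mult_distrib power_add flip: power_mult_distrib mult.assoc)

lemma twist_cong: "even a = even b \<Longrightarrow> twist a f = twist b f"
  by (auto simp: twist_def fun_eq_iff minus_one_power_iff)

lemma twist_sprod: "twist a (sprod f g) = sprod (twist a f) (twist a g)"
proof (intro ext)
  fix K x
  show "twist a (sprod f g) K x = sprod (twist a f) (twist a g) K x"
  proof (cases "finite K")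
    case True
    have "(- 1) ^ (a * card K) = (- 1) ^ (a * card I) * ((- 1) ^ (a * card (K - I)) :: real)" if "I \<subseteq> K" for I
    proof -
      have "card K = card I + card (K - I)"
        using that True by (metis Diff_disjoint Diff_partition card_Un_disjoint finite_Diff finite_subset)
      then show ?thesis
        by (simp add: add_mult_distrib2 power_add)
    qed
    then show ?thesis
      by (auto simp: twist_def sprod_def sum_distrib_left intro!: sum.cong)
  qed (simp add: sprod_infinite twist_def)
qed

section \<open>Homogeneous parts and supercommutativity\<close>

definition homog :: "nat \<Rightarrow> sfun \<Rightarrow> bool" where
  "homog a f \<longleftrightarrow> (\<forall>I. f I \<noteq> 0 \<longrightarrow> card I mod 2 = a mod 2)"

lemma homog_hpart [simp]: "homog a (hpart a f)"
  by (simp add: homog_def hpart_def)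

lemma hpart_homog: "homog a f \<Longrightarrow> hpart b f = (if a mod 2 = b mod 2 then f else 0)"
  by (auto simp: homog_def hpart_def fun_eq_iff)

lemma hpart_linear [simp]: "hpart a (f + g) = hpart a f + hpart a g" "hpart a (c *\<^sub>R f) = c *\<^sub>R hpart a f"
  "hpart a (- f) = - hpart a f" "hpart a 0 = 0"
  by (auto simp: hpart_def fun_eq_iff)

lemma hpart_sum: "hpart a (\<Sum>b\<in>A. f b) = (\<Sum>b\<in>A. hpart a (f b))"
  using sum_comp_morphism[of "hpart a" f A] by (simp add: comp_def)

lemma hpart_mod: "a mod 2 = b mod 2 \<Longrightarrow> hpart a f = hpart b f"
  by (simp add: hpart_def)

lemma hpart_decomp: "hpart 0 f + hpart 1 f = f" "hpart 0 f + hpart (Suc 0) f = f"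
  by (auto simp: hpart_def fun_eq_iff)

text \<open>The bridge from the definitions to \<open>twist\<close>: summed over b in {0,1}, the
  signed homogeneous parts recombine into \<open>twist a f\<close>.\<close>

lemma twist_hpart: "(- 1) ^ (a * b) *\<^sub>R hpart b f = twist a (hpart b f)"
proof -
  have "(- 1) ^ (a * b) = ((- 1) ^ (a * card I) :: real)" if "card I mod 2 = b mod 2" for I
  proof -
    have "even (card I) = even b"
      using that by (simp add: even_iff_mod_2_eq_zero)
    then show ?thesis
      by (simp add: minus_one_power_iff)
  qed
  then show ?thesis
    by (auto simp: twist_def hpart_def fun_eq_iff)
qed

text \<open>Taking complements in K matches the summands. The twist supplies the right sign for
  every part of f, so f can be arbitrary.\<close>

lemma sprod_commute:
  assumes "homog b g"
  shows "sprod g f = sprod (twist b f) g"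
proof (intro ext)
  fix K x
  show "sprod g f K x = sprod (twist b f) g K x"
  proof (cases "finite K")
    case True
    show ?thesis
      unfolding sprod_def
    proof (rule sum.reindex_bij_witness[where i = "\<lambda>I. K - I" and j = "\<lambda>I. K - I"])
      fix J assume J: "J \<in> Pow K"
      show "ksign (K - J) (K - (K - J)) * twist b f (K - J) x * g (K - (K - J)) x = ksign J (K - J) * g J x * f (K - J) x"
      proof (cases "g J = 0")
        case False
        then have "even (card J) = even b"
          using assms by (auto simp: homog_def even_iff_mod_2_eq_zero)
        moreover have "finite J" "finite (K - J)"
          using J by (auto intro!: rev_finite_subset[OF True])
        moreover have "ksign (K - J) J = ksign J (K - J) * (- 1) ^ (card J * card (K - J))"
          using calculation by (intro ksign_commute) auto
        ultimately show ?thesis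
          using J by (auto simp: double_diff twist_def minus_one_power_iff)
      qed (use J in \<open>simp add: double_diff\<close>)
    qed auto
  qed (simp add: sprod_infinite)
qed


section \<open>The carrier of superfunctions\<close>

lemma subspace_SF: "subspace (SF p q)"
proof (rule subspaceI)
  show "0 \<in> SF p q"
    using smooth_const[of p 0] by (simp add: SF_def zero_fun_def)
  show "f + g \<in> SF p q" if "f \<in> SF p q" "g \<in> SF p q" for f g
    using that smooth_add by (auto simp: SF_def plus_fun_def)
  show "c *\<^sub>R f \<in> SF p q" if "f \<in> SF p q" for c f
    using that smooth_cmult by (auto simp: SF_def scaleR_fun_def fun_eq_iff)
qed

lemma SF_closed [simp]: "0 \<in> SF p q" "f \<in> SF p q \<Longrightarrow> g \<in> SF p q \<Longrightarrow> f + g \<in> SF p q"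
  "f \<in> SF p q \<Longrightarrow> c *\<^sub>R f \<in> SF p q" "f \<in> SF p q \<Longrightarrow> g \<in> SF p q \<Longrightarrow> f - g \<in> SF p q"
  "f \<in> SF p q \<Longrightarrow> - f \<in> SF p q" "(\<And>a. a \<in> A \<Longrightarrow> h a \<in> SF p q) \<Longrightarrow> sum h A \<in> SF p q"
  using subspace_SF[of p q]
  by (auto simp: subspace_0 subspace_add subspace_scale subspace_diff subspace_neg intro: subspace_sum)

lemma SF_smooth: "f \<in> SF p q \<Longrightarrow> smooth p (f I)"
  and SF_outside: "f \<in> SF p q \<Longrightarrow> \<not> I \<subseteq> {p+1..p+q} \<Longrightarrow> f I = 0"
  by (auto simp: SF_def)

lemma SF_infinite: "f \<in> SF p q \<Longrightarrow> infinite I \<Longrightarrow> f I = 0"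
  by (metis SF_outside finite_atLeastAtMost finite_subset)

lemma sprod_SF [simp]:
  assumes "f \<in> SF p q" "g \<in> SF p q"
  shows "sprod f g \<in> SF p q"
proof -
  have "smooth p (sprod f g K)" for K
    unfolding sprod_def by (intro smooth_sum smooth_mult smooth_cmult SF_smooth[OF assms(1)] SF_smooth[OF assms(2)])
  moreover have "sprod f g K = 0" if "\<not> K \<subseteq> {p+1..p+q}" for K
  proof -
    \<comment> \<open>An index of K outside the odd range lies in I or in its complement, so every
      summand has a vanishing factor.\<close>
    have "f I x = 0 \<or> g (K - I) x = 0" if "I \<subseteq> K" for I x
      using SF_outside[OF assms(1), of I] SF_outside[OF assms(2), of "K - I"] \<open>\<not> K \<subseteq> {p+1..p+q}\<close>
      by (cases "I \<subseteq> {p+1..p+q}"; cases "K - I \<subseteq> {p+1..p+q}") (auto simp del: atLeastAtMost_iff)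
    then show ?thesis
      by (auto simp: sprod_def fun_eq_iff intro!: sum.neutral)
  qed
  ultimately show ?thesis
    by (simp add: SF_def)
qed

lemma twist_SF [simp]: "f \<in> SF p q \<Longrightarrow> twist a f \<in> SF p q"
  using smooth_cmult by (auto simp: SF_def twist_def scaleR_fun_def fun_eq_iff)

lemma hpart_SF [simp]: "f \<in> SF p q \<Longrightarrow> hpart a f \<in> SF p q"
  by (auto simp: SF_def hpart_def) (simp add: zero_fun_def)

lemma sone_SF [simp]: "sone \<in> SF p q"
  by (auto simp: SF_def sone_def fun_eq_iff)

lemma coord_SF [simp]: "i \<in> {1..p+q} \<Longrightarrow> coord p i \<in> SF p q"
proof -
  have "smooth p (\<lambda>x. if I = {} then x i else 0)" if "i \<in> {1..p}" for I :: "nat set"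
    using smooth_coord[OF that] by (cases "I = {}") simp_all
  then show "i \<in> {1..p+q} \<Longrightarrow> coord p i \<in> SF p q"
    by (auto simp: SF_def coord_def fun_eq_iff)
qed

lemma homog_coord [simp]: "homog (par p i) (coord p i)"
  by (auto simp: homog_def coord_def par_def fun_eq_iff)

lemma homog_sone [simp]: "homog 0 sone"
  by (auto simp: homog_def sone_def fun_eq_iff)

lemma twist_homog: "homog b f \<Longrightarrow> twist a f = (- 1) ^ (a * b) *\<^sub>R f"
  using twist_hpart[of a b f] by (simp add: hpart_homog)

lemma homog_sprod: "homog a f \<Longrightarrow> homog b g \<Longrightarrow> homog (a + b) (sprod f g)"
  unfolding homog_def
proof (intro allI impI)
  fix K
  assume f: "\<forall>I. f I \<noteq> 0 \<longrightarrow> card I mod 2 = a mod 2" and g: "\<forall>I. g I \<noteq> 0 \<longrightarrow> card I mod 2 = b mod 2"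
    and K: "sprod f g K \<noteq> 0"
  then have fin: "finite K"
    using sprod_infinite[of K f g] by (auto simp: fun_eq_iff)
  obtain I where I: "I \<subseteq> K" "f I \<noteq> 0" "g (K - I) \<noteq> 0"
  proof (rule ccontr)
    assume "\<not> thesis"
    with that have "f I = 0 \<or> g (K - I) = 0" if "I \<subseteq> K" for I
      using \<open>I \<subseteq> K\<close> by blast
    then have "f I x = 0 \<or> g (K - I) x = 0" if "I \<in> Pow K" for I x
      using that by (metis PowD zero_fun_apply)
    then have "sprod f g K x = 0" for x
      unfolding sprod_def by (intro sum.neutral) auto
    with K show False
      by (auto simp: fun_eq_iff)
  qed
  have "card K = card I + card (K - I)"
    using card_mono[OF fin I(1)] card_Diff_subset[OF finite_subset[OF I(1) fin] I(1)] by linarith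
  moreover have "card I mod 2 = a mod 2" "card (K - I) mod 2 = b mod 2"
    using f g I by blast+
  ultimately show "card K mod 2 = (a + b) mod 2"
    by (metis mod_add_eq)
qed

lemma sprod_sone_left [simp]: "f \<in> SF p q \<Longrightarrow> sprod sone f = f"
proof (intro ext)
  fix K x assume f: "f \<in> SF p q"
  show "sprod sone f K x = f K x"
  proof (cases "finite K")
    case True
    then have "sprod sone f K x = (\<Sum>I\<in>Pow K. if I = {} then f K x else 0)"
      unfolding sprod_def by (intro sum.cong) (auto simp: sone_def)
    then show ?thesis
      using True by simp
  qed (simp add: sprod_infinite SF_infinite[OF f])
qed

lemma sprod_sone_right [simp]: "f \<in> SF p q \<Longrightarrow> sprod f sone = f"
  using sprod_commute[of 0 sone f] by simp

lemma sprod_coord_right: "sprod f (coord p j) = sprod (coord p j) (twist (par p j) f)"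
  using sprod_commute[OF homog_coord[of p j], of "twist (par p j) f"] by simp

lemma sprod_coord_left_commute:
  "sprod f (sprod (coord p j) g) = sprod (coord p j) (sprod (twist (par p j) f) g)"
  by (metis sprod_assoc sprod_coord_right)

lemma coord_coord_commute:
  "sprod (coord p i) (sprod (coord p j) f) =
    (- 1) ^ (par p i * par p j) *\<^sub>R sprod (coord p j) (sprod (coord p i) f)"
  by (simp add: sprod_coord_left_commute[of "coord p i"] twist_homog[of "par p i"] mult.commute)

lemma twist_coord_mult:
  "twist a (sprod (coord p i) f) = (- 1) ^ (a * par p i) *\<^sub>R sprod (coord p i) (twist a f)"
  by (simp add: twist_sprod twist_homog[of "par p i"])

section \<open>Partial derivatives of superfunctions\<close>

lemma sderiv_even: "i \<le> p \<Longrightarrow> sderiv p i f = (\<lambda>I. pderivative i (f I))"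
  by (simp add: sderiv_def)

lemma sderiv_odd: "p < i \<Longrightarrow>
  sderiv p i f = (\<lambda>I. if i \<in> I then 0 else (- 1) ^ card {j\<in>I. j < i} *\<^sub>R f (insert i I))"
  by (simp add: sderiv_def)

lemma sderiv_SF [simp]:
  assumes "f \<in> SF p q" "i \<in> {1..p+q}"
  shows "sderiv p i f \<in> SF p q"
proof (cases "i \<le> p")
  case True
  have "pderivative i (f I) = 0" if "\<not> I \<subseteq> {p+1..p+q}" for I
    using SF_outside[OF assms(1) that] by (simp add: zero_fun_def)
  then show ?thesis
    using True assms smooth_pderivative[of p _ i] SF_smooth[OF assms(1)] by (simp add: SF_def sderiv_even)
next
  case False
  have "smooth p (if i \<in> I then 0 else c *\<^sub>R f (insert i I))" for I c
    using smooth_cmult[OF SF_smooth[OF assms(1)], of c "insert i I"]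
    by (auto simp: zero_fun_def scaleR_fun_def)
  moreover have "f (insert i I) = 0" if "\<not> I \<subseteq> {p+1..p+q}" for I
    using that by (intro SF_outside[OF assms(1)]) auto
  ultimately show ?thesis
    using False by (simp add: SF_def sderiv_odd)
qed

lemma sderiv_add [simp]:
  assumes "f \<in> SF p q" "g \<in> SF p q" "i \<in> {1..p+q}"
  shows "sderiv p i (f + g) = sderiv p i f + sderiv p i g"
proof (cases "i \<le> p")
  case True
  have "pderivative i (f I + g I) = pderivative i (f I) + pderivative i (g I)" for I
    using pderivative_add[of p "f I" "g I" i] True assms by (simp add: plus_fun_def SF_smooth smooth_imp_smooth0)
  then show ?thesis
    using True by (simp add: sderiv_even fun_eq_iff)
qed (auto simp: sderiv_odd fun_eq_iff algebra_simps)

lemma sderiv_scaleR [simp]: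
  assumes "f \<in> SF p q" "i \<in> {1..p+q}"
  shows "sderiv p i (c *\<^sub>R f) = c *\<^sub>R sderiv p i f"
proof (cases "i \<le> p")
  case True
  have "pderivative i (c *\<^sub>R f I) = c *\<^sub>R pderivative i (f I)" for I
    using pderivative_cmult[of p "f I" i c] True assms by (simp add: scaleR_fun_def SF_smooth smooth_imp_smooth0)
  then show ?thesis
    using True by (simp add: sderiv_even fun_eq_iff)
qed (auto simp: sderiv_odd fun_eq_iff)

lemma sderiv_zero [simp]: "sderiv p i 0 = 0"
  by (auto simp: sderiv_def fun_eq_iff) (simp add: zero_fun_def)

lemma sderiv_minus [simp]: "f \<in> SF p q \<Longrightarrow> i \<in> {1..p+q} \<Longrightarrow> sderiv p i (- f) = - sderiv p i f"
  using sderiv_scaleR[of f p q i "-1"] by simp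

lemma twist_sderiv:
  assumes "f \<in> SF p q" "i \<in> {1..p+q}"
  shows "twist a (sderiv p i f) = (- 1) ^ (a * par p i) *\<^sub>R sderiv p i (twist a f)"
proof (cases "i \<le> p")
  case True
  have "pderivative i (c *\<^sub>R f I) = c *\<^sub>R pderivative i (f I)" for I c
    using pderivative_cmult[of p "f I" i c] True assms by (simp add: scaleR_fun_def SF_smooth smooth_imp_smooth0)
  then show ?thesis
    using True by (simp add: sderiv_even twist_def par_def fun_eq_iff)
next
  case False
  \<comment> \<open>Infinite sets have \<open>card\<close> 0, which would spoil the sign; there both
    sides vanish, since f lies in the carrier.\<close>
  have "twist a (sderiv p i f) I = ((- 1) ^ (a * par p i) *\<^sub>R sderiv p i (twist a f)) I" for I
    using False SF_infinite[OF assms(1), of I] SF_infinite[OF assms(1), of "insert i I"]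
    by (cases "finite I") (auto simp: sderiv_odd twist_def par_def fun_eq_iff power_add simp flip: power_mult_distrib)
  then show ?thesis ..
qed

lemma sderiv_commute:
  assumes "f \<in> SF p q" "i \<in> {1..p+q}" "j \<in> {1..p+q}"
  shows "sderiv p i (sderiv p j f) = (- 1) ^ (par p i * par p j) *\<^sub>R sderiv p j (sderiv p i f)"
proof -
  \<comment> \<open>For j < i the presence of j shifts the position of i by one, while the presence
    of i does not affect that of j; hence a single minus sign.\<close>
  have odd: "sderiv p i (sderiv p j f) = - sderiv p j (sderiv p i f)" if "p < j" "j < i" for i j
  proof
    fix I
    show "sderiv p i (sderiv p j f) I = (- sderiv p j (sderiv p i f)) I"
    proof (cases "finite I \<and> i \<notin> I \<and> j \<notin> I")
      case True
      then have "{l \<in> insert j I. l < i} = insert j {l \<in> I. l < i}" "{l \<in> insert i I. l < j} = {l \<in> I. l < j}"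
        using that by auto
      then show ?thesis
        using True that by (simp add: sderiv_odd insert_commute fun_eq_iff)
    qed (use that SF_infinite[OF assms(1)] in \<open>auto simp: sderiv_odd fun_eq_iff\<close>)
  qed
  have mixed: "sderiv p i (sderiv p j f) = sderiv p j (sderiv p i f)"
    if "i \<in> {1..p+q}" "i \<le> p" "p < j" for i j
  proof -
    have "pderivative i (c *\<^sub>R f I) = c *\<^sub>R pderivative i (f I)" for I c
      using pderivative_cmult[of p "f I" i c] that assms by (simp add: scaleR_fun_def SF_smooth smooth_imp_smooth0)
    then show ?thesis
      using that by (auto simp: sderiv_even sderiv_odd fun_eq_iff) (simp add: zero_fun_def)
  qed
  consider "i \<le> p" "j \<le> p" | "i \<le> p" "p < j" | "p < i" "j \<le> p" | "p < i" "p < j"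
    by linarith
  then show ?thesis
  proof cases
    case 1
    then show ?thesis
      using assms pderivative_commute[OF SF_smooth[OF assms(1)]] by (simp add: sderiv_even par_def)
  next
    case 2
    then show ?thesis
      using mixed[of i j] assms by (simp add: par_def)
  next
    case 3
    then show ?thesis
      using mixed[of j i] assms by (simp add: par_def)
  next
    case 4
    then show ?thesis
      using odd[of i j] odd[of j i] by (cases i j rule: linorder_cases) (auto simp: par_def sderiv_odd fun_eq_iff)
  qed
qed

text \<open>For even i the ordinary rule holds in each summand. For odd i the subsets are split by
  whether they contain i. If i lies in K, the left side is 0 by definition of \<open>sderiv\<close>,
  and the two products on the right must cancel.\<close>

lemma sderiv_sprod:
  assumes f: "f \<in> SF p q" and g: "g \<in> SF p q" and i: "i \<in> {1..p+q}"
  shows "sderiv p i (sprod f g) = sprod (sderiv p i f) g + sprod (twist (par p i) f) (sderiv p i g)"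
proof (cases "i \<le> p")
  case True
  have "pderivative i (sprod f g K) =
      (\<lambda>x. \<Sum>I\<in>Pow K. ksign I (K - I) * pderivative i (f I) x * g (K - I) x +
        ksign I (K - I) * f I x * pderivative i (g (K - I)) x)" for K
  proof -
    have "pderivative i (\<lambda>x. ksign I (K - I) * f I x * g (K - I) x) =
        (\<lambda>x. ksign I (K - I) * pderivative i (f I) x * g (K - I) x +
          ksign I (K - I) * f I x * pderivative i (g (K - I)) x)" for I
      using True i SF_smooth[OF f, of I] SF_smooth[OF g, of "K - I"]
      by (subst pderivative_mult[of p]) (auto simp: pderivative_cmult[of p] smooth_imp_smooth0 smooth_cmult)
    then show ?thesis
      unfolding sprod_def using True i
      by (subst pderivative_sum[of _ p])
        (auto intro!: smooth_mult smooth_cmult SF_smooth[OF f] SF_smooth[OF g])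
  qed
  then show ?thesis
    using True by (simp add: sderiv_even par_def fun_eq_iff sprod_def sum.distrib)
next
  case False
  then have odd: "p < i" "par p i = 1"
    by (auto simp: par_def)
  show ?thesis
  proof (intro ext)
    fix K x
    show "sderiv p i (sprod f g) K x = (sprod (sderiv p i f) g + sprod (twist (par p i) f) (sderiv p i g)) K x"
    proof (cases "finite K")
      case fin: True
      show ?thesis
      proof (cases "i \<in> K")
        case True
        define L where "L = K - {i}"
        have L: "finite L" "i \<notin> L" "K = insert i L"
          using True fin by (auto simp: L_def)
        have P: "Pow (insert i L) = Pow L \<union> insert i ` Pow L" "Pow L \<inter> insert i ` Pow L = {}"
          "inj_on (insert i) (Pow L)" "finite (Pow L)"
          using L by (auto simp: Pow_insert inj_on_def)
        \<comment> \<open>A summand survives only if the set at the differentiated factor lacks i;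
          so i goes to the set of g here, and to that of f in the other product.\<close>
        have 1: "sprod (sderiv p i f) g K x = (\<Sum>I\<in>Pow L. ksign I (insert i (L - I)) *
            (- 1) ^ card {j\<in>I. j < i} * f (insert i I) x * g (insert i (L - I)) x)"
        proof -
          have "insert i L - I = insert i (L - I)" if "I \<subseteq> L" for I
            using that L by auto
          then show ?thesis
            unfolding sprod_def L(3) P(1) using P L
            by (subst sum.union_disjoint) (auto simp: sum.reindex sderiv_odd odd intro!: sum.cong)
        qed
        have 2: "sprod (twist (par p i) f) (sderiv p i g) K x = (\<Sum>I\<in>Pow L. ksign (insert i I) (L - I) *
            (- 1) ^ card (insert i I) * f (insert i I) x * ((- 1) ^ card {j\<in>L-I. j < i} * g (insert i (L - I)) x))"
        proof -
          have "insert i L - insert i I = L - I" "i \<in> insert i L - I" if "I \<subseteq> L" for I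
            using that L by auto
          then show ?thesis
            unfolding sprod_def L(3) P(1) using P L
            by (subst sum.union_disjoint) (auto simp: sum.reindex sderiv_odd odd twist_def intro!: sum.cong)
        qed
        have "ksign I (insert i (L - I)) * (- 1) ^ card {j\<in>I. j < i} =
            - (ksign (insert i I) (L - I) * (- 1) ^ card (insert i I) * (- 1) ^ card {j\<in>L-I. j < i})"
          if "I \<subseteq> L" for I
        proof -
          have I: "finite I" "finite (L - I)" "i \<notin> I" "i \<notin> L - I"
            using that L by (auto intro!: rev_finite_subset[OF L(1)])
          have 1: "ksign {i} I = ksign I {i} * (- 1) ^ (card I * card {i})"
            using I by (intro ksign_commute) auto
          have 2: "ksign I J * ksign I J = 1" for I J
            by (simp add: ksign_eq flip: power_mult_distrib)
          \<comment> \<open>d and e stand for the signs of i against I and against L - I; each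
            occurs twice, so only their squares matter.\<close>
          have "d * k * (d * c) = - (e * k * (- c) * e)" if "d * d = 1" "e * e = 1" for c d e k :: real
            using that by algebra
          from this[OF 2[of I "{i}"] 2[of "{i}" "L - I"], of "ksign I (L - I)" "(- 1) ^ card I"]
          show ?thesis
            unfolding ksign_singleton(1)[symmetric] ksign_insert_right[OF I(1,2,4)] ksign_insert_left[OF I(1,2,3)]
              card_insert_disjoint[OF I(1,3)] 1
            by simp
        qed
        then have "sprod (sderiv p i f) g K x + sprod (twist (par p i) f) (sderiv p i g) K x = 0"
          unfolding 1 2 sum.distrib[symmetric] by (intro sum.neutral) (simp add: algebra_simps)
        then show ?thesis
          using True odd(1) by (simp add: sderiv_odd)
      next
        case False
        have P: "Pow (insert i K) = Pow K \<union> insert i ` Pow K" "Pow K \<inter> insert i ` Pow K = {}"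
          "inj_on (insert i) (Pow K)" "finite (Pow K)"
          using fin False by (auto simp: Pow_insert inj_on_def)
        \<comment> \<open>Subsets without i lead to the term in which g is differentiated, those
          with i to the one in which f is.\<close>
        have "sprod f g (insert i K) x = (\<Sum>I\<in>Pow K. ksign I (insert i (K - I)) * f I x * g (insert i (K - I)) x) +
            (\<Sum>I\<in>Pow K. ksign (insert i I) (K - I) * f (insert i I) x * g (K - I) x)"
        proof -
          have "insert i K - I = insert i (K - I)" "insert i K - insert i I = K - I" if "I \<subseteq> K" for I
            using that False by auto
          then show ?thesis
            unfolding sprod_def P(1) using P
            by (subst sum.union_disjoint) (auto simp: sum.reindex intro!: arg_cong2[of _ _ _ _ "(+)"] sum.cong)
        qed
        moreover have sgn: "(- 1) ^ card {j\<in>K. j < i} * ksign I (insert i (K - I)) =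
            (- 1) ^ card I * ksign I (K - I) * (- 1) ^ card {j\<in>K-I. j < i}"
          "(- 1) ^ card {j\<in>K. j < i} * ksign (insert i I) (K - I) = ksign I (K - I) * (- 1) ^ card {j\<in>I. j < i}"
          if "I \<subseteq> K" for I
        proof -
          have I: "finite I" "finite (K - I)" "i \<notin> I" "i \<notin> K - I" "I \<inter> (K - I) = {}" "I \<union> (K - I) = K"
            using that False by (auto intro!: rev_finite_subset[OF fin])
          have 1: "ksign {i} I = ksign I {i} * (- 1) ^ (card I * card {i})"
            using I by (intro ksign_commute) auto
          have 2: "ksign {i} K = ksign {i} I * ksign {i} (K - I)"
            using ksign_Un_right[of "{i}" I "K - I"] I by simp
          have 3: "ksign I J * ksign I J = 1" for I J
            by (simp add: ksign_eq flip: power_mult_distrib)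
          have cancel: "a * b * c * (a * d) = b * d * c" and cancel': "b * a * (a * d) = d * b"
            if "a * a = 1" for a b c d :: real
            using that by algebra+
          show "(- 1) ^ card {j\<in>K. j < i} * ksign I (insert i (K - I)) =
            (- 1) ^ card I * ksign I (K - I) * (- 1) ^ card {j\<in>K-I. j < i}"
            using cancel[OF 3[of I "{i}"], of "(- 1) ^ card I" "ksign {i} (K - I)" "ksign I (K - I)"]
            unfolding ksign_singleton(1)[symmetric] ksign_insert_right[OF I(1,2,4)] 2 1 by simp
          show "(- 1) ^ card {j\<in>K. j < i} * ksign (insert i I) (K - I) = ksign I (K - I) * (- 1) ^ card {j\<in>I. j < i}"
            using cancel'[OF 3[of "{i}" "K - I"], of "ksign {i} I" "ksign I (K - I)"]
            unfolding ksign_singleton(1)[symmetric] ksign_insert_left[OF I(1,2,3)] 2 by simp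
        qed
        moreover have "(\<Sum>I\<in>Pow K. (- 1) ^ card {j\<in>K. j < i} * (ksign I (insert i (K - I)) * f I x * g (insert i (K - I)) x)) =
            sprod (twist (par p i) f) (sderiv p i g) K x"
        proof -
          show ?thesis
            unfolding sprod_def using odd sgn(1) False
            by (intro sum.cong) (simp_all add: sderiv_odd twist_def flip: mult.assoc)
        qed
        moreover have "(\<Sum>I\<in>Pow K. (- 1) ^ card {j\<in>K. j < i} * (ksign (insert i I) (K - I) * f (insert i I) x * g (K - I) x)) =
            sprod (sderiv p i f) g K x"
        proof -
          have "i \<notin> I" if "I \<subseteq> K" for I
            using False that by auto
          then show ?thesis
            unfolding sprod_def using odd sgn(2)
            by (intro sum.cong) (simp_all add: sderiv_odd flip: mult.assoc)
        qed
        ultimately show ?thesis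
          using False odd(1) by (simp add: sderiv_odd distrib_left sum_distrib_left)
      qed
    qed (use odd in \<open>simp add: sderiv_odd sprod_infinite\<close>)
  qed
qed

lemma sderiv_sone [simp]: "sderiv p i sone = 0"
  by (auto simp: sderiv_def sone_def fun_eq_iff pderivative_def)

lemma sderiv_coord:
  "i \<in> {1..p+q} \<Longrightarrow> j \<in> {1..p+q} \<Longrightarrow> sderiv p i (coord p j) = (if i = j then sone else 0)"
proof (cases "i \<le> p \<and> j \<le> p")
  case True
  have "pderivative i (coord p j I) = (if i = j then sone else 0) I" for I
    using True by (cases "I = {}") (auto simp: coord_def sone_def pderivative_coord fun_eq_iff)
  then show ?thesis
    using True by (simp add: sderiv_even)
qed (auto simp: sderiv_def coord_def sone_def fun_eq_iff pderivative_def)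

lemma sderiv_coord_mult:
  assumes "f \<in> SF p q" "i \<in> {1..p+q}" "j \<in> {1..p+q}"
  shows "sderiv p i (sprod (coord p j) f) =
    (- 1) ^ (par p i * par p j) *\<^sub>R sprod (coord p j) (sderiv p i f) + (if i = j then f else 0)"
  using assms by (simp add: sderiv_sprod[of _ p q] sderiv_coord[of _ p q] twist_homog[of "par p j"])

section \<open>The supersymmetric algebra\<close>

text \<open>The sign of moving \<open>e\<^sub>i\<close> past \<open>e\<^sub>1\<^sup>\<alpha>\<^sup>1 \<or> \<dots> \<or> e\<^sub>i\<^sub>-\<^sub>1\<^sup>\<alpha>\<^sup>i\<^sup>-\<^sup>1\<close>.\<close>

definition msgn :: "nat \<Rightarrow> nat \<Rightarrow> midx \<Rightarrow> real" where
  "msgn p i \<alpha> = (- 1) ^ (par p i * (\<Sum>l=1..<i. par p l * \<alpha> l))"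

text \<open>\<open>e\<^sub>i \<or> _\<close> and \<open>i(\<epsilon>\<^sup>i)\<close> on coefficient families; the coefficients are real numbers or
  superfunctions.\<close>

definition Emul :: "nat \<Rightarrow> nat \<Rightarrow> nat \<Rightarrow> (midx \<Rightarrow> 'a::real_vector) \<Rightarrow> midx \<Rightarrow> 'a" where
  "Emul p q i v = (\<lambda>\<alpha>. if \<alpha> \<in> MI p q \<and> 0 < \<alpha> i then msgn p i \<alpha> *\<^sub>R v (\<alpha>(i := \<alpha> i - 1)) else 0)"

definition Imul :: "nat \<Rightarrow> nat \<Rightarrow> (midx \<Rightarrow> 'a::real_vector) \<Rightarrow> midx \<Rightarrow> 'a" where
  "Imul p i v = (\<lambda>\<alpha>. (real (Suc (\<alpha> i)) * msgn p i \<alpha>) *\<^sub>R v (\<alpha>(i := Suc (\<alpha> i))))"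

lemma msgn_upd_same [simp]: "msgn p i (\<alpha>(i := n)) = msgn p i \<alpha>"
proof -
  have "(\<Sum>l=1..<i. par p l * (\<alpha>(i := n)) l) = (\<Sum>l=1..<i. par p l * \<alpha> l)"
    by (intro sum.cong) auto
  then show ?thesis
    by (simp add: msgn_def)
qed

lemma msgn_square [simp]: "msgn p i \<alpha> * msgn p i \<alpha> = 1"
  by (simp add: msgn_def flip: power_mult_distrib)

text \<open>To reach its place e_i passes only the factors with smaller index.\<close>

lemma msgn_Suc:
  assumes "1 \<le> j" "j \<noteq> i"
  shows "msgn p i (\<alpha>(j := Suc (\<alpha> j))) = (if j < i then (- 1) ^ (par p i * par p j) else 1) * msgn p i \<alpha>"
proof (cases "j < i")
  case True
  then have j: "j \<in> {1..<i}"
    using assms by simp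
  have "(\<Sum>l\<in>{1..<i} - {j}. par p l * (\<alpha>(j := Suc (\<alpha> j))) l) = (\<Sum>l\<in>{1..<i} - {j}. par p l * \<alpha> l)"
    by (intro sum.cong) auto
  then have "(\<Sum>l=1..<i. par p l * (\<alpha>(j := Suc (\<alpha> j))) l) = par p j + (\<Sum>l=1..<i. par p l * \<alpha> l)"
    using sum.remove[OF finite_atLeastLessThan j, of "\<lambda>l. par p l * (\<alpha>(j := Suc (\<alpha> j))) l"]
      sum.remove[OF finite_atLeastLessThan j, of "\<lambda>l. par p l * \<alpha> l"] by simp
  then show ?thesis
    using True by (simp add: msgn_def power_add add_mult_distrib2)
next
  case False
  then have "(\<Sum>l=1..<i. par p l * (\<alpha>(j := Suc (\<alpha> j))) l) = (\<Sum>l=1..<i. par p l * \<alpha> l)"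
    using assms by (intro sum.cong) auto
  then show ?thesis
    using False by (simp add: msgn_def)
qed

lemma msgn_pred:
  assumes "1 \<le> j" "j \<noteq> i" "0 < \<alpha> j"
  shows "msgn p i (\<alpha>(j := \<alpha> j - Suc 0)) = (if j < i then (- 1) ^ (par p i * par p j) else 1) * msgn p i \<alpha>"
proof -
  have "(\<alpha>(j := \<alpha> j - Suc 0))(j := Suc ((\<alpha>(j := \<alpha> j - Suc 0)) j)) = \<alpha>"
    using assms by (auto simp: fun_eq_iff)
  with msgn_Suc[OF assms(1,2), of p "\<alpha>(j := \<alpha> j - Suc 0)"]
  show ?thesis
    by (auto simp flip: power_mult_distrib mult.assoc)
qed

lemma MI_pos: "\<alpha> \<in> MI p q \<Longrightarrow> 0 < \<alpha> i \<Longrightarrow> i \<in> {1..p+q}"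
  unfolding MI_def by (metis (mono_tags, lifting) less_irrefl mem_Collect_eq)

lemma MI_upd:
  assumes "i \<in> {1..p+q}"
  shows "\<alpha>(i := n) \<in> MI p q \<longleftrightarrow> \<alpha>(i := 0) \<in> MI p q \<and> (p < i \<longrightarrow> n \<le> 1)"
  using assms by (auto simp: MI_def)

lemma MI_iff: "i \<in> {1..p+q} \<Longrightarrow> \<alpha> \<in> MI p q \<longleftrightarrow> \<alpha>(i := 0) \<in> MI p q \<and> (p < i \<longrightarrow> \<alpha> i \<le> 1)"
  using MI_upd[of i p q \<alpha> "\<alpha> i"] by simp

lemma Emul_add [simp]: "Emul p q i (v + w) = Emul p q i v + Emul p q i w"
  and Emul_scaleR [simp]: "Emul p q i (c *\<^sub>R v) = c *\<^sub>R Emul p q i v"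
  and Emul_zero [simp]: "Emul p q i 0 = 0"
  by (auto simp: Emul_def fun_eq_iff scaleR_add_right scaleR_fun_def)

lemma Imul_add [simp]: "Imul p i (v + w) = Imul p i v + Imul p i w"
  and Imul_scaleR [simp]: "Imul p i (c *\<^sub>R v) = c *\<^sub>R Imul p i v"
  and Imul_zero [simp]: "Imul p i 0 = 0"
  by (auto simp: Imul_def fun_eq_iff scaleR_add_right scaleR_fun_def)

lemma Emul_sum: "Emul p q i (\<Sum>a\<in>A. f a) = (\<Sum>a\<in>A. Emul p q i (f a))"
  using sum_comp_morphism[of "Emul p q i" f A] by (simp add: comp_def)

lemma Emul_outside: "\<alpha> \<notin> MI p q \<Longrightarrow> Emul p q i v \<alpha> = 0"
  by (simp add: Emul_def)

text \<open>For i \<noteq> j exactly one of the two signs \<open>msgn\<close> counts the other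
  index, namely that of the larger one.\<close>

lemma Emul_Emul:
  assumes "i \<in> {1..p+q}" "j \<in> {1..p+q}"
  shows "Emul p q i (Emul p q j v) = (- 1) ^ (par p i * par p j) *\<^sub>R Emul p q j (Emul p q i v)"
proof (cases "i = j")
  case True
  show ?thesis
  proof (cases "p < i")
    case odd: True
    \<comment> \<open>A nonzero value needs an exponent of at least 2 at i, which
      \<open>MI p q\<close> excludes for odd i.\<close>
    have "Emul p q i (Emul p q i v) = 0"
      using assms odd by (auto simp: Emul_def fun_eq_iff MI_def)
    then show ?thesis
      using True by simp
  qed (use True in \<open>simp add: par_def\<close>)
next
  case False
  show ?thesis
  proof
    fix \<alpha>
    show "Emul p q i (Emul p q j v) \<alpha> = ((- 1) ^ (par p i * par p j) *\<^sub>R Emul p q j (Emul p q i v)) \<alpha>"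
    proof (cases "\<alpha> \<in> MI p q \<and> 0 < \<alpha> i \<and> 0 < \<alpha> j")
      case True
      then have "\<alpha>(i := \<alpha> i - 1) \<in> MI p q" "\<alpha>(j := \<alpha> j - 1) \<in> MI p q"
        by (auto simp: MI_def)
      then show ?thesis
        using True False assms
        by (cases i j rule: linorder_cases)
          (auto simp: Emul_def msgn_pred scaleR_fun_def fun_upd_twist mult_ac simp flip: power_mult_distrib)
    qed (use False in \<open>auto simp: Emul_def scaleR_fun_def\<close>)
  qed
qed

text \<open>Unlike \<open>Emul\<close>, \<open>Imul\<close> does not test membership in
  \<open>MI p q\<close>; the support condition on v is what makes the square of an odd contraction
  vanish.\<close>

lemma Imul_Imul:
  assumes "i \<in> {1..p+q}" "j \<in> {1..p+q}" "\<And>\<alpha>. \<alpha> \<notin> MI p q \<Longrightarrow> v \<alpha> = 0"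
  shows "Imul p i (Imul p j v) = (- 1) ^ (par p i * par p j) *\<^sub>R Imul p j (Imul p i v)"
proof (cases "i = j")
  case True
  show ?thesis
  proof (cases "p < i")
    case odd: True
    have "v (\<alpha>(i := Suc (Suc n))) = 0" for \<alpha> n
      using assms odd by (intro assms(3)) (auto simp: MI_def)
    then have "Imul p i (Imul p i v) = 0"
      by (auto simp: Imul_def fun_eq_iff)
    then show ?thesis
      using True by simp
  qed (use True in \<open>simp add: par_def\<close>)
next
  case False
  then show ?thesis
    using assms
    by (cases i j rule: linorder_cases)
      (auto simp: Imul_def fun_eq_iff msgn_Suc scaleR_fun_def fun_upd_twist mult_ac simp flip: power_mult_distrib)
qed

text \<open>Let n be the exponent at i = j. For even i the two products have the coefficients n + 1
  and n; for odd i exactly one of them is nonzero, according to n = 0 or n = 1. For i \<noteq> j the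
  sign arises as in \<open>Emul_Emul\<close>.\<close>

lemma Imul_Emul:
  assumes "i \<in> {1..p+q}" "j \<in> {1..p+q}" "\<And>\<alpha>. \<alpha> \<notin> MI p q \<Longrightarrow> v \<alpha> = 0"
  shows "Imul p i (Emul p q j v) =
    (- 1) ^ (par p i * par p j) *\<^sub>R Emul p q j (Imul p i v) + (if i = j then v else 0)"
proof
  fix \<alpha>
  show "Imul p i (Emul p q j v) \<alpha> =
    ((- 1) ^ (par p i * par p j) *\<^sub>R Emul p q j (Imul p i v) + (if i = j then v else 0)) \<alpha>"
  proof (cases "i = j")
    case True
    show ?thesis
    proof (cases "\<alpha> \<in> MI p q")
      case in_MI: True
      show ?thesis
      proof (cases "p < i")
        case odd: True
        then have "\<alpha> i \<le> 1"
          using in_MI assms(1) by (auto simp: MI_def)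
        then have "\<alpha> i = 0 \<or> \<alpha> i = 1"
          by linarith
        moreover have "\<alpha>(i := Suc (\<alpha> i)) \<in> MI p q \<longleftrightarrow> \<alpha> i = 0"
          using in_MI odd MI_iff[OF assms(1), of \<alpha>] MI_upd[OF assms(1), of \<alpha> "Suc (\<alpha> i)"] by simp
        moreover have "\<alpha>(i := 0) = \<alpha>" if "\<alpha> i = 0"
          using that by (metis fun_upd_triv)
        moreover have "\<alpha>(i := Suc 0) = \<alpha>" if "\<alpha> i = Suc 0"
          using that by (metis fun_upd_triv)
        ultimately show ?thesis
          using True odd in_MI by (auto simp: Imul_def Emul_def par_def scaleR_fun_def)
      next
        case even: False
        then have "\<alpha>(i := Suc (\<alpha> i)) \<in> MI p q"
          using in_MI assms(1) by (auto simp: MI_def)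
        then have "Imul p i (Emul p q j v) \<alpha> = real (Suc (\<alpha> i)) *\<^sub>R v \<alpha>"
          using True by (simp add: Imul_def Emul_def mult.assoc)
        moreover have "Emul p q j (Imul p i v) \<alpha> = real (\<alpha> i) *\<^sub>R v \<alpha>"
        proof (cases "\<alpha> i")
          case (Suc m)
          then have "\<alpha>(i := Suc m) = \<alpha>"
            by (metis fun_upd_triv)
          then show ?thesis
            using Suc True in_MI by (simp add: Imul_def Emul_def mult.left_commute[of "msgn p i \<alpha>"])
        qed (use True in \<open>simp add: Emul_def\<close>)
        ultimately show ?thesis
          using True even by (simp add: par_def algebra_simps)
      qed
    next
      case not_MI: False
      then have "\<alpha>(i := Suc (\<alpha> i)) \<notin> MI p q"
        using MI_iff[OF assms(1), of \<alpha>] MI_upd[OF assms(1), of \<alpha> "Suc (\<alpha> i)"] by auto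
      then show ?thesis
        using True not_MI assms(3) by (simp add: Imul_def Emul_def scaleR_fun_def)
    qed
  next
    case False
    \<comment> \<open>Raising the exponent at i leaves \<open>MI p q\<close> only for odd i with
      exponent 1, and lowering another exponent does not repair this.\<close>
    have *: "\<alpha>(i := Suc (\<alpha> i), j := \<alpha> j - 1) \<notin> MI p q" if "\<alpha>(i := Suc (\<alpha> i)) \<notin> MI p q" "\<alpha> \<in> MI p q"
      using that assms(1,2) False by (auto simp: MI_def split: if_splits)
    have **: "\<alpha> \<in> MI p q" if "\<alpha>(i := Suc (\<alpha> i)) \<in> MI p q"
      using that assms(1,2) False by (auto simp: MI_def split: if_splits)
    show ?thesis
    proof (cases "\<alpha>(i := Suc (\<alpha> i)) \<in> MI p q \<and> 0 < \<alpha> j")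
      case True
      then show ?thesis
        using ** False assms(1,2)
        by (cases i j rule: linorder_cases)
          (auto simp: Imul_def Emul_def msgn_Suc msgn_pred fun_upd_twist scaleR_fun_def mult_ac simp flip: power_mult_distrib)
    next
      case 1: False
      show ?thesis
      proof (cases "\<alpha> j = 0")
        case True
        then show ?thesis
          using False by (simp add: Imul_def Emul_def)
      next
        case pos: False
        have "(\<alpha>(j := \<alpha> j - 1))(i := Suc ((\<alpha>(j := \<alpha> j - 1)) i)) = \<alpha>(i := Suc (\<alpha> i), j := \<alpha> j - 1)"
          using False by (auto simp: fun_eq_iff)
        moreover have "\<alpha> \<notin> MI p q \<or> v (\<alpha>(i := Suc (\<alpha> i), j := \<alpha> j - 1)) = 0"
          using 1 pos * assms(3) by blast
        ultimately have "\<alpha> \<notin> MI p q \<or> v ((\<alpha>(j := \<alpha> j - 1))(i := Suc ((\<alpha>(j := \<alpha> j - 1)) i))) = 0"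
          by simp
        then have "Emul p q j (Imul p i v) \<alpha> = 0"
          unfolding Emul_def Imul_def by (elim disjE) (simp_all del: fun_upd_apply)
        moreover have "Imul p i (Emul p q j v) \<alpha> = 0"
          using 1 pos by (simp add: Imul_def Emul_def)
        ultimately show ?thesis
          using False by simp
      qed
    qed
  qed
qed

lemma Emul_mono:
  "i \<in> {1..p+q} \<Longrightarrow> Emul p q i (mono \<alpha>) =
    (if \<alpha>(i := Suc (\<alpha> i)) \<in> MI p q then msgn p i \<alpha> *\<^sub>R mono (\<alpha>(i := Suc (\<alpha> i))) else 0)"
proof -
  have eq: "0 < \<beta> i \<and> \<beta>(i := \<beta> i - 1) = \<alpha> \<longleftrightarrow> \<beta> = \<alpha>(i := Suc (\<alpha> i))" for \<beta>
  proof
    assume *: "0 < \<beta> i \<and> \<beta>(i := \<beta> i - 1) = \<alpha>"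
    then have "\<alpha>(i := Suc (\<alpha> i)) = \<beta>(i := Suc (\<beta> i - 1))"
      by (metis fun_upd_same fun_upd_upd)
    with * show "\<beta> = \<alpha>(i := Suc (\<alpha> i))"
      by simp
  qed simp
  have "Emul p q i (mono \<alpha>) \<beta> =
      (if \<beta> \<in> MI p q \<and> 0 < \<beta> i \<and> \<beta>(i := \<beta> i - 1) = \<alpha> then msgn p i \<beta> else 0)" for \<beta>
    unfolding Emul_def mono_def by (cases "\<beta>(i := \<beta> i - 1) = \<alpha>") simp_all
  then have "Emul p q i (mono \<alpha>) \<beta> =
      (if \<beta> \<in> MI p q \<and> \<beta> = \<alpha>(i := Suc (\<alpha> i)) then msgn p i \<beta> else 0)" for \<beta>
    unfolding eq .
  then show ?thesis
    by (intro ext) (simp add: mono_def)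
qed

lemma mono_outside: "\<alpha> \<in> MI p q \<Longrightarrow> \<beta> \<notin> MI p q \<Longrightarrow> mono \<alpha> \<beta> = 0"
  by (auto simp: mono_def)

lemma zero_MI [simp]: "(\<lambda>_. 0) \<in> MI p q"
  by (simp add: MI_def)

lemmas pointwise = plus_fun_apply zero_fun_apply scaleR_fun_apply minus_apply uminus_apply

text \<open>These rules would unfold the vector space operations on symbols down to values at points.\<close>

declare pointwise [simp del]

lemma Imul_mono_zero [simp]: "Imul p i (mono (\<lambda>_. 0)) = 0"
proof -
  have "\<alpha>(i := Suc (\<alpha> i)) \<noteq> (\<lambda>_. 0)" for \<alpha> :: midx
    by (metis fun_upd_same nat.distinct(1))
  then show ?thesis
    by (intro ext) (simp add: Imul_def mono_def pointwise)
qed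

section \<open>Products of vectors as iterated multiplication operators\<close>

lemma deg_one_unit: "i \<in> {1..p+q} \<Longrightarrow> deg_one p q (unit_vec i) = mono (\<lambda>j. if j = i then 1 else 0)"
proof -
  assume i: "i \<in> {1..p+q}"
  have "deg_one p q (unit_vec i) = (\<Sum>k\<in>{1..p+q}. if k = i then mono (\<lambda>j. if j = i then 1 else 0) else 0)"
    unfolding deg_one_def unit_vec_def by (intro sum.cong) auto
  then show ?thesis
    using i by simp
qed

lemma deg_one_zero [simp]: "deg_one p q (\<lambda>_. 0) = 0"
  by (simp add: deg_one_def)

lemma vee_zero_left [simp]: "vee p q 0 v = 0"
  by (auto simp: vee_def fun_eq_iff pointwise)

lemma vee_zero_right [simp]: "vee p q v 0 = 0"
  by (auto simp: vee_def fun_eq_iff pointwise)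

lemma finite_below_MI:
  assumes "\<gamma> \<in> MI p q"
  shows "finite {\<alpha>::midx. \<forall>i. \<alpha> i \<le> \<gamma> i}"
proof -
  \<comment> \<open>The sum of the entries of \<gamma> is one bound for all places, which puts the
    set inside a set of functions between finite sets.\<close>
  have "{\<alpha>::midx. \<forall>i. \<alpha> i \<le> \<gamma> i} \<subseteq>
      {\<alpha>. \<forall>i. (i \<in> {1..p+q} \<longrightarrow> \<alpha> i \<in> {..\<Sum>j\<in>{1..p+q}. \<gamma> j}) \<and> (i \<notin> {1..p+q} \<longrightarrow> \<alpha> i = 0)}"
  proof (intro subsetI CollectI allI conjI impI)
    fix \<alpha> :: midx and i assume \<alpha>: "\<alpha> \<in> {\<alpha>. \<forall>i. \<alpha> i \<le> \<gamma> i}"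
    show "i \<in> {1..p+q} \<Longrightarrow> \<alpha> i \<in> {..\<Sum>j\<in>{1..p+q}. \<gamma> j}"
      using \<alpha> member_le_sum[of i "{1..p+q}" \<gamma>] by (auto intro: order_trans)
    show "i \<notin> {1..p+q} \<Longrightarrow> \<alpha> i = 0"
      using \<alpha> assms unfolding MI_def by (metis (mono_tags, lifting) le_zero_eq mem_Collect_eq)
  qed
  then show ?thesis
    by (rule finite_subset) (intro finite_set_of_finite_funs; simp)
qed

text \<open>The sign counts the odd entries of \<gamma> below i. The entry at i itself is never
  counted, so n is arbitrary.\<close>

lemma ksign_odd_supp:
  assumes "i \<in> {1..p+q}" "\<gamma> \<in> MI p q"
  shows "ksign (odd_supp p q (\<lambda>j. if j = i then 1 else 0)) (odd_supp p q (\<gamma>(i := n))) = msgn p i \<gamma>"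
proof (cases "p < i")
  case True
  have *: "odd_supp p q (\<lambda>j. if j = i then 1 else 0) = {i}"
    using True assms(1) by (auto simp: odd_supp_def)
  have "card {j \<in> odd_supp p q (\<gamma>(i := n)). j < i} = (\<Sum>l\<in>{j \<in> odd_supp p q (\<gamma>(i := n)). j < i}. par p l * \<gamma> l)"
    by (simp add: odd_supp_def par_def)
  also have "\<dots> = (\<Sum>l=1..<i. par p l * \<gamma> l)"
  proof (rule sum.mono_neutral_left)
    have "\<gamma> l = 0" if "p < l" "l < i" "\<gamma> l \<noteq> 1" for l
    proof -
      have "\<gamma> l \<le> 1"
        using assms that by (auto simp: MI_def)
      then show ?thesis
        using that by linarith
    qed
    then have "\<gamma> l = 0" if "p < l" "l < i" "\<gamma> l \<noteq> Suc 0" for l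
      using that by simp
    then show "\<forall>l\<in>{1..<i} - {j \<in> odd_supp p q (\<gamma>(i := n)). j < i}. par p l * \<gamma> l = 0"
      using assms(1) by (intro ballI) (auto simp: par_def odd_supp_def)
  qed (auto simp: odd_supp_def)
  finally show ?thesis
    using True unfolding * ksign_singleton by (simp add: msgn_def par_def)
next
  case False
  then have "odd_supp p q (\<lambda>j. if j = i then 1 else 0) = {}"
    by (auto simp: odd_supp_def)
  then show ?thesis
    using False by (simp add: msgn_def par_def)
qed

text \<open>Only the multi-index of e_i itself contributes to the sum. Products of unit vectors
  thereby become iterated \<open>Emul\<close>.\<close>

lemma vee_unit:
  assumes i: "i \<in> {1..p+q}"
  shows "vee p q (deg_one p q (unit_vec i)) v = Emul p q i v"
proof
  fix \<gamma>
  let ?e = "\<lambda>j::nat. if j = i then 1 else 0 :: nat"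
  show "vee p q (deg_one p q (unit_vec i)) v \<gamma> = Emul p q i v \<gamma>"
  proof (cases "\<gamma> \<in> MI p q")
    case True
    have "vee p q (deg_one p q (unit_vec i)) v \<gamma> = (\<Sum>\<alpha>\<in>{\<alpha>. \<forall>i. \<alpha> i \<le> \<gamma> i}.
        if \<alpha> = ?e then ksign (odd_supp p q ?e) (odd_supp p q (\<lambda>i. \<gamma> i - ?e i)) * v (\<lambda>i. \<gamma> i - ?e i) else 0)"
      unfolding vee_def deg_one_unit[OF i] using True by (auto simp: mono_def intro!: sum.cong)
    also have "\<dots> = (if ?e \<in> {\<alpha>. \<forall>i. \<alpha> i \<le> \<gamma> i} then
        ksign (odd_supp p q ?e) (odd_supp p q (\<lambda>i. \<gamma> i - ?e i)) * v (\<lambda>i. \<gamma> i - ?e i) else 0)"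
      by (rule sum.delta[OF finite_below_MI[OF True]])
    also have "(\<lambda>i. \<gamma> i - ?e i) = \<gamma>(i := \<gamma> i - 1)"
      by auto
    also have "?e \<in> {\<alpha>. \<forall>i. \<alpha> i \<le> \<gamma> i} \<longleftrightarrow> 0 < \<gamma> i"
      by (auto simp: Suc_le_eq)
    finally show ?thesis
      using True unfolding ksign_odd_supp[OF i True] by (simp add: Emul_def)
  qed (simp add: vee_def Emul_def)
qed

text \<open>The letters may come in any order: replacing a letter of
  \<open>word p q \<alpha>\<close> by another one destroys its monotonicity.\<close>

definition wordv :: "nat \<Rightarrow> nat \<Rightarrow> nat list \<Rightarrow> symv" where
  "wordv p q w = foldr (Emul p q) w (mono (\<lambda>_. 0))"

lemma wordv_simps [simp]: "wordv p q [] = mono (\<lambda>_. 0)" "wordv p q (i # w) = Emul p q i (wordv p q w)"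
  by (simp_all add: wordv_def)

lemma wordv_outside: "\<alpha> \<notin> MI p q \<Longrightarrow> wordv p q w \<alpha> = 0"
  by (cases w) (simp_all add: mono_outside Emul_outside)

lemma vee_list_units: "set w \<subseteq> {1..p+q} \<Longrightarrow> vee_list p q (map unit_vec w) = wordv p q w"
  by (induction w) (simp_all add: vee_list_def vee_unit)

lemma vee_list_zero: "(\<lambda>_. 0) \<in> set vs \<Longrightarrow> vee_list p q vs = 0"
  by (induction vs) (auto simp: vee_list_def)

lemma Emul_wordv:
  assumes "j \<in> {1..p+q}" "set u \<subseteq> {1..p+q}"
  shows "Emul p q j (wordv p q (u @ v)) = (- 1) ^ (par p j * (\<Sum>i\<leftarrow>u. par p i)) *\<^sub>R wordv p q (u @ j # v)"
  using assms(2)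
proof (induction u)
  case (Cons i u)
  then show ?case
    using Emul_Emul[OF assms(1), of i "wordv p q (u @ v)"]
    by (simp add: add_mult_distrib2 power_add)
qed simp

text \<open>Contraction is a superderivation: \<open>Imul_Emul\<close> moves it past one letter at a
  time, which reproduces the sum in \<open>interior_hom\<close>.\<close>

lemma Imul_wordv:
  assumes "i \<in> {1..p+q}" "set w \<subseteq> {1..p+q}"
  shows "Imul p i (wordv p q w) = (\<Sum>m<length w. if w ! m = i
    then (- 1) ^ (par p i * (\<Sum>l<m. par p (w ! l))) *\<^sub>R wordv p q (take m w @ drop (Suc m) w) else 0)"
  using assms(2)
proof (induction w)
  case (Cons k w)
  let ?t = "\<lambda>w m. if w ! m = i
    then (- 1) ^ (par p i * (\<Sum>l<m. par p (w ! l))) *\<^sub>R wordv p q (take m w @ drop (Suc m) w) else 0"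
  have "?t (k # w) (Suc m) = (- 1) ^ (par p i * par p k) *\<^sub>R Emul p q k (?t w m)" for m
    by (simp add: sum.lessThan_Suc_shift add_mult_distrib2 power_add del: sum.lessThan_Suc)
  then have "(\<Sum>m<length (k # w). ?t (k # w) m) = (- 1) ^ (par p i * par p k) *\<^sub>R Emul p q k (\<Sum>m<length w. ?t w m)
      + (if i = k then wordv p q w else 0)"
    by (simp add: sum.lessThan_Suc_shift Emul_sum scaleR_right.sum del: sum.lessThan_Suc)
  then show ?case
    using Cons Imul_Emul[OF assms(1), of k "wordv p q w"] by (simp add: wordv_outside)
qed simp

text \<open>Replacing an occurrence of e_i by e_j is contraction with \<epsilon>^i followed by
  multiplication with e_j, so \<rho>(e^i_j) belongs to the Weyl algebra. The signs of the two
  passages combine to that of the matrix unit, of parity par i + par j.\<close>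

lemma Emul_Imul_wordv:
  assumes "i \<in> {1..p+q}" "j \<in> {1..p+q}" "set w \<subseteq> {1..p+q}"
  shows "Emul p q j (Imul p i (wordv p q w)) = (\<Sum>m<length w. if w ! m = i
    then (- 1) ^ ((par p i + par p j) * (\<Sum>l<m. par p (w ! l))) *\<^sub>R wordv p q (w[m := j]) else 0)"
proof -
  have "Emul p q j (if w ! m = i
      then (- 1) ^ (par p i * (\<Sum>l<m. par p (w ! l))) *\<^sub>R wordv p q (take m w @ drop (Suc m) w) else 0) =
    (if w ! m = i then (- 1) ^ ((par p i + par p j) * (\<Sum>l<m. par p (w ! l))) *\<^sub>R wordv p q (w[m := j]) else 0)"
    if "m < length w" for m
  proof -
    have "(\<Sum>k\<leftarrow>take m w. par p k) = (\<Sum>l<m. par p (w ! l))"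
      using that by (simp add: sum_list_sum_nth atLeast0LessThan)
    moreover have "set (take m w) \<subseteq> {1..p+q}"
      using assms(3) set_take_subset[of m w] by auto
    ultimately show ?thesis
      using Emul_wordv[OF assms(2), of "take m w" "drop (Suc m) w"] that
      by (simp add: upd_conv_take_nth_drop add_mult_distrib power_add)
  qed
  then show ?thesis
    unfolding Imul_wordv[OF assms(1,3)] Emul_sum by (intro sum.cong) auto
qed

lemma MI_upd_mono: "i \<in> {1..p+q} \<Longrightarrow> \<alpha>(i := n) \<in> MI p q \<Longrightarrow> m \<le> n \<Longrightarrow> \<alpha>(i := m) \<in> MI p q"
  using MI_upd[of i p q \<alpha> n] MI_upd[of i p q \<alpha> m] by auto

text \<open>No entry of \<beta> stands at or before k, so no sign arises.\<close>

lemma wordv_replicate: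
  assumes "k \<in> {1..p+q}" "\<beta>(k := m) \<in> MI p q" "\<And>l. l \<le> k \<Longrightarrow> \<beta> l = 0"
  shows "foldr (Emul p q) (replicate m k) (mono \<beta>) = mono (\<beta>(k := m))"
  using assms(2)
proof (induction m)
  case 0
  then show ?case
    using assms(3)[of k] by (simp add: fun_upd_idem)
next
  case (Suc m)
  have "\<beta>(k := m) \<in> MI p q"
    by (rule MI_upd_mono[OF assms(1) Suc.prems]) simp
  moreover have "(\<Sum>l=1..<k. par p l * \<beta> l) = 0"
    using assms(3) by simp
  then have "msgn p k \<beta> = 1"
    unfolding msgn_def by (simp only: mult_0_right power_0)
  moreover have "\<beta>(k := Suc m) \<in> MI p q"
    by (rule Suc.prems)
  moreover have "foldr (Emul p q) (replicate m k) (mono \<beta>) = mono (\<beta>(k := m))"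
    by (rule Suc.IH) fact
  ultimately have "foldr (Emul p q) (replicate (Suc m) k) (mono \<beta>) = mono (\<beta>(k := Suc m))"
    using Emul_mono[OF assms(1), of "\<beta>(k := m)"] by simp
  then show ?case .
qed

lemma wordv_word:
  assumes \<alpha>: "\<alpha> \<in> MI p q"
  shows "wordv p q (word p q \<alpha>) = mono \<alpha>"
proof -
  \<comment> \<open>Downward induction on k: each new letter is the smallest so far and is put in
    front.\<close>
  have "wordv p q (concat (map (\<lambda>i. replicate (\<alpha> i) i) [k..<p+q+1])) = mono (\<lambda>i. if k \<le> i then \<alpha> i else 0)"
    if "1 \<le> k" "k \<le> p+q+1" for k
    using that(2,1)
  proof (induction rule: inc_induct)
    case base
    have "(\<lambda>i. if p + q + 1 \<le> i then \<alpha> i else 0) = (\<lambda>_. 0)"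
      using \<alpha> by (auto simp: MI_def)
    then show ?case
      by simp
  next
    case (step k)
    let ?b = "\<lambda>i. if Suc k \<le> i then \<alpha> i else 0"
    have b: "?b(k := \<alpha> k) = (\<lambda>i. if k \<le> i then \<alpha> i else 0)"
      by (auto simp: fun_eq_iff)
    have "foldr (Emul p q) (replicate (\<alpha> k) k) (mono ?b) = mono (?b(k := \<alpha> k))"
      using step \<alpha> by (intro wordv_replicate) (auto simp: MI_def)
    then show ?case
      using step unfolding b by (simp add: upt_conv_Cons wordv_def del: upt_Suc)
  qed
  from this[of 1] have "wordv p q (word p q \<alpha>) = mono (\<lambda>i. if 1 \<le> i then \<alpha> i else 0)"
    unfolding word_def by simp
  also have "(\<lambda>i. if 1 \<le> i then \<alpha> i else 0) = \<alpha>"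
    using \<alpha> by (auto simp: MI_def fun_eq_iff)
  finally show ?thesis .
qed

lemma set_word: "set (word p q \<alpha>) \<subseteq> {1..p+q}"
  by (auto simp: word_def)

lemma interior_hom_unit:
  assumes "\<alpha> \<in> MI p q" "i \<in> {1..p+q}"
  shows "interior_hom p q a (rpart p a (unit_vec i)) \<alpha> = (if par p i = a then Imul p i (mono \<alpha>) else 0)"
proof -
  have "set (take m (word p q \<alpha>) @ drop (Suc m) (word p q \<alpha>)) \<subseteq> {1..p+q}" for m
    unfolding set_append by (intro Un_least order_trans[OF set_take_subset set_word] order_trans[OF set_drop_subset set_word])
  then have "interior_hom p q a (rpart p a (unit_vec i)) \<alpha> = (\<Sum>m<length (word p q \<alpha>).
     ((- 1) ^ (a * (\<Sum>l<m. par p (word p q \<alpha> ! l))) * rpart p a (unit_vec i) (word p q \<alpha> ! m)) *\<^sub>R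
          wordv p q (take m (word p q \<alpha>) @ drop (Suc m) (word p q \<alpha>)))"
    unfolding interior_hom_def Let_def by (simp only: vee_list_units)
  also have "\<dots> = (if par p i = a then Imul p i (wordv p q (word p q \<alpha>)) else 0)"
    unfolding Imul_wordv[OF assms(2) set_word]
    by (auto simp: rpart_def unit_vec_def intro!: sum.cong sum.neutral)
  finally show ?thesis
    by (simp add: wordv_word assms)
qed

lemma rho_sym_elem_mat:
  assumes \<alpha>: "\<alpha> \<in> MI p q" and "i \<in> {1..p+q}" "j \<in> {1..p+q}"
  shows "rho_sym p q (elem_mat i j) \<alpha> = Emul p q j (Imul p i (mono \<alpha>))"
proof -
  define w where "w = word p q \<alpha>"
  have w: "set w \<subseteq> {1..p+q}"
    unfolding w_def by (rule set_word)
  have t: "vee_list p q ((map unit_vec w)[m := (\<lambda>r. mpart p a (elem_mat i j) r (w ! m))]) =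
      (if w ! m = i \<and> (par p i + par p j) mod 2 = a mod 2 then wordv p q (w[m := j]) else 0)" if m: "m < length w" for a m
  proof (cases "w ! m = i \<and> (par p i + par p j) mod 2 = a mod 2")
    case True
    then have "(\<lambda>r. mpart p a (elem_mat i j) r (w ! m)) = unit_vec j"
      by (auto simp: mpart_def elem_mat_def unit_vec_def fun_eq_iff add.commute)
    moreover have "set (w[m := j]) \<subseteq> {1..p+q}"
      using w assms(3) set_update_subset_insert[of w m j] by auto
    ultimately show ?thesis
      using True vee_list_units[of "w[m := j]" p q] by (simp add: map_update)
  next
    case False
    then have "(\<lambda>r. mpart p a (elem_mat i j) r (w ! m)) = (\<lambda>_. 0)"
      by (auto simp: mpart_def elem_mat_def fun_eq_iff add.commute)
    moreover have "(\<lambda>_. 0) \<in> set ((map unit_vec w)[m := (\<lambda>_. 0)])"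
      using m by (simp add: set_update_memI)
    ultimately show ?thesis
      using False by (auto simp: vee_list_zero)
  qed
  have "rho_sym p q (elem_mat i j) \<alpha> = (\<Sum>a\<in>{0,1}. \<Sum>m<length w. if w ! m = i \<and> (par p i + par p j) mod 2 = a mod 2
      then (- 1) ^ (a * (\<Sum>l<m. par p (w ! l))) *\<^sub>R wordv p q (w[m := j]) else 0)"
    unfolding rho_sym_def Let_def w_def[symmetric] by (intro sum.cong) (auto simp: t)
  also have "\<dots> = (\<Sum>m<length w. if w ! m = i
    then (- 1) ^ ((par p i + par p j) * (\<Sum>l<m. par p (w ! l))) *\<^sub>R wordv p q (w[m := j]) else 0)"
  proof -
    \<comment> \<open>Two odd indices belong to the component a = 0, while the exponent on the right
      contains the factor 2; the signs agree.\<close>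
    have "(\<Sum>a\<in>{0,1}. if w ! m = i \<and> (par p i + par p j) mod 2 = a mod 2
      then (- 1) ^ (a * (\<Sum>l<m. par p (w ! l))) *\<^sub>R wordv p q (w[m := j]) else 0) = (if w ! m = i
      then (- 1) ^ ((par p i + par p j) * (\<Sum>l<m. par p (w ! l))) *\<^sub>R wordv p q (w[m := j]) else 0)" for m
      by (auto simp: par_def power_mult)
    then show ?thesis
      by (subst sum.swap) simp
  qed
  also have "\<dots> = Emul p q j (Imul p i (wordv p q w))"
    using Emul_Imul_wordv assms w by simp
  finally show ?thesis
    unfolding w_def wordv_word[OF \<alpha>] .
qed

lemma supertrace_elem_mat:
  "i \<in> {1..p+q} \<Longrightarrow> supertrace p q (elem_mat i j) = (if i = j then (- 1) ^ par p i else 0)"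
proof -
  assume i: "i \<in> {1..p+q}"
  have "supertrace p q (elem_mat i j) = (\<Sum>l\<in>{1..p+q}. if l = i then if i = j then (- 1) ^ par p i else 0 else 0)"
    unfolding supertrace_def elem_mat_def by (intro sum.cong) auto
  then show ?thesis
    using i by simp
qed

lemma rho_elem_mat:
  assumes "\<alpha> \<in> MI p q" "i \<in> {1..p+q}" "j \<in> {1..p+q}"
  shows "rho p q \<delta> (elem_mat i j) \<alpha> =
    Emul p q j (Imul p i (mono \<alpha>)) - (\<delta> * (if i = j then (- 1) ^ par p i else 0)) *\<^sub>R mono \<alpha>"
  using assms by (simp add: rho_def rho_sym_elem_mat supertrace_elem_mat)

section \<open>Iterated derivatives\<close>

lemma sderiv_pow_SF [simp]: "f \<in> SF p q \<Longrightarrow> i \<in> {1..p+q} \<Longrightarrow> (sderiv p i ^^ m) f \<in> SF p q"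
  by (induction m) simp_all

lemma sderiv_pow_scaleR: "f \<in> SF p q \<Longrightarrow> i \<in> {1..p+q} \<Longrightarrow>
    (sderiv p i ^^ m) (c *\<^sub>R f) = c *\<^sub>R (sderiv p i ^^ m) f"
  by (induction m) (simp_all add: sderiv_scaleR[of _ p q])

lemma sderiv_pow_add: "f \<in> SF p q \<Longrightarrow> g \<in> SF p q \<Longrightarrow> i \<in> {1..p+q} \<Longrightarrow>
    (sderiv p i ^^ m) (f + g) = (sderiv p i ^^ m) f + (sderiv p i ^^ m) g"
  by (induction m) (simp_all add: sderiv_add[of _ p q])

lemma sderiv_sderiv_pow:
  assumes "f \<in> SF p q" "i \<in> {1..p+q}" "j \<in> {1..p+q}"
  shows "sderiv p i ((sderiv p j ^^ m) f) = (- 1) ^ (par p i * (par p j * m)) *\<^sub>R (sderiv p j ^^ m) (sderiv p i f)"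
proof (induction m)
  case (Suc m)
  then show ?case
    using assms sderiv_commute[of "(sderiv p j ^^ m) f" p q i j] by (simp add: algebra_simps power_add sderiv_scaleR[of _ p q])
qed simp

text \<open>The tail of \<open>mderiv\<close> from index k on, made for downward induction on
  k.\<close>

definition mderiv_from :: "nat \<Rightarrow> nat \<Rightarrow> nat \<Rightarrow> midx \<Rightarrow> sfun \<Rightarrow> sfun" where
  "mderiv_from p q k \<alpha> f = foldr (\<lambda>i. sderiv p i ^^ \<alpha> i) [k..<p+q+1] f"

lemma mderiv_from_step: "k \<le> p + q \<Longrightarrow>
    mderiv_from p q k \<alpha> f = (sderiv p k ^^ \<alpha> k) (mderiv_from p q (Suc k) \<alpha> f)"
  unfolding mderiv_from_def by (simp add: upt_conv_Cons del: upt_Suc)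

lemma mderiv_eq: "mderiv p q \<alpha> f = mderiv_from p q 1 \<alpha> f"
  by (simp add: mderiv_def mderiv_from_def)

lemma mderiv_from_SF [simp]: "f \<in> SF p q \<Longrightarrow> 1 \<le> k \<Longrightarrow> mderiv_from p q k \<alpha> f \<in> SF p q"
proof (cases "k \<le> p+q+1")
  case True
  assume f: "f \<in> SF p q" and k: "1 \<le> k"
  show ?thesis
    using True k
  proof (induction rule: inc_induct)
    case base
    then show ?case
      using f by (simp add: mderiv_from_def)
  next
    case (step m)
    then show ?case
      by (simp add: mderiv_from_step)
  qed
qed (simp add: mderiv_from_def)

lemma mderiv_SF [simp]: "f \<in> SF p q \<Longrightarrow> mderiv p q \<alpha> f \<in> SF p q"
  by (simp add: mderiv_eq)

lemma mderiv_scaleR: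
  assumes f: "f \<in> SF p q"
  shows "mderiv p q \<alpha> (c *\<^sub>R f) = c *\<^sub>R mderiv p q \<alpha> f"
proof -
  have "1 \<le> k \<longrightarrow> mderiv_from p q k \<alpha> (c *\<^sub>R f) = c *\<^sub>R mderiv_from p q k \<alpha> f" if "k \<le> p+q+1" for k
    using that
  proof (induction rule: inc_induct)
    case (step m)
    then show ?case
      using f by (simp add: mderiv_from_step sderiv_pow_scaleR[of _ p q])
  qed (simp add: mderiv_from_def)
  then show ?thesis
    by (simp add: mderiv_eq)
qed

lemma mderiv_add:
  assumes f: "f \<in> SF p q" and g: "g \<in> SF p q"
  shows "mderiv p q \<alpha> (f + g) = mderiv p q \<alpha> f + mderiv p q \<alpha> g"
proof -
  have "1 \<le> k \<longrightarrow> mderiv_from p q k \<alpha> (f + g) = mderiv_from p q k \<alpha> f + mderiv_from p q k \<alpha> g"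
    if "k \<le> p+q+1" for k
    using that
  proof (induction rule: inc_induct)
    case (step m)
    then show ?case
      using f g by (simp add: mderiv_from_step sderiv_pow_add[of _ p q])
  qed (simp add: mderiv_from_def)
  then show ?thesis
    by (simp add: mderiv_eq)
qed

lemma mderiv_zero: "mderiv p q (\<lambda>_. 0) f = f"
proof -
  have "foldr (\<lambda>i. sderiv p i ^^ 0) xs f = f" for xs :: "nat list"
    by (induction xs) simp_all
  then show ?thesis
    by (simp add: mderiv_def)
qed

text \<open>The same sign and the same vanishing rule as in \<open>Emul_mono\<close>; this is why
  multiplication with e_i models composition with a derivative.\<close>

lemma sderiv_mderiv:
  assumes f: "f \<in> SF p q" and i: "i \<in> {1..p+q}" and \<alpha>: "\<alpha> \<in> MI p q"
  shows "sderiv p i (mderiv p q \<alpha> f) =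
    (if \<alpha>(i := Suc (\<alpha> i)) \<in> MI p q then msgn p i \<alpha> *\<^sub>R mderiv p q (\<alpha>(i := Suc (\<alpha> i))) f else 0)"
proof -
  define \<beta> where "\<beta> = \<alpha>(i := Suc (\<alpha> i))"
  define c :: real where "c = (if \<beta> \<in> MI p q then 1 else 0)"
  have base: "sderiv p i (mderiv_from p q i \<alpha> f) = c *\<^sub>R mderiv_from p q i \<beta> f"
  proof -
    define g where "g = mderiv_from p q (Suc i) \<alpha> f"
    have g: "g = mderiv_from p q (Suc i) \<beta> f" "g \<in> SF p q"
      unfolding g_def mderiv_from_def[of p q "Suc i"] using f mderiv_from_SF[of f p q "Suc i" \<alpha>]
      by (auto simp: \<beta>_def mderiv_from_def intro!: foldr_cong)
    have 1: "mderiv_from p q i \<alpha> f = (sderiv p i ^^ \<alpha> i) g" "mderiv_from p q i \<beta> f = (sderiv p i ^^ Suc (\<alpha> i)) g"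
      using i g(1) by (simp_all add: mderiv_from_step g_def) (simp add: \<beta>_def)
    show ?thesis
    proof (cases "\<beta> \<in> MI p q")
      case True
      then show ?thesis
        by (simp add: 1 c_def)
    next
      case False
      then have *: "p < i" "\<alpha> i = 1"
        using MI_iff[OF i, of \<alpha>] MI_upd[OF i, of \<alpha> "Suc (\<alpha> i)"] \<alpha> by (auto simp: \<beta>_def)
      \<comment> \<open>An odd derivative anticommutes with itself, so its square is 0.\<close>
      have "sderiv p i (sderiv p i g) = - sderiv p i (sderiv p i g)"
        using sderiv_commute[OF g(2) i i] *(1) by (simp add: par_def)
      then have "sderiv p i (sderiv p i g) = 0"
        by (simp add: eq_neg_iff_add_eq_0 flip: scaleR_2)
      then show ?thesis
        using False * by (simp add: 1 c_def)
    qed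
  qed
  \<comment> \<open>Starting at i and going down, d_i passes one block of derivatives at a time; the
    exponent accumulates the odd ones.\<close>
  have "1 \<le> k \<longrightarrow> sderiv p i (mderiv_from p q k \<alpha> f) =
      ((- 1) ^ (par p i * (\<Sum>l=k..<i. par p l * \<alpha> l)) * c) *\<^sub>R mderiv_from p q k \<beta> f" if "k \<le> i" for k
    using that
  proof (induction rule: inc_induct)
    case base
    then show ?case
      using \<open>sderiv p i (mderiv_from p q i \<alpha> f) = c *\<^sub>R mderiv_from p q i \<beta> f\<close> by simp
  next
    case (step m)
    have "(\<Sum>l=m..<i. par p l * \<alpha> l) = par p m * \<alpha> m + (\<Sum>l=Suc m..<i. par p l * \<alpha> l)"
      using step by (simp add: sum.atLeast_Suc_lessThan)
    moreover have "\<beta> m = \<alpha> m"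
      using step by (simp add: \<beta>_def)
    ultimately show ?case
      using step f i sderiv_sderiv_pow[of "mderiv_from p q (Suc m) \<alpha> f" p q i m "\<alpha> m"]
      by (auto simp: mderiv_from_step sderiv_pow_scaleR[of _ p q] add_mult_distrib2 power_add)
  qed
  from this[of 1] show ?thesis
    using i by (simp add: mderiv_eq msgn_def c_def \<beta>_def)
qed

section \<open>Symbols\<close>

definition Yop :: "nat \<Rightarrow> nat \<Rightarrow> symbol \<Rightarrow> symbol" where
  "Yop p j T = (\<lambda>\<alpha>. sprod (coord p j) (T \<alpha>))"

definition Dop :: "nat \<Rightarrow> nat \<Rightarrow> symbol \<Rightarrow> symbol" where
  "Dop p j T = (\<lambda>\<alpha>. sderiv p j (T \<alpha>))"

text \<open>The twist is the sign of moving e_j past the coefficient, which stands to the left of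
  the monomial. The same holds for the contraction.\<close>

definition Eop :: "nat \<Rightarrow> nat \<Rightarrow> nat \<Rightarrow> symbol \<Rightarrow> symbol" where
  "Eop p q j T = Emul p q j (\<lambda>\<alpha>. twist (par p j) (T \<alpha>))"

definition Iop :: "nat \<Rightarrow> nat \<Rightarrow> symbol \<Rightarrow> symbol" where
  "Iop p j T = Imul p j (\<lambda>\<alpha>. twist (par p j) (T \<alpha>))"

definition Lmul :: "sfun \<Rightarrow> symbol \<Rightarrow> symbol" where
  "Lmul f T = (\<lambda>\<alpha>. sprod f (T \<alpha>))"

lemma symbol_pointwise: "(S + T) \<alpha> = S \<alpha> + T \<alpha>" "(0::symbol) \<alpha> = 0" "(c *\<^sub>R T) \<alpha> = c *\<^sub>R T \<alpha>"
  "(S - T) \<alpha> = S \<alpha> - T \<alpha>" "(- T) \<alpha> = - T \<alpha>" for S T :: symbol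
  by (simp_all add: pointwise)

lemma SymI:
  assumes "\<And>\<alpha>. T \<alpha> \<in> SF p q" "\<And>\<alpha>. \<alpha> \<notin> MI p q \<Longrightarrow> T \<alpha> = 0" "{\<alpha>. T \<alpha> \<noteq> 0} \<subseteq> A" "finite A"
  shows "T \<in> Sym p q"
  using assms finite_subset by (auto simp: Sym_def)

lemma SymD:
  assumes "T \<in> Sym p q"
  shows "T \<alpha> \<in> SF p q" "\<alpha> \<notin> MI p q \<Longrightarrow> T \<alpha> = 0" "finite {\<alpha>. T \<alpha> \<noteq> 0}"
  using assms by (auto simp: Sym_def)

lemma Sym_map:
  assumes "T \<in> Sym p q" "\<And>f. f \<in> SF p q \<Longrightarrow> F f \<in> SF p q" "F 0 = 0"
  shows "(\<lambda>\<alpha>. F (T \<alpha>)) \<in> Sym p q"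
  using assms by (intro SymI[of _ p q "{\<alpha>. T \<alpha> \<noteq> 0}"]) (auto simp: SymD)

lemma subspace_Sym: "subspace (Sym p q)"
proof (rule subspaceI)
  show "0 \<in> Sym p q"
    by (rule SymI[of _ _ _ "{}"]) (auto simp: symbol_pointwise)
  show "S + T \<in> Sym p q" if "S \<in> Sym p q" "T \<in> Sym p q" for S T
    by (rule SymI[of _ _ _ "{\<alpha>. S \<alpha> \<noteq> 0} \<union> {\<alpha>. T \<alpha> \<noteq> 0}"])
      (auto simp: SymD[OF that(1)] SymD[OF that(2)] plus_fun_apply[of S T])
  show "c *\<^sub>R T \<in> Sym p q" if "T \<in> Sym p q" for c T
    by (rule SymI[of _ _ _ "{\<alpha>. T \<alpha> \<noteq> 0}"]) (auto simp: SymD[OF that] scaleR_fun_apply[of c T])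
qed

lemma Sym_closed [simp]: "0 \<in> Sym p q" "S \<in> Sym p q \<Longrightarrow> T \<in> Sym p q \<Longrightarrow> S + T \<in> Sym p q"
  "T \<in> Sym p q \<Longrightarrow> c *\<^sub>R T \<in> Sym p q" "S \<in> Sym p q \<Longrightarrow> T \<in> Sym p q \<Longrightarrow> S - T \<in> Sym p q"
  "T \<in> Sym p q \<Longrightarrow> - T \<in> Sym p q" "(\<And>a. a \<in> A \<Longrightarrow> F a \<in> Sym p q) \<Longrightarrow> sum F A \<in> Sym p q"
  using subspace_Sym[of p q]
  by (auto simp: subspace_0 subspace_add subspace_scale subspace_diff subspace_neg intro: subspace_sum)

lemma Yop_Sym [simp]: "i \<in> {1..p+q} \<Longrightarrow> T \<in> Sym p q \<Longrightarrow> Yop p i T \<in> Sym p q"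
  unfolding Yop_def by (rule Sym_map[where F = "sprod (coord p i)"]) simp_all

lemma Dop_Sym [simp]: "i \<in> {1..p+q} \<Longrightarrow> T \<in> Sym p q \<Longrightarrow> Dop p i T \<in> Sym p q"
  unfolding Dop_def by (rule Sym_map[where F = "sderiv p i"]) simp_all

lemma Eop_Sym [simp]:
  assumes "i \<in> {1..p+q}" "T \<in> Sym p q"
  shows "Eop p q i T \<in> Sym p q"
proof (rule SymI)
  show "{\<alpha>. Eop p q i T \<alpha> \<noteq> 0} \<subseteq> (\<lambda>\<alpha>. \<alpha>(i := Suc (\<alpha> i))) ` {\<alpha>. T \<alpha> \<noteq> 0}"
  proof
    fix \<alpha> assume "\<alpha> \<in> {\<alpha>. Eop p q i T \<alpha> \<noteq> 0}"
    then have "0 < \<alpha> i" "T (\<alpha>(i := \<alpha> i - 1)) \<noteq> 0"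
      by (auto simp: Eop_def Emul_def split: if_splits)
    then show "\<alpha> \<in> (\<lambda>\<alpha>. \<alpha>(i := Suc (\<alpha> i))) ` {\<alpha>. T \<alpha> \<noteq> 0}"
      by (intro image_eqI[of _ _ "\<alpha>(i := \<alpha> i - 1)"]) auto
  qed
qed (use assms SymD[OF assms(2)] in \<open>auto simp: Eop_def Emul_def\<close>)

lemma Iop_Sym [simp]:
  assumes "i \<in> {1..p+q}" "T \<in> Sym p q"
  shows "Iop p i T \<in> Sym p q"
proof (rule SymI)
  show "{\<alpha>. Iop p i T \<alpha> \<noteq> 0} \<subseteq> (\<lambda>\<alpha>. \<alpha>(i := \<alpha> i - 1)) ` {\<alpha>. T \<alpha> \<noteq> 0}"
  proof
    fix \<alpha> assume "\<alpha> \<in> {\<alpha>. Iop p i T \<alpha> \<noteq> 0}"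
    then have "T (\<alpha>(i := Suc (\<alpha> i))) \<noteq> 0"
      by (auto simp: Iop_def Imul_def)
    then show "\<alpha> \<in> (\<lambda>\<alpha>. \<alpha>(i := \<alpha> i - 1)) ` {\<alpha>. T \<alpha> \<noteq> 0}"
      by (intro image_eqI[of _ _ "\<alpha>(i := Suc (\<alpha> i))"]) auto
  qed
  show "Iop p i T \<alpha> = 0" if "\<alpha> \<notin> MI p q" for \<alpha>
  proof -
    have "\<alpha>(i := Suc (\<alpha> i)) \<notin> MI p q"
      using MI_iff[OF assms(1), of \<alpha>] MI_upd[OF assms(1), of \<alpha> "Suc (\<alpha> i)"] that by auto
    then show ?thesis
      using SymD(2)[OF assms(2)] by (simp add: Iop_def Imul_def)
  qed
qed (use assms SymD[OF assms(2)] in \<open>auto simp: Iop_def Imul_def\<close>)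

lemma Emul_map:
  assumes "\<And>c f. F (c *\<^sub>R f) = c *\<^sub>R F f"
  shows "Emul p q i (\<lambda>\<alpha>. F (v \<alpha>)) = (\<lambda>\<alpha>. F (Emul p q i v \<alpha>))"
  using assms[of 0] assms by (auto simp: Emul_def fun_eq_iff)

lemma Imul_map:
  assumes "\<And>c f. F (c *\<^sub>R f) = c *\<^sub>R F f"
  shows "Imul p i (\<lambda>\<alpha>. F (v \<alpha>)) = (\<lambda>\<alpha>. F (Imul p i v \<alpha>))"
  using assms by (auto simp: Imul_def fun_eq_iff)

lemma Emul_Imul_scaled_map:
  assumes "\<And>c \<alpha>. F (c *\<^sub>R v \<alpha>) = c *\<^sub>R F (v \<alpha>)"
  shows "Emul p q i (\<lambda>\<alpha>. d *\<^sub>R F (v \<alpha>)) = d *\<^sub>R (\<lambda>\<alpha>. F (Emul p q i v \<alpha>))"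
    and "Imul p i (\<lambda>\<alpha>. d *\<^sub>R F (v \<alpha>)) = d *\<^sub>R (\<lambda>\<alpha>. F (Imul p i v \<alpha>))"
  using assms[of 0] assms by (auto simp: Emul_def Imul_def fun_eq_iff symbol_pointwise scaleR_fun_apply mult.commute)

lemma Eop_eq: "Eop p q i T = (\<lambda>\<alpha>. twist (par p i) (Emul p q i T \<alpha>))"
  unfolding Eop_def by (rule Emul_map[where F = "twist (par p i)"]) simp

lemma Iop_eq: "Iop p i T = (\<lambda>\<alpha>. twist (par p i) (Imul p i T \<alpha>))"
  unfolding Iop_def by (rule Imul_map[where F = "twist (par p i)"]) simp

lemma symbol_scaleR: "c *\<^sub>R (\<lambda>\<alpha>. (f \<alpha> :: sfun)) = (\<lambda>\<alpha>. c *\<^sub>R f \<alpha>)"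
  and symbol_add: "(\<lambda>\<alpha>. (f \<alpha> :: sfun)) + (\<lambda>\<alpha>. g \<alpha>) = (\<lambda>\<alpha>. f \<alpha> + g \<alpha>)"
  by (simp_all add: fun_eq_iff pointwise)

text \<open>Y and D act on the coefficients, E and I on the monomials. Relations inside one group
  are those of superfunctions or of the symmetric algebra; the mixed signs all come from the
  twists.\<close>

lemma super_weyl_Sym:
  "super_weyl (Sym p q) {1..p+q} (par p) (Yop p) (Dop p) (Eop p q) (Iop p)"
proof
  show "subspace (Sym p q)" "finite {1..p+q}"
    by (simp_all add: subspace_Sym)
  fix i T S c assume i: "i \<in> {1..p+q}" and T: "T \<in> Sym p q"
  note TD = SymD[OF T]
  show "Yop p i T \<in> Sym p q" "Dop p i T \<in> Sym p q" "Eop p q i T \<in> Sym p q" "Iop p i T \<in> Sym p q"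
    using i T by simp_all
  show "Yop p i (c *\<^sub>R T) = c *\<^sub>R Yop p i T"
    by (simp add: Yop_def symbol_scaleR scaleR_fun_apply[of c T])
  show "Dop p i (c *\<^sub>R T) = c *\<^sub>R Dop p i T"
    using i TD(1) by (simp add: Dop_def symbol_scaleR scaleR_fun_apply[of c T] sderiv_scaleR[of _ p q])
  show "Eop p q i (c *\<^sub>R T) = c *\<^sub>R Eop p q i T" "Iop p i (c *\<^sub>R T) = c *\<^sub>R Iop p i T"
    unfolding Eop_eq Iop_eq Emul_scaleR Imul_scaleR by (simp_all add: symbol_pointwise symbol_scaleR)
  {
    assume S: "S \<in> Sym p q"
    show "Yop p i (T + S) = Yop p i T + Yop p i S"
      by (simp add: Yop_def symbol_add plus_fun_apply[of T S] sprod_add_right)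
    show "Dop p i (T + S) = Dop p i T + Dop p i S"
      using i TD(1) SymD(1)[OF S]
      by (simp add: Dop_def symbol_add plus_fun_apply[of T S] sderiv_add[of _ p q])
    show "Eop p q i (T + S) = Eop p q i T + Eop p q i S" "Iop p i (T + S) = Iop p i T + Iop p i S"
      unfolding Eop_eq Iop_eq Emul_add Imul_add by (simp_all add: symbol_pointwise symbol_add)
  }
next
  fix i j T assume i: "i \<in> {1..p+q}" and j: "j \<in> {1..p+q}" and T: "T \<in> Sym p q"
  note TD = SymD[OF T]
  let ?s = "(- 1) ^ (par p i * par p j) :: real"
  show "Yop p i (Yop p j T) = ?s *\<^sub>R Yop p j (Yop p i T)"
    by (simp add: Yop_def symbol_scaleR coord_coord_commute[of p i j])
  show "Dop p i (Dop p j T) = ?s *\<^sub>R Dop p j (Dop p i T)"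
    using i j TD(1) sderiv_commute[of _ p q i j] by (simp add: Dop_def symbol_scaleR)
  show "Dop p i (Yop p j T) = ?s *\<^sub>R Yop p j (Dop p i T) + (if i = j then T else 0)"
    using i j TD(1) sderiv_coord_mult[of _ p q i j] by (simp add: Yop_def Dop_def symbol_scaleR symbol_add symbol_pointwise)
  \<comment> \<open>Linear maps of the coefficients commute with \<open>Emul\<close> and
    \<open>Imul\<close>, so all twists can be collected in front.\<close>
  have tw: "(\<lambda>\<alpha>. twist (par p i) (Emul p q i (\<lambda>\<alpha>. twist a (v \<alpha>)) \<alpha>)) = (\<lambda>\<alpha>. twist (par p i + a) (Emul p q i v \<alpha>))"
    "(\<lambda>\<alpha>. twist (par p i) (Imul p i (\<lambda>\<alpha>. twist a (v \<alpha>)) \<alpha>)) = (\<lambda>\<alpha>. twist (par p i + a) (Imul p i v \<alpha>))"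
    for i a and v :: symbol
    by (simp_all add: Emul_map[where F = "twist a"] Imul_map[where F = "twist a"])
  show "Eop p q i (Eop p q j T) = ?s *\<^sub>R Eop p q j (Eop p q i T)"
    unfolding Eop_eq tw Emul_Emul[OF i j] by (simp add: symbol_pointwise symbol_scaleR add.commute)
  show "Iop p i (Iop p j T) = ?s *\<^sub>R Iop p j (Iop p i T)"
    using Imul_Imul[of i p q j T, OF i j TD(2)] unfolding Iop_eq tw by (simp add: symbol_pointwise symbol_scaleR add.commute)
  show "Iop p i (Eop p q j T) = ?s *\<^sub>R Eop p q j (Iop p i T) + (if i = j then T else 0)"
    using Imul_Emul[of i p q j T, OF i j TD(2)] unfolding Iop_eq Eop_eq tw
    by (auto simp: symbol_pointwise symbol_scaleR symbol_add add.commute)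
  show "Eop p q i (Yop p j T) = ?s *\<^sub>R Yop p j (Eop p q i T)"
    unfolding Eop_def Yop_def twist_coord_mult
    by (rule Emul_Imul_scaled_map(1)[where F = "sprod (coord p j)" and v = "\<lambda>\<alpha>. twist (par p i) (T \<alpha>)"]) simp
  show "Iop p i (Yop p j T) = ?s *\<^sub>R Yop p j (Iop p i T)"
    unfolding Iop_def Yop_def twist_coord_mult
    by (rule Emul_Imul_scaled_map(2)[where F = "sprod (coord p j)" and v = "\<lambda>\<alpha>. twist (par p i) (T \<alpha>)"]) simp
  show "Dop p i (Eop p q j T) = ?s *\<^sub>R Eop p q j (Dop p i T)"
  proof -
    \<comment> \<open>In this order the twist is applied to a derivative, as
      \<open>twist_sderiv\<close> requires; the sign is its own inverse, which gives the other
      direction.\<close>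
    have "Eop p q j (Dop p i T) = ?s *\<^sub>R Dop p i (Eop p q j T)"
      using i TD(1) unfolding Eop_def Dop_def
      by (subst Emul_Imul_scaled_map(1)[where F = "sderiv p i" and v = "\<lambda>\<alpha>. twist (par p j) (T \<alpha>)", symmetric]) (simp_all add: twist_sderiv[of _ p q] sderiv_scaleR[of _ p q] mult.commute)
    then show ?thesis
      by (simp flip: power_mult_distrib)
  qed
  show "Iop p i (Dop p j T) = ?s *\<^sub>R Dop p j (Iop p i T)"
    using j TD(1) unfolding Iop_def Dop_def
    by (subst Emul_Imul_scaled_map(2)[where F = "sderiv p j" and v = "\<lambda>\<alpha>. twist (par p i) (T \<alpha>)", symmetric]) (simp_all add: twist_sderiv[of _ p q] sderiv_scaleR[of _ p q])
qed


section \<open>Lie derivative, interior product and divergence as operators on symbols\<close>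

lemma tens_add: "tens (f + g) v = tens f v + tens g v" "tens f (v + w) = tens f v + tens f w"
  and tens_scaleR: "tens (c *\<^sub>R f) v = c *\<^sub>R tens f v" "tens f (c *\<^sub>R v) = c *\<^sub>R tens f v"
  and tens_minus: "tens f (v - w) = tens f v - tens f w"
  and tens_zero [simp]: "tens 0 v = 0" "tens f 0 = 0"
  by (auto simp: tens_def fun_eq_iff symbol_pointwise pointwise algebra_simps)

lemma tens_sum: "tens (\<Sum>a\<in>A. f a) v = (\<Sum>a\<in>A. tens (f a) v)"
  using sum_comp_morphism[of "\<lambda>f. tens f v" f A] by (simp add: comp_def tens_add)

lemma tens_mono_Sym [simp]: "f \<in> SF p q \<Longrightarrow> \<alpha> \<in> MI p q \<Longrightarrow> tens f (mono \<alpha>) \<in> Sym p q"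
  by (rule SymI[of _ _ _ "{\<alpha>}"]) (auto simp: tens_def mono_def)

lemma Sym_decomp:
  assumes "T \<in> Sym p q"
  shows "(\<Sum>\<alpha> | T \<alpha> \<noteq> 0. tens (T \<alpha>) (mono \<alpha>)) = T"
proof
  fix \<beta>
  have "(\<Sum>\<alpha> | T \<alpha> \<noteq> 0. tens (T \<alpha>) (mono \<alpha>)) \<beta> = (\<Sum>\<alpha> | T \<alpha> \<noteq> 0. if \<alpha> = \<beta> then T \<beta> else 0)"
    by (auto simp: sum_apply tens_def mono_def intro!: sum.cong)
  then show "(\<Sum>\<alpha> | T \<alpha> \<noteq> 0. tens (T \<alpha>) (mono \<alpha>)) \<beta> = T \<beta>"
    using SymD(3)[OF assms] by simp
qed

text \<open>The definitions are sums over the terms of a symbol; this identifies such a sum with the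
  value of one additive operator.\<close>

lemma Sym_additive_decomp:
  fixes F :: "symbol \<Rightarrow> 'b::comm_monoid_add"
  assumes "T \<in> Sym p q" "\<And>S T. S \<in> Sym p q \<Longrightarrow> T \<in> Sym p q \<Longrightarrow> F (S + T) = F S + F T" "F 0 = 0"
  shows "F T = (\<Sum>\<alpha> | T \<alpha> \<noteq> 0. F (tens (T \<alpha>) (mono \<alpha>)))"
proof -
  have "F T = F (\<Sum>\<alpha> | T \<alpha> \<noteq> 0. tens (T \<alpha>) (mono \<alpha>))"
    by (simp add: Sym_decomp[OF assms(1)])
  also have "\<dots> = (\<Sum>\<alpha> | T \<alpha> \<noteq> 0. F (tens (T \<alpha>) (mono \<alpha>)))"
    by (intro sum_additive_on[OF subspace_Sym[of p q]] assms(2,3) tens_mono_Sym SymD(1)[OF assms(1)])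
      (use SymD(2)[OF assms(1)] in auto)
  finally show ?thesis .
qed

lemma Lmul_tens: "Lmul g (tens f v) = tens (sprod g f) v"
  by (simp add: Lmul_def tens_def)

lemma Dop_tens: "f \<in> SF p q \<Longrightarrow> i \<in> {1..p+q} \<Longrightarrow> Dop p i (tens f v) = tens (sderiv p i f) v"
  by (simp add: Dop_def tens_def sderiv_scaleR[of _ p q])

lemma Eop_tens: "Eop p q i (tens f v) = tens (twist (par p i) f) (Emul p q i v)"
  by (auto simp: Eop_def Emul_def tens_def fun_eq_iff)

lemma Iop_tens: "Iop p i (tens f v) = tens (twist (par p i) f) (Imul p i v)"
  by (auto simp: Iop_def Imul_def tens_def fun_eq_iff)

lemma Lmul_add: "Lmul (f + g) T = Lmul f T + Lmul g T" "Lmul f (S + T) = Lmul f S + Lmul f T"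
  and Lmul_scaleR: "Lmul (c *\<^sub>R f) T = c *\<^sub>R Lmul f T" "Lmul f (c *\<^sub>R T) = c *\<^sub>R Lmul f T"
  and Lmul_zero [simp]: "Lmul 0 T = 0" "Lmul f 0 = 0"
  and Lmul_diff: "Lmul f (S - T) = Lmul f S - Lmul f T"
  using sprod_add_right[of f _ "- _"]
  by (auto simp: Lmul_def fun_eq_iff symbol_pointwise sprod_add_left sprod_add_right)

lemma homog_scaleR: "homog a f \<Longrightarrow> homog a (c *\<^sub>R f)"
  by (auto simp: homog_def scaleR_fun_apply)

lemma homog_cong: "a mod 2 = b mod 2 \<Longrightarrow> homog a f = homog b f"
  by (simp add: homog_def)

lemma homog_sderiv:
  assumes "f \<in> SF p q" "homog a f"
  shows "homog (a + par p i) (sderiv p i f)"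
proof (cases "i \<le> p")
  case True
  have "pderivative i (0 :: point \<Rightarrow> real) = 0"
    by (simp add: zero_fun_def)
  then have "f I \<noteq> 0" if "pderivative i (f I) \<noteq> 0" for I
    using that by metis
  then show ?thesis
    using True assms(2) by (auto simp: homog_def sderiv_even par_def)
next
  case False
  have "card I mod 2 = Suc a mod 2" if "i \<notin> I" "f (insert i I) \<noteq> 0" for I
  proof -
    have "finite I"
      using SF_infinite[OF assms(1), of "insert i I"] that(2) by auto
    moreover have "card (insert i I) mod 2 = a mod 2"
      using assms(2) that by (auto simp: homog_def)
    ultimately show ?thesis
      using that(1) by simp presburger
  qed
  then show ?thesis
    using False by (auto simp: homog_def sderiv_odd par_def)
qed

lemma vact_add: "(\<And>i. i \<in> {1..p+q} \<Longrightarrow> X i \<in> SF p q) \<Longrightarrow> f \<in> SF p q \<Longrightarrow> g \<in> SF p q \<Longrightarrow>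
    vact p q X (f + g) = vact p q X f + vact p q X g"
  by (simp add: vact_def sderiv_add[of _ p q] sprod_add_right sum.distrib)

text \<open>The Lie derivative along X of parity a with the sum over the parities of the
  coefficients carried out: the Jacobian stands on the left and no sign is left over.\<close>

definition hlie :: "nat \<Rightarrow> nat \<Rightarrow> real \<Rightarrow> nat \<Rightarrow> vfield \<Rightarrow> symbol \<Rightarrow> symbol" where
  "hlie p q \<delta> a X T = (\<Sum>i\<in>{1..p+q}. Lmul (X i) (Dop p i T)) +
    (\<Sum>i\<in>{1..p+q}. \<Sum>j\<in>{1..p+q}. Lmul (jac p a X i j)
      (Eop p q j (Iop p i T) - (\<delta> * (if i = j then (- 1) ^ par p i else 0)) *\<^sub>R T))"

text \<open>Exchanging f of parity b with J_i^j of parity a + par i + par j gives (-1)^(ab) times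
  (-1)^(b (par i + par j)). The first factor cancels the sign of the definition, the second is the
  twist inside \<open>Eop\<close> and \<open>Iop\<close>.\<close>

lemma symbol_lie_hom_eq:
  assumes X: "\<And>i. i \<in> {1..p+q} \<Longrightarrow> X i \<in> SF p q" "\<And>i. i \<in> {1..p+q} \<Longrightarrow> homog (a + par p i) (X i)"
    and f: "f \<in> SF p q" and \<alpha>: "\<alpha> \<in> MI p q"
  shows "(\<Sum>b\<in>{0,1}. symbol_lie_hom p q \<delta> a b X (hpart b f) \<alpha>) = hlie p q \<delta> a X (tens f (mono \<alpha>))"
proof -
  have jac: "homog (a + par p i + par p j) (jac p a X i j)" if "i \<in> {1..p+q}" "j \<in> {1..p+q}" for i j
    using homog_scaleR[OF homog_sderiv[OF X(1)[OF that(2)] X(2)[OF that(2)], of i],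
        of "(- 1) ^ (par p i * a + 1)"] unfolding jac_def
    by (simp only: ac_simps)
  have 1: "(- 1) ^ (a * b) *\<^sub>R sprod (hpart b f) (jac p a X i j) = sprod (jac p a X i j) (twist (par p i + par p j) (hpart b f))"
    if "i \<in> {1..p+q}" "j \<in> {1..p+q}" for i j b
  proof -
    have "sprod (hpart b f) (jac p a X i j) = sprod (twist b (jac p a X i j)) (hpart b f)"
      by (rule sprod_commute) simp
    also have "\<dots> = (- 1) ^ (b * (a + par p i + par p j)) *\<^sub>R sprod (jac p a X i j) (hpart b f)"
      by (simp add: twist_homog[OF jac[OF that]])
    finally show ?thesis
      unfolding twist_hpart[of "par p i + par p j" b f, symmetric] by (simp add: minus_one_power_iff)
  qed
  let ?R = "\<lambda>i j. Emul p q j (Imul p i (mono \<alpha>)) - (\<delta> * (if i = j then (- 1) ^ par p i else 0)) *\<^sub>R mono \<alpha>"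
  have 2: "(\<Sum>b\<in>{0,1}. (- 1) ^ (a * b) *\<^sub>R tens (sprod (hpart b f) (jac p a X i j)) (rho p q \<delta> (elem_mat i j) \<alpha>)) =
      Lmul (jac p a X i j) (Eop p q j (Iop p i (tens f (mono \<alpha>))) -
        (\<delta> * (if i = j then (- 1) ^ par p i else 0)) *\<^sub>R tens f (mono \<alpha>))"
    if ij: "i \<in> {1..p+q}" "j \<in> {1..p+q}" for i j
  proof -
    have "(\<Sum>b\<in>{0,1}. (- 1) ^ (a * b) *\<^sub>R tens (sprod (hpart b f) (jac p a X i j)) (rho p q \<delta> (elem_mat i j) \<alpha>)) =
        tens (\<Sum>b\<in>{0,1}. (- 1) ^ (a * b) *\<^sub>R sprod (hpart b f) (jac p a X i j)) (rho p q \<delta> (elem_mat i j) \<alpha>)"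
      by (simp add: tens_add tens_scaleR)
    also have "(\<Sum>b\<in>{0,1}. (- 1) ^ (a * b) *\<^sub>R sprod (hpart b f) (jac p a X i j)) =
        sprod (jac p a X i j) (twist (par p i + par p j) (hpart 0 f + hpart 1 f))"
      unfolding 1[OF ij] by (simp add: sprod_add_right)
    also have "hpart 0 f + hpart 1 f = f"
      by (rule hpart_decomp)
    also have "tens (sprod (jac p a X i j) (twist (par p i + par p j) f)) (rho p q \<delta> (elem_mat i j) \<alpha>) =
        Lmul (jac p a X i j) (tens (twist (par p j + par p i) f) (?R i j))"
      by (simp only: rho_elem_mat[OF \<alpha> ij] Lmul_tens add.commute)
    also have "tens (twist (par p j + par p i) f) (?R i j) = Eop p q j (Iop p i (tens f (mono \<alpha>))) -
        (\<delta> * (if i = j then (- 1) ^ par p i else 0)) *\<^sub>R tens f (mono \<alpha>)"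
      by (auto simp: Eop_tens Iop_tens tens_minus tens_scaleR)
    finally show ?thesis .
  qed
  have "(\<Sum>b\<in>{0,1}. symbol_lie_hom p q \<delta> a b X (hpart b f) \<alpha>) =
      tens (vact p q X (hpart 0 f) + vact p q X (hpart 1 f)) (mono \<alpha>) +
      (\<Sum>i\<in>{1..p+q}. \<Sum>j\<in>{1..p+q}. \<Sum>b\<in>{0,1}.
        (- 1) ^ (a * b) *\<^sub>R tens (sprod (hpart b f) (jac p a X i j)) (rho p q \<delta> (elem_mat i j) \<alpha>))"
    unfolding symbol_lie_hom_def by (simp add: sum.distrib scaleR_right.sum tens_add)
  also have "vact p q X (hpart 0 f) + vact p q X (hpart 1 f) = vact p q X f"
    using vact_add[of p q X "hpart 0 f" "hpart 1 f"] X(1) f hpart_decomp(1)[of f] by simp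
  also have "tens (vact p q X f) (mono \<alpha>) = (\<Sum>i\<in>{1..p+q}. Lmul (X i) (Dop p i (tens f (mono \<alpha>))))"
    using f by (simp add: vact_def tens_sum Dop_tens[of _ p q] Lmul_tens)
  finally show ?thesis
    unfolding hlie_def using 2 by simp
qed

lemma hlie_add:
  assumes "S \<in> Sym p q" "T \<in> Sym p q"
  shows "hlie p q \<delta> a X (S + T) = hlie p q \<delta> a X S + hlie p q \<delta> a X T"
proof -
  interpret super_weyl "Sym p q" "{1..p+q}" "par p" "Yop p" "Dop p" "Eop p q" "Iop p"
    by (rule super_weyl_Sym)
  show ?thesis
    using assms by (simp add: hlie_def Lmul_add Lmul_diff Lmul_scaleR sum.distrib sum_subtractf scaleR_add_right)
qed

lemma vpart_SF: "X i \<in> SF p q \<Longrightarrow> vpart p a X i \<in> SF p q"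
  by (simp add: vpart_def)

lemma symbol_lie_eq:
  assumes X: "\<And>i. i \<in> {1..p+q} \<Longrightarrow> X i \<in> SF p q" and T: "T \<in> Sym p q"
  shows "symbol_lie p q \<delta> X T = (\<Sum>a\<in>{0,1}. hlie p q \<delta> a (vpart p a X) T)"
proof -
  have "symbol_lie p q \<delta> X T = (\<Sum>\<alpha> | T \<alpha> \<noteq> 0. \<Sum>a\<in>{0,1}. hlie p q \<delta> a (vpart p a X) (tens (T \<alpha>) (mono \<alpha>)))"
    unfolding symbol_lie_def
  proof (intro sum.cong refl)
    fix \<alpha> a assume "\<alpha> \<in> {\<alpha>. T \<alpha> \<noteq> 0}"
    then have "\<alpha> \<in> MI p q"
      using SymD(2)[OF T] by auto
    then show "(\<Sum>b\<in>{0,1}. symbol_lie_hom p q \<delta> a b (vpart p a X) (hpart b (T \<alpha>)) \<alpha>) =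
        hlie p q \<delta> a (vpart p a X) (tens (T \<alpha>) (mono \<alpha>))"
      using SymD(1)[OF T] X by (intro symbol_lie_hom_eq) (auto simp: vpart_def)
  qed
  also have "\<dots> = (\<Sum>a\<in>{0,1}. hlie p q \<delta> a (vpart p a X) T)"
  proof -
    have "hlie p q \<delta> a X 0 = 0" for a X
      using hlie_add[of 0 p q 0 \<delta> a X] by simp
    then show ?thesis
      by (subst sum.swap, intro sum.cong refl Sym_additive_decomp[OF T, symmetric] hlie_add)
  qed
  finally show ?thesis .
qed

lemma interior_unit_vec:
  assumes T: "T \<in> Sym p q" and j: "j \<in> {1..p+q}"
  shows "interior p q (unit_vec j) T = Iop p j T"
proof -
  interpret super_weyl "Sym p q" "{1..p+q}" "par p" "Yop p" "Dop p" "Eop p q" "Iop p"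
    by (rule super_weyl_Sym)
  have "(\<Sum>a\<in>{0,1}. \<Sum>b\<in>{0,1}. (- 1) ^ (a * b) *\<^sub>R
      tens (hpart b (T \<alpha>)) (interior_hom p q a (rpart p a (unit_vec j)) \<alpha>)) = Iop p j (tens (T \<alpha>) (mono \<alpha>))"
    if "\<alpha> \<in> MI p q" for \<alpha>
  proof -
    have 1: "(\<Sum>a\<in>{0,1}. (- 1) ^ (a * b) *\<^sub>R
        tens (hpart b (T \<alpha>)) (interior_hom p q a (rpart p a (unit_vec j)) \<alpha>)) =
        tens (twist (par p j) (hpart b (T \<alpha>))) (Imul p j (mono \<alpha>))" for b
      unfolding twist_hpart[symmetric] interior_hom_unit[OF that j] tens_scaleR by (auto simp: par_def)
    show ?thesis
      unfolding sum.swap[of _ "{0,1}" "{0,1}"] 1 Iop_tens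
      by (simp add: hpart_decomp flip: tens_add twist_linear(1))
  qed
  then have "interior p q (unit_vec j) T = (\<Sum>\<alpha> | T \<alpha> \<noteq> 0. Iop p j (tens (T \<alpha>) (mono \<alpha>)))"
    unfolding interior_def using SymD(2)[OF T] by (intro sum.cong) auto
  also have "\<dots> = Iop p j T"
    using j by (intro Sym_additive_decomp[OF T, symmetric]) simp_all
  finally show ?thesis .
qed

lemma symbol_div_eq:
  assumes T: "T \<in> Sym p q"
  shows "symbol_div p q T = (\<Sum>j\<in>{1..p+q}. Dop p j (Iop p j T))"
proof -
  interpret super_weyl "Sym p q" "{1..p+q}" "par p" "Yop p" "Dop p" "Eop p q" "Iop p"
    by (rule super_weyl_Sym)
  show ?thesis
    unfolding symbol_div_def
  proof (intro sum.cong refl)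
    fix j assume "j \<in> {1..p+q}"
    then show "(- 1) ^ par p j *\<^sub>R interior p q (unit_vec j) (\<lambda>\<alpha>. sderiv p j (T \<alpha>)) = Dop p j (Iop p j T)"
      using interior_unit_vec[of "Dop p j T" p q j] ID_same[of j T] T by (simp flip: Dop_def)
  qed
qed

lemma Eop_Iop_same:
  assumes "i \<in> {1..p+q}" "T \<in> Sym p q"
  shows "Eop p q i (Iop p i T) \<alpha> = real (\<alpha> i) *\<^sub>R T \<alpha>"
proof (cases "\<alpha> \<in> MI p q \<and> 0 < \<alpha> i")
  case True
  then have "\<alpha>(i := Suc (\<alpha> i - Suc 0)) = \<alpha>"
    by (simp add: fun_eq_iff)
  then show ?thesis
    using True by (simp add: Eop_def Iop_def Emul_def Imul_def mult.left_commute[of "msgn p i \<alpha>"])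
next
  case False
  then show ?thesis
    using SymD(2)[OF assms(2)] by (auto simp: Eop_def Emul_def)
qed

lemma degree_op:
  assumes "T \<in> Sym p q"
  shows "(\<Sum>i\<in>{1..p+q}. Eop p q i (Iop p i T)) = (\<lambda>\<alpha>. real (mdeg p q \<alpha>) *\<^sub>R T \<alpha>)"
  using assms by (auto simp: fun_eq_iff[where 'a = midx] sum_apply Eop_Iop_same mdeg_def scaleR_left.sum)

section \<open>Differential operators\<close>

lemma diffop_superset:
  assumes "f \<in> SF p q" "finite A" "{\<alpha>. c \<alpha> \<noteq> 0} \<subseteq> A"
  shows "diffop p q c f = (\<Sum>\<alpha>\<in>A. sprod (c \<alpha>) (mderiv p q \<alpha> f))"
  using assms by (simp add: diffop_def) (intro sum.mono_neutral_left; auto)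

lemma diffop_outside: "f \<notin> SF p q \<Longrightarrow> diffop p q c f = 0"
  by (simp add: diffop_def)

lemma diffop_add:
  assumes "c \<in> Sym p q" "d \<in> Sym p q"
  shows "diffop p q (c + d) = diffop p q c + diffop p q d"
proof
  fix f
  let ?A = "{\<alpha>. c \<alpha> \<noteq> 0} \<union> {\<alpha>. d \<alpha> \<noteq> 0}"
  show "diffop p q (c + d) f = (diffop p q c + diffop p q d) f"
  proof (cases "f \<in> SF p q")
    case True
    have "finite ?A" "{\<alpha>. (c + d) \<alpha> \<noteq> 0} \<subseteq> ?A"
      using SymD(3)[OF assms(1)] SymD(3)[OF assms(2)] by (auto simp: symbol_pointwise)
    then show ?thesis
      using diffop_superset[OF True, of ?A c] diffop_superset[OF True, of ?A d] diffop_superset[OF True, of ?A "c + d"]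
      by (simp add: symbol_pointwise plus_fun_apply[of "diffop p q c"] sprod_add_left sum.distrib)
  qed (simp add: diffop_outside plus_fun_apply[of "diffop p q c"])
qed

lemma diffop_scaleR:
  assumes "c \<in> Sym p q"
  shows "diffop p q (r *\<^sub>R c) = r *\<^sub>R diffop p q c"
proof
  fix f
  let ?A = "{\<alpha>. c \<alpha> \<noteq> 0}"
  show "diffop p q (r *\<^sub>R c) f = (r *\<^sub>R diffop p q c) f"
  proof (cases "f \<in> SF p q")
    case True
    then show ?thesis
      using SymD(3)[OF assms] diffop_superset[OF True, of ?A c] diffop_superset[OF True, of ?A "r *\<^sub>R c"]
      by (simp add: symbol_pointwise scaleR_fun_apply[of r "diffop p q c"] scaleR_right.sum subset_iff)
  qed (simp add: diffop_outside scaleR_fun_apply[of r "diffop p q c"])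
qed

lemma oper_pointwise: "(D + D') f = D f + D' f" "(0::oper) f = 0" "(r *\<^sub>R D) f = r *\<^sub>R D f"
  "(D - D') f = D f - D' f" "(- D) f = - D f" for D D' :: oper
  by (simp_all add: pointwise)

lemma diffop_zero [simp]: "diffop p q 0 = 0"
  using diffop_scaleR[of 0 p q 0] by simp

lemma diffop_minus: "c \<in> Sym p q \<Longrightarrow> diffop p q (- c) = - diffop p q c"
  using diffop_scaleR[of c p q "-1"] by simp

lemma diffop_diff: "c \<in> Sym p q \<Longrightarrow> d \<in> Sym p q \<Longrightarrow> diffop p q (c - d) = diffop p q c - diffop p q d"
  using diffop_add[of c p q "- d"] diffop_minus[of d p q] by simp

lemma diffop_sum: "(\<And>a. a \<in> A \<Longrightarrow> c a \<in> Sym p q) \<Longrightarrow> diffop p q (\<Sum>a\<in>A. c a) = (\<Sum>a\<in>A. diffop p q (c a))"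
  by (intro sum_additive_on[OF subspace_Sym[of p q], where T = "diffop p q"]) (simp_all add: diffop_add)

lemma diffop_SF [simp]: "c \<in> Sym p q \<Longrightarrow> diffop p q c f \<in> SF p q"
  using SymD(1) by (simp add: diffop_def)

lemma diffop_arg_add:
  "f \<in> SF p q \<Longrightarrow> g \<in> SF p q \<Longrightarrow> diffop p q c (f + g) = diffop p q c f + diffop p q c g"
  by (simp add: diffop_def mderiv_add sprod_add_right sum.distrib)

lemma diffop_arg_scaleR: "f \<in> SF p q \<Longrightarrow> diffop p q c (r *\<^sub>R f) = r *\<^sub>R diffop p q c f"
  by (simp add: diffop_def mderiv_scaleR scaleR_right.sum)

lemma diffop_arg_minus: "f \<in> SF p q \<Longrightarrow> diffop p q c (- f) = - diffop p q c f"
  using diffop_arg_scaleR[of f p q c "-1"] by simp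

lemma diffop_arg_zero: "diffop p q c 0 = 0"
  using diffop_arg_scaleR[of 0 p q c 0] by simp

lemma diffop_arg_sum:
  "(\<And>a. a \<in> A \<Longrightarrow> f a \<in> SF p q) \<Longrightarrow> diffop p q c (\<Sum>a\<in>A. f a) = (\<Sum>a\<in>A. diffop p q c (f a))"
  by (intro sum_additive_on[OF subspace_SF[of p q], where T = "diffop p q c"])
    (simp_all add: diffop_arg_add diffop_arg_zero)

lemma diffop_tens:
  assumes "g \<in> SF p q"
  shows "diffop p q (tens f (mono \<alpha>)) g = sprod f (mderiv p q \<alpha> g)"
proof -
  have "{\<beta>. tens f (mono \<alpha>) \<beta> \<noteq> 0} \<subseteq> {\<alpha>}"
    by (auto simp: tens_def mono_def)
  from diffop_superset[OF assms _ this] show ?thesis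
    by (simp add: tens_def mono_def)
qed

section \<open>Composition of operators with coordinates and derivatives\<close>

lemma Sym_induct [consumes 1, case_names add tens]:
  assumes T: "T \<in> Sym p q"
    and add: "\<And>S T. S \<in> Sym p q \<Longrightarrow> T \<in> Sym p q \<Longrightarrow> P S \<Longrightarrow> P T \<Longrightarrow> P (S + T)"
    and tens: "\<And>f \<alpha>. f \<in> SF p q \<Longrightarrow> \<alpha> \<in> MI p q \<Longrightarrow> P (tens f (mono \<alpha>))"
  shows "P T"
proof -
  have "P 0"
    using tens[of 0 "\<lambda>_. 0"] by simp
  have *: "tens (T \<alpha>) (mono \<alpha>) \<in> Sym p q" "P (tens (T \<alpha>) (mono \<alpha>))" if "T \<alpha> \<noteq> 0" for \<alpha>
    using that SymD(1,2)[OF T, of \<alpha>] tens tens_mono_Sym by blast+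
  have "A \<subseteq> {\<alpha>. T \<alpha> \<noteq> 0} \<Longrightarrow>
      (\<Sum>\<alpha>\<in>A. tens (T \<alpha>) (mono \<alpha>)) \<in> Sym p q \<and> P (\<Sum>\<alpha>\<in>A. tens (T \<alpha>) (mono \<alpha>))" for A
  proof (induction A rule: infinite_finite_induct)
    case (insert \<alpha> A)
    then show ?case
      using * add by simp
  qed (use \<open>P 0\<close> in simp_all)
  from this[of "{\<alpha>. T \<alpha> \<noteq> 0}"] show ?thesis
    by (simp add: Sym_decomp[OF T])
qed

lemma mdeg_upd: "i \<in> {1..p+q} \<Longrightarrow> mdeg p q (\<alpha>(i := Suc (\<alpha> i))) = Suc (mdeg p q \<alpha>)"
proof -
  assume i: "i \<in> {1..p+q}"
  have "(\<Sum>j\<in>{1..p+q} - {i}. (\<alpha>(i := Suc (\<alpha> i))) j) = (\<Sum>j\<in>{1..p+q} - {i}. \<alpha> j)"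
    by (intro sum.cong) auto
  then show ?thesis
    using sum.remove[OF finite_atLeastAtMost i, of "\<alpha>(i := Suc (\<alpha> i))"] sum.remove[OF finite_atLeastAtMost i, of \<alpha>]
    by (simp add: mdeg_def)
qed

lemma mdeg_pred: "i \<in> {1..p+q} \<Longrightarrow> 0 < \<alpha> i \<Longrightarrow> mdeg p q \<alpha> = Suc (mdeg p q (\<alpha>(i := \<alpha> i - 1)))"
  using mdeg_upd[of i p q "\<alpha>(i := \<alpha> i - 1)"] by (simp add: fun_upd_idem)

text \<open>Symbols are built by multiplication with e_k. The hypothesis on \<open>Dop p k T\<close>
  is there because composition with d_k on the left gives \<open>Eop p q k T\<close> only up to
  \<open>Dop p k T\<close>.\<close>

lemma Sym_E_induct [consumes 1, case_names add zero E]: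
  assumes T: "T \<in> Sym p q"
    and add: "\<And>S T. S \<in> Sym p q \<Longrightarrow> T \<in> Sym p q \<Longrightarrow> P S \<Longrightarrow> P T \<Longrightarrow> P (S + T)"
    and zero: "\<And>f. f \<in> SF p q \<Longrightarrow> P (tens f (mono (\<lambda>_. 0)))"
    and E: "\<And>k T. k \<in> {1..p+q} \<Longrightarrow> T \<in> Sym p q \<Longrightarrow> P T \<Longrightarrow> P (Dop p k T) \<Longrightarrow> P (Eop p q k T)"
  shows "P T"
  using T
proof (induction rule: Sym_induct)
  case (add S T)
  then show ?case
    by (rule assms(2))
next
  case (tens f \<alpha>)
  \<comment> \<open>Induction on the degree with f arbitrary, so that the differentiated coefficient
    is covered too.\<close>
  have "f \<in> SF p q \<Longrightarrow> \<alpha> \<in> MI p q \<Longrightarrow> mdeg p q \<alpha> = n \<Longrightarrow> P (tens f (mono \<alpha>))" for n f \<alpha>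
  proof (induction n arbitrary: f \<alpha>)
    case 0
    then have "\<alpha> i = 0" for i
      using MI_pos[OF 0(2), of i] by (fastforce simp: mdeg_def)
    then have "\<alpha> = (\<lambda>_. 0)"
      by auto
    then show ?case
      using zero 0 by simp
  next
    case (Suc n)
    have "\<exists>i. 0 < \<alpha> i"
      using Suc(4) by (metis bot_nat_0.not_eq_extremum mdeg_def nat.distinct(1) sum.neutral)
    then obtain i where i: "0 < \<alpha> i" ..
    define \<beta> where "\<beta> = \<alpha>(i := \<alpha> i - 1)"
    have iN: "i \<in> {1..p+q}"
      by (rule MI_pos[OF Suc(3) i])
    have \<beta>: "\<beta> \<in> MI p q" "mdeg p q \<beta> = n" "\<beta>(i := Suc (\<beta> i)) = \<alpha>"
      using Suc i MI_upd_mono[OF iN, of \<alpha> "\<alpha> i" "\<alpha> i - 1"] mdeg_pred[of i p q \<alpha>, OF iN i] by (simp_all add: \<beta>_def)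
    \<comment> \<open>Undoes in advance the twist and the sign that \<open>Eop\<close>
      introduces.\<close>
    define g where "g = msgn p i \<beta> *\<^sub>R twist (par p i) f"
    have g: "g \<in> SF p q"
      using Suc by (simp add: g_def)
    have "twist (par p i) g = msgn p i \<beta> *\<^sub>R f"
      by (simp add: g_def)
    then have "Eop p q i (tens g (mono \<beta>)) = tens f (mono \<alpha>)"
      using Suc(3) iN \<beta> unfolding Eop_tens by (simp add: Emul_mono tens_scaleR)
    moreover have "P (Eop p q i (tens g (mono \<beta>)))"
      using g \<beta> iN by (intro E) (simp_all add: Dop_tens[of _ p q] Suc.IH)
    ultimately show ?case
      by simp
  qed
  with tens show ?case
    by blast
qed

lemma sprod_coord_diffop:
  assumes "c \<in> Sym p q" and f: "f \<in> SF p q" and i: "i \<in> {1..p+q}"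
  shows "sprod (coord p i) (diffop p q c f) = diffop p q (Yop p i c) f"
proof -
  interpret super_weyl "Sym p q" "{1..p+q}" "par p" "Yop p" "Dop p" "Eop p q" "Iop p"
    by (rule super_weyl_Sym)
  show ?thesis
    using assms(1)
  proof (induction rule: Sym_induct)
    case (add S T)
    then show ?case
      using i by (simp add: diffop_add oper_pointwise sprod_add_right)
  next
    case (tens g \<alpha>)
    have "Yop p i (tens g (mono \<alpha>)) = tens (sprod (coord p i) g) (mono \<alpha>)"
      by (simp add: Yop_def tens_def)
    then show ?case
      using f by (simp add: diffop_tens sprod_assoc)
  qed
qed

lemma diffop_tens_Emul:
  assumes "f \<in> SF p q" "i \<in> {1..p+q}" "\<alpha> \<in> MI p q"
  shows "diffop p q (tens g (Emul p q i (mono \<alpha>))) f = sprod g (sderiv p i (mderiv p q \<alpha> f))"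
  using assms by (simp add: sderiv_mderiv Emul_mono diffop_tens tens_scaleR oper_pointwise flip: tens_scaleR(1))

text \<open>By the Leibniz rule d_i hits the coefficient, or it joins the derivatives of the
  argument.\<close>

lemma sderiv_diffop:
  assumes "c \<in> Sym p q" and f: "f \<in> SF p q" and i: "i \<in> {1..p+q}"
  shows "sderiv p i (diffop p q c f) = diffop p q (Dop p i c + Eop p q i c) f"
proof -
  interpret super_weyl "Sym p q" "{1..p+q}" "par p" "Yop p" "Dop p" "Eop p q" "Iop p"
    by (rule super_weyl_Sym)
  show ?thesis
    using assms(1)
  proof (induction rule: Sym_induct)
    case (add S T)
    then show ?case
      using i by (simp add: diffop_add oper_pointwise sderiv_add[of _ p q])
  next
    case (tens g \<alpha>)
    have "diffop p q (Dop p i (tens g (mono \<alpha>)) + Eop p q i (tens g (mono \<alpha>))) f =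
        diffop p q (Dop p i (tens g (mono \<alpha>))) f + diffop p q (Eop p q i (tens g (mono \<alpha>))) f"
      using tens i by (simp add: diffop_add oper_pointwise)
    then show ?case
      using tens f i by (simp add: diffop_tens Dop_tens[of _ p q] Eop_tens diffop_tens_Emul sderiv_sprod[of _ p q])
  qed
qed

lemma diffop_Eop:
  assumes "c \<in> Sym p q" "f \<in> SF p q" "k \<in> {1..p+q}"
  shows "diffop p q (Eop p q k c) f = sderiv p k (diffop p q c f) - diffop p q (Dop p k c) f"
  using sderiv_diffop[OF assms] assms by (simp add: diffop_add oper_pointwise)

text \<open>The conjugation by a twist supplies the sign of exchanging d_i with the operator. As
  derivatives supercommute, d_i can then be moved in front of the others, and multiplication with
  e_i is all that remains.\<close>

lemma diffop_sderiv:
  assumes "c \<in> Sym p q" and f: "f \<in> SF p q" and i: "i \<in> {1..p+q}"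
  shows "twist (par p i) (diffop p q c (twist (par p i) (sderiv p i f))) = diffop p q (Eop p q i c) f"
proof -
  interpret super_weyl "Sym p q" "{1..p+q}" "par p" "Yop p" "Dop p" "Eop p q" "Iop p"
    by (rule super_weyl_Sym)
  show ?thesis
    using assms(1)
  proof (induction rule: Sym_E_induct)
    case (add S T)
    then show ?case
      using i by (simp add: diffop_add oper_pointwise)
  next
    case (zero g)
    then show ?case
      using f i by (simp add: diffop_tens mderiv_zero Eop_tens diffop_tens_Emul twist_sprod)
  next
    case (E k T)
    let ?h = "twist (par p i) (sderiv p i f)"
    let ?s = "(- 1) ^ (par p i * par p k) :: real"
    have h: "?h \<in> SF p q"
      using f i by simp
    have "twist (par p i) (diffop p q (Eop p q k T) ?h) =
        ?s *\<^sub>R sderiv p k (twist (par p i) (diffop p q T ?h)) - twist (par p i) (diffop p q (Dop p k T) ?h)"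
      using E h by (simp add: diffop_Eop twist_sderiv[of _ p q])
    also have "\<dots> = ?s *\<^sub>R diffop p q (Dop p k (Eop p q i T) + Eop p q k (Eop p q i T)) f - diffop p q (Eop p q i (Dop p k T)) f"
      using E i f by (simp add: sderiv_diffop)
    also have "\<dots> = diffop p q (?s *\<^sub>R (Dop p k (Eop p q i T) + Eop p q k (Eop p q i T)) - Eop p q i (Dop p k T)) f"
      using E i by (simp add: diffop_scaleR diffop_diff oper_pointwise)
    also have "?s *\<^sub>R (Dop p k (Eop p q i T) + Eop p q k (Eop p q i T)) - Eop p q i (Dop p k T) = Eop p q i (Eop p q k T)"
      using E i DE[of k i T] EE[of i k T] by (simp add: scaleR_add_right mult.commute[of "par p k"])
    finally show ?case .
  qed
qed

text \<open>Moving y^i to the left through the derivatives leaves, besides the product, the terms in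
  which one derivative hits y^i; together these form the contraction.\<close>

lemma diffop_coord:
  assumes "c \<in> Sym p q" and f: "f \<in> SF p q" and i: "i \<in> {1..p+q}"
  shows "twist (par p i) (diffop p q c (twist (par p i) (sprod (coord p i) f))) =
    diffop p q (Yop p i c + (- 1) ^ par p i *\<^sub>R Iop p i c) f"
proof -
  interpret super_weyl "Sym p q" "{1..p+q}" "par p" "Yop p" "Dop p" "Eop p q" "Iop p"
    by (rule super_weyl_Sym)
  show ?thesis
    using assms(1)
  proof (induction rule: Sym_E_induct)
    case (add S T)
    then show ?case
      using i by (simp add: diffop_add diffop_scaleR oper_pointwise scaleR_add_right)
  next
    case (zero g)
    have "Yop p i (tens g (mono (\<lambda>_. 0))) = tens (sprod (coord p i) g) (mono (\<lambda>_. 0))"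
      by (simp add: Yop_def tens_def)
    then show ?case
      using f i zero by (simp add: diffop_tens mderiv_zero Iop_tens twist_sprod sprod_assoc sprod_coord_left_commute[of _ p i])
  next
    case (E k T)
    let ?h = "twist (par p i) (sprod (coord p i) f)"
    let ?s = "(- 1) ^ (par p i * par p k) :: real"
    let ?R = "\<lambda>T. Yop p i T + (- 1) ^ par p i *\<^sub>R Iop p i T"
    have h: "?h \<in> SF p q"
      using f i by simp
    have R: "?R T \<in> Sym p q" "?R (Dop p k T) \<in> Sym p q"
      using E i by simp_all
    have "twist (par p i) (diffop p q (Eop p q k T) ?h) =
        ?s *\<^sub>R sderiv p k (twist (par p i) (diffop p q T ?h)) - twist (par p i) (diffop p q (Dop p k T) ?h)"
      using E h by (simp add: diffop_Eop twist_sderiv[of _ p q])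
    also have "\<dots> = ?s *\<^sub>R diffop p q (Dop p k (?R T) + Eop p q k (?R T)) f - diffop p q (?R (Dop p k T)) f"
      unfolding E.IH using sderiv_diffop[OF R(1) f E(1)] by simp
    also have "\<dots> = diffop p q (?s *\<^sub>R (Dop p k (?R T) + Eop p q k (?R T)) - ?R (Dop p k T)) f"
      using E R by (simp add: diffop_scaleR diffop_diff oper_pointwise del: closed)
    also have "?s *\<^sub>R (Dop p k (?R T) + Eop p q k (?R T)) - ?R (Dop p k T) = ?R (Eop p q k T)"
      using E i DY[of k i T] EY[of k i T] ID[of i k T] IE[of i k T]
      by (cases "i = k") (simp_all add: scaleR_add_right mult.commute pm)
    finally show ?case .
  qed
qed

text \<open>If an operator vanishes, so does its supercommutator with y^i, whose symbol is the
  contraction of c up to sign and has smaller degree. By induction all contractions vanish, so c has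
  degree 0 and is recovered from the value at the constant function 1.\<close>

lemma diffop_inj_zero:
  assumes "c \<in> Sym p q" "diffop p q c = 0"
  shows "c = 0"
proof -
  interpret super_weyl "Sym p q" "{1..p+q}" "par p" "Yop p" "Dop p" "Eop p q" "Iop p"
    by (rule super_weyl_Sym)
  have "c = 0" if "c \<in> Sym p q" "\<And>f. f \<in> SF p q \<Longrightarrow> diffop p q c f = 0" "\<And>\<alpha>. c \<alpha> \<noteq> 0 \<Longrightarrow> mdeg p q \<alpha> < n" for c n
    using that
  proof (induction n arbitrary: c)
    case 0
    then have "c \<alpha> = 0" for \<alpha>
      by blast
    then show ?case
      by (simp add: fun_eq_iff[where 'a = midx] symbol_pointwise)
  next
    case (Suc n)
    have I: "Iop p i c = 0" if i: "i \<in> {1..p+q}" for i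
    proof (rule Suc.IH)
      show "Iop p i c \<in> Sym p q"
        using i Suc.prems(1) by simp
      show "diffop p q (Iop p i c) f = 0" if f: "f \<in> SF p q" for f
      proof -
        have "diffop p q (Yop p i c) f = 0"
          using sprod_coord_diffop[OF Suc.prems(1) f i] Suc.prems(2)[OF f] by simp
        moreover have "diffop p q (Yop p i c + (- 1) ^ par p i *\<^sub>R Iop p i c) f = 0"
          using diffop_coord[OF Suc.prems(1) f i] Suc.prems(2) f i by simp
        ultimately show ?thesis
          using Suc.prems(1) i by (simp add: diffop_add diffop_scaleR oper_pointwise)
      qed
      show "mdeg p q \<alpha> < n" if "Iop p i c \<alpha> \<noteq> 0" for \<alpha>
      proof -
        have "c (\<alpha>(i := Suc (\<alpha> i))) \<noteq> 0"
          using that by (auto simp: Iop_def Imul_def)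
        then show ?thesis
          using Suc.prems(3) mdeg_upd[OF i, of \<alpha>] by fastforce
      qed
    qed
    \<comment> \<open>At the multi-index lowered at i the contraction is a nonzero multiple of the
      twisted coefficient at \<alpha>, and the twist is invertible.\<close>
    have nz: "c \<alpha> = 0" if "0 < \<alpha> i" for \<alpha> i
    proof (cases "\<alpha> \<in> MI p q")
      case True
      have "i \<in> {1..p+q}"
        by (rule MI_pos[OF True that])
      then have "Iop p i c (\<alpha>(i := \<alpha> i - 1)) = 0"
        using I by (simp add: symbol_pointwise)
      moreover have "msgn p i \<alpha> \<noteq> 0"
        by (simp add: msgn_def)
      ultimately have "twist (par p i) (c \<alpha>) = 0"
        using that by (simp add: Iop_def Imul_def)
      then have "twist (par p i) (twist (par p i) (c \<alpha>)) = 0"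
        by (simp only: twist_linear)
      then show ?thesis
        by simp
    qed (use SymD(2)[OF Suc.prems(1)] in simp)
    have "c \<alpha> = 0" if "\<alpha> \<noteq> (\<lambda>_. 0)" for \<alpha>
      using that nz by (metis bot_nat_0.not_eq_extremum ext)
    then have "{\<alpha>. c \<alpha> \<noteq> 0} \<subseteq> {\<lambda>_. 0}"
      by auto
    from diffop_superset[OF sone_SF _ this] have "diffop p q c sone = c (\<lambda>_. 0)"
      using sprod_sone_right[OF SymD(1)[OF Suc.prems(1), of "\<lambda>_. 0"]] by (simp add: mderiv_zero)
    then have "c (\<lambda>_. 0) = 0"
      using Suc.prems(2) by simp
    with \<open>\<And>\<alpha>. \<alpha> \<noteq> (\<lambda>_. 0) \<Longrightarrow> c \<alpha> = 0\<close> have "c \<alpha> = 0" for \<alpha>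
      by metis
    then show ?case
      by (simp add: fun_eq_iff[where 'a = midx] symbol_pointwise)
  qed
  moreover have "mdeg p q \<alpha> < Suc (Max (mdeg p q ` {\<alpha>. c \<alpha> \<noteq> 0}))" if "c \<alpha> \<noteq> 0" for \<alpha>
    using that SymD(3)[OF assms(1)] by (simp add: less_Suc_eq_le)
  ultimately show ?thesis
    using assms by (metis oper_pointwise(2))
qed

lemma diffop_inj_on: "inj_on (diffop p q) (Sym p q)"
proof (rule inj_onI)
  fix c d assume *: "c \<in> Sym p q" "d \<in> Sym p q" "diffop p q c = diffop p q d"
  then have "diffop p q (c - d) = 0"
    by (simp add: diffop_diff)
  then show "c = d"
    using diffop_inj_zero[of "c - d" p q] * by simp
qed

lemma total_symbol_diffop: "c \<in> Sym p q \<Longrightarrow> total_symbol p q (diffop p q c) = c"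
  unfolding total_symbol_def by (rule the_equality) (use inj_onD[OF diffop_inj_on] in auto)

text \<open>\<open>total_symbol\<close> inverts \<open>diffop\<close> on \<open>Sym p q\<close>, and
  \<open>Q_Aff\<close> inverts \<open>total_symbol\<close> on \<open>DO p q\<close>.\<close>

lemma Q_Aff_eq:
  assumes "c \<in> Sym p q"
  shows "Q_Aff p q c = diffop p q c"
proof -
  have "inj_on (total_symbol p q) (DO p q)"
    by (rule inj_on_inverseI[where g = "diffop p q"]) (auto simp: DO_def total_symbol_diffop)
  moreover have "diffop p q c \<in> DO p q"
    using assms by (simp add: DO_def)
  ultimately have "the_inv_into (DO p q) (total_symbol p q) (total_symbol p q (diffop p q c)) = diffop p q c"
    by (rule the_inv_into_f_f)
  then show ?thesis
    by (simp add: Q_Aff_def total_symbol_diffop[OF assms])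
qed

section \<open>The projective vector fields\<close>

declare One_nat_def [simp del]

text \<open>A linear map evaluated at the class of M, when a, b and c are its values on the bases of
  g_-1, g_0 and g_1. The subtracted \<open>M 0 0\<close> is the passage from A to A - a Id.\<close>

definition proj_sum :: "nat \<Rightarrow> nat \<Rightarrow> mat \<Rightarrow> (nat \<Rightarrow> 'a::real_vector) \<Rightarrow> (nat \<Rightarrow> nat \<Rightarrow> 'a) \<Rightarrow> (nat \<Rightarrow> 'a) \<Rightarrow> 'a" where
  "proj_sum p q M a b c = (\<Sum>r\<in>{1..p+q}. M r 0 *\<^sub>R a r) +
    (\<Sum>r\<in>{1..p+q}. \<Sum>s\<in>{1..p+q}. (M r s - (if r = s then M 0 0 else 0)) *\<^sub>R b r s) +
    (\<Sum>s\<in>{1..p+q}. M 0 s *\<^sub>R c s)"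

lemma proj_sum_cong:
  assumes "\<And>r. r \<in> {1..p+q} \<Longrightarrow> a r = a' r" "\<And>r s. r \<in> {1..p+q} \<Longrightarrow> s \<in> {1..p+q} \<Longrightarrow> b r s = b' r s"
    and "\<And>s. s \<in> {1..p+q} \<Longrightarrow> c s = c' s"
  shows "proj_sum p q M a b c = proj_sum p q M a' b' c'"
  using assms by (simp add: proj_sum_def)

lemma proj_sum_linear:
  "proj_sum p q M (\<lambda>r. a r + a' r) (\<lambda>r s. b r s + b' r s) (\<lambda>s. c s + c' s) = proj_sum p q M a b c + proj_sum p q M a' b' c'"
  "proj_sum p q M (\<lambda>r. x *\<^sub>R a r) (\<lambda>r s. x *\<^sub>R b r s) (\<lambda>s. x *\<^sub>R c s) = x *\<^sub>R proj_sum p q M a b c"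
  by (simp_all add: proj_sum_def scaleR_add_right sum.distrib scaleR_right.sum mult.commute)

lemma proj_sum_sum:
  "(\<Sum>i\<in>A. x i *\<^sub>R proj_sum p q M (a i) (b i) (c i)) =
    proj_sum p q M (\<lambda>r. \<Sum>i\<in>A. x i *\<^sub>R a i r) (\<lambda>r s. \<Sum>i\<in>A. x i *\<^sub>R b i r s) (\<lambda>s. \<Sum>i\<in>A. x i *\<^sub>R c i s)"
proof (induction A rule: infinite_finite_induct)
  case (insert i A)
  then show ?case
    by (simp add: proj_sum_linear)
qed (simp_all add: proj_sum_def)

lemma proj_sum_in:
  assumes "subspace W" "\<And>r. r \<in> {1..p+q} \<Longrightarrow> a r \<in> W" "\<And>s. s \<in> {1..p+q} \<Longrightarrow> c s \<in> W"
    and "\<And>r s. r \<in> {1..p+q} \<Longrightarrow> s \<in> {1..p+q} \<Longrightarrow> b r s \<in> W"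
  shows "proj_sum p q M a b c \<in> W"
  unfolding proj_sum_def by (intro subspace_add[OF assms(1)] subspace_sum[OF assms(1)] subspace_scale[OF assms(1)] assms(2-4))

lemma proj_sum_map:
  fixes T :: "'a::real_vector \<Rightarrow> 'b::real_vector"
  assumes W: "subspace W" and add: "\<And>x y. x \<in> W \<Longrightarrow> y \<in> W \<Longrightarrow> T (x + y) = T x + T y"
    and scale: "\<And>r x. x \<in> W \<Longrightarrow> T (r *\<^sub>R x) = r *\<^sub>R T x"
    and a: "\<And>r. r \<in> {1..p+q} \<Longrightarrow> a r \<in> W" and c: "\<And>s. s \<in> {1..p+q} \<Longrightarrow> c s \<in> W"
    and b: "\<And>r s. r \<in> {1..p+q} \<Longrightarrow> s \<in> {1..p+q} \<Longrightarrow> b r s \<in> W"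
  shows "T (proj_sum p q M a b c) = proj_sum p q M (\<lambda>r. T (a r)) (\<lambda>r s. T (b r s)) (\<lambda>s. T (c s))"
proof -
  have "T 0 = 0"
    using scale[OF subspace_0[OF W], of 0] by simp
  then have T_sum: "T (\<Sum>i\<in>A. f i) = (\<Sum>i\<in>A. T (f i))" if "\<And>i. i \<in> A \<Longrightarrow> f i \<in> W" for A :: "nat set" and f
    using add that by (intro sum_additive_on[OF W, where T = T])
  have lin: "T (\<Sum>i\<in>A. x i *\<^sub>R f i) = (\<Sum>i\<in>A. x i *\<^sub>R T (f i))" if "\<And>i. i \<in> A \<Longrightarrow> f i \<in> W" for A :: "nat set" and x f
    using that by (subst T_sum) (simp_all add: scale subspace_scale[OF W])
  let ?A = "\<Sum>r\<in>{1..p+q}. M r 0 *\<^sub>R a r"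
    and ?b = "\<lambda>r. \<Sum>s\<in>{1..p+q}. (M r s - (if r = s then M 0 0 else 0)) *\<^sub>R b r s"
    and ?C = "\<Sum>s\<in>{1..p+q}. M 0 s *\<^sub>R c s"
  have V: "?A \<in> W" "?C \<in> W" "\<And>r. r \<in> {1..p+q} \<Longrightarrow> ?b r \<in> W"
    by (intro subspace_sum[OF W] subspace_scale[OF W] a b c; assumption)+
  have "T (?A + (\<Sum>r\<in>{1..p+q}. ?b r) + ?C) = T ?A + (\<Sum>r\<in>{1..p+q}. T (?b r)) + T ?C"
  proof -
    have "T (\<Sum>r\<in>{1..p+q}. ?b r) = (\<Sum>r\<in>{1..p+q}. T (?b r))"
      by (rule T_sum[OF V(3)])
    then show ?thesis
      using V subspace_sum[OF W, of "{1..p+q}" ?b] by (simp add: add subspace_add[OF W])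
  qed
  moreover have "(\<Sum>r\<in>{1..p+q}. T (?b r)) =
      (\<Sum>r\<in>{1..p+q}. \<Sum>s\<in>{1..p+q}. (M r s - (if r = s then M 0 0 else 0)) *\<^sub>R T (b r s))"
    by (intro sum.cong refl lin b)
  ultimately show ?thesis
    unfolding proj_sum_def by (simp only: lin a c)
qed

section \<open>Basis of the projective vector fields\<close>

definition VF :: "nat \<Rightarrow> nat \<Rightarrow> vfield set" where
  "VF p q = {X. \<forall>i\<in>{1..p+q}. X i \<in> SF p q}"

lemma vfield_pointwise: "(X + Z) i = X i + Z i" "(0::vfield) i = 0" "(r *\<^sub>R X) i = r *\<^sub>R X i"
  for X Z :: vfield
  by (simp_all add: pointwise)

lemma subspace_VF: "subspace (VF p q)"
  by (rule subspaceI) (auto simp: VF_def vfield_pointwise)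

lemma VF_D: "X \<in> VF p q \<Longrightarrow> i \<in> {1..p+q} \<Longrightarrow> X i \<in> SF p q"
  by (simp add: VF_def)

lemma VF_closed [simp]: "X \<in> VF p q \<Longrightarrow> Z \<in> VF p q \<Longrightarrow> X + Z \<in> VF p q"
  "X \<in> VF p q \<Longrightarrow> r *\<^sub>R X \<in> VF p q" "(\<And>a. a \<in> A \<Longrightarrow> F a \<in> VF p q) \<Longrightarrow> sum F A \<in> VF p q"
  using subspace_VF[of p q] by (auto simp: subspace_add subspace_scale intro: subspace_sum)

definition Fminus :: "nat \<Rightarrow> vfield" where
  "Fminus r = (\<lambda>i. if i = r then - sone else 0)"

definition Fzero :: "nat \<Rightarrow> nat \<Rightarrow> nat \<Rightarrow> vfield" where
  "Fzero p r c = (\<lambda>i. if i = r then (- ((- 1) ^ (par p c * (par p r + par p c)))) *\<^sub>R coord p c else 0)"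

definition Fplus :: "nat \<Rightarrow> nat \<Rightarrow> vfield" where
  "Fplus p c = (\<lambda>i. (- 1) ^ par p c *\<^sub>R sprod (coord p c) (coord p i))"

lemma F_VF [simp]: "Fminus r \<in> VF p q" "c \<in> {1..p+q} \<Longrightarrow> Fzero p r c \<in> VF p q"
  "c \<in> {1..p+q} \<Longrightarrow> Fplus p c \<in> VF p q"
  by (auto simp: VF_def Fminus_def Fzero_def Fplus_def)

lemma proj_field_VF: "proj_field p q M \<in> VF p q"
  unfolding VF_def proj_field_def field_minus_def field_zero_def field_plus_def
  by (auto simp: vfield_pointwise simp del: One_nat_def intro!: SF_closed sprod_SF)

text \<open>The last clause discards components at indices outside {1..p+q}: they carry no meaning,
  but \<open>proj_field\<close> need not vanish there.\<close>

definition fields_linear :: "nat \<Rightarrow> nat \<Rightarrow> (vfield \<Rightarrow> 'b::real_vector) \<Rightarrow> bool" where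
  "fields_linear p q G \<longleftrightarrow> (\<forall>X\<in>VF p q. \<forall>Z\<in>VF p q. G (X + Z) = G X + G Z) \<and>
    (\<forall>r. \<forall>X\<in>VF p q. G (r *\<^sub>R X) = r *\<^sub>R G X) \<and>
    (\<forall>X Z. (\<forall>i\<in>{1..p+q}. X i = Z i) \<longrightarrow> G X = G Z)"

lemma mod_2_swap: "a mod 2 = (b + c) mod 2 \<longleftrightarrow> (c + a) mod 2 = b mod 2" for a b c :: nat
  by (auto simp: mod2_eq_if)

lemma mod_2_cancel: "(a + c) mod 2 = (b + c) mod 2 \<longleftrightarrow> a mod 2 = b mod 2" for a b c :: nat
  by (auto simp: mod2_eq_if)

text \<open>Each basis field is homogeneous, so passing to the part of parity a only selects some of
  them.\<close>

lemma vpart_proj_field: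
  assumes i: "i \<in> {1..p+q}"
  shows "vpart p a (proj_field p q M) i =
    proj_sum p q M (\<lambda>r. (if par p r mod 2 = a mod 2 then 1 else 0) *\<^sub>R Fminus r)
      (\<lambda>r c. (if (par p r + par p c) mod 2 = a mod 2 then 1 else 0) *\<^sub>R Fzero p r c)
      (\<lambda>c. (if par p c mod 2 = a mod 2 then 1 else 0) *\<^sub>R Fplus p c) i"
proof -
  let ?A = "\<lambda>i j. M i j - (if i = j then M 0 0 else 0)"
  let ?b = "a + par p i"
  have 1: "hpart ?b (field_minus (\<lambda>i. M i 0) i) =
      (\<Sum>r\<in>{1..p+q}. M r 0 *\<^sub>R (if par p r mod 2 = a mod 2 then 1 else 0) *\<^sub>R Fminus r i)"
  proof -
    have "(\<Sum>r\<in>{1..p+q}. M r 0 *\<^sub>R (if par p r mod 2 = a mod 2 then 1 else 0) *\<^sub>R Fminus r i) =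
        (\<Sum>r\<in>{1..p+q}. if r = i then M i 0 *\<^sub>R (if par p i mod 2 = a mod 2 then 1 else 0) *\<^sub>R (- sone) else 0)"
      by (intro sum.cong) (auto simp: Fminus_def)
    also have "\<dots> = M i 0 *\<^sub>R (if par p i mod 2 = a mod 2 then 1 else 0) *\<^sub>R (- sone)"
      using i by simp
    also have "\<dots> = hpart ?b (field_minus (\<lambda>i. M i 0) i)"
    proof -
      have "0 mod 2 = ?b mod 2 \<longleftrightarrow> par p i mod 2 = a mod 2"
        unfolding mod_2_swap by simp
      then show ?thesis
        by (auto simp: field_minus_def hpart_homog[OF homog_sone])
    qed
    finally show ?thesis ..
  qed
  have 2: "hpart ?b (field_zero p q ?A i) =
      (\<Sum>r\<in>{1..p+q}. \<Sum>c\<in>{1..p+q}. ?A r c *\<^sub>R (if (par p r + par p c) mod 2 = a mod 2 then 1 else 0) *\<^sub>R Fzero p r c i)"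
  proof -
    have "(\<Sum>r\<in>{1..p+q}. \<Sum>c\<in>{1..p+q}. ?A r c *\<^sub>R (if (par p r + par p c) mod 2 = a mod 2 then 1 else 0) *\<^sub>R Fzero p r c i) =
        (\<Sum>r\<in>{1..p+q}. if r = i then \<Sum>c\<in>{1..p+q}. ?A i c *\<^sub>R (if (par p i + par p c) mod 2 = a mod 2 then 1 else 0) *\<^sub>R Fzero p i c i else 0)"
      by (intro sum.cong) (auto simp: Fzero_def mult.assoc)
    also have "\<dots> = (\<Sum>c\<in>{1..p+q}. ?A i c *\<^sub>R (if (par p i + par p c) mod 2 = a mod 2 then 1 else 0) *\<^sub>R Fzero p i c i)"
      using i by simp
    also have "\<dots> = (\<Sum>c\<in>{1..p+q}. hpart ?b (- ((- 1) ^ (par p c * (par p i + par p c)) * ?A i c) *\<^sub>R coord p c))"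
    proof (intro sum.cong refl)
      fix c
      have "par p c mod 2 = ?b mod 2 \<longleftrightarrow> (par p i + par p c) mod 2 = a mod 2"
        by (rule mod_2_swap)
      then show "?A i c *\<^sub>R (if (par p i + par p c) mod 2 = a mod 2 then 1 else 0) *\<^sub>R Fzero p i c i =
          hpart ?b (- ((- 1) ^ (par p c * (par p i + par p c)) * ?A i c) *\<^sub>R coord p c)"
        by (auto simp: Fzero_def hpart_homog[OF homog_coord] mult.commute)
    qed
    also have "\<dots> = hpart ?b (field_zero p q ?A i)"
      by (simp add: field_zero_def hpart_sum sum_negf)
    finally show ?thesis ..
  qed
  have 3: "hpart ?b (field_plus p q (\<lambda>j. M 0 j) i) =
      (\<Sum>c\<in>{1..p+q}. M 0 c *\<^sub>R (if par p c mod 2 = a mod 2 then 1 else 0) *\<^sub>R Fplus p c i)"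
  proof -
    have "hpart ?b (sprod (coord p c) (coord p i)) = (if par p c mod 2 = a mod 2 then sprod (coord p c) (coord p i) else 0)" for c
    proof -
      have "(par p c + par p i) mod 2 = ?b mod 2 \<longleftrightarrow> par p c mod 2 = a mod 2"
        by (rule mod_2_cancel)
      then show ?thesis
        by (simp add: hpart_homog[OF homog_sprod[OF homog_coord homog_coord]])
    qed
    then show ?thesis
      by (simp add: field_plus_def Fplus_def sprod_sum_left hpart_sum if_distrib[of "\<lambda>x. x *\<^sub>R _"] cong: if_cong sum.cong)
        (auto intro!: sum.cong)
  qed
  show ?thesis
    unfolding vpart_def proj_field_def proj_sum_def
    by (simp only: vfield_pointwise hpart_linear 1 2 3 sum_apply[of _ _ i])
qed

text \<open>G may depend on the parity; the sum over a evaluates it at each basis field with that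
  field's own parity.\<close>

lemma proj_field_expand:
  fixes G :: "nat \<Rightarrow> vfield \<Rightarrow> 'b::real_vector"
  assumes G: "\<And>a. fields_linear p q (G a)"
  shows "(\<Sum>a\<in>{0,1}. G a (vpart p a (proj_field p q M))) = proj_sum p q M
    (\<lambda>r. G (par p r) (Fminus r)) (\<lambda>r c. G ((par p r + par p c) mod 2) (Fzero p r c)) (\<lambda>c. G (par p c) (Fplus p c))"
proof -
  let ?i = "\<lambda>m a. if m mod 2 = a mod 2 then 1 else 0 :: real"
  have *: "G a (vpart p a (proj_field p q M)) = proj_sum p q M (\<lambda>r. ?i (par p r) a *\<^sub>R G a (Fminus r))
      (\<lambda>r c. ?i (par p r + par p c) a *\<^sub>R G a (Fzero p r c)) (\<lambda>c. ?i (par p c) a *\<^sub>R G a (Fplus p c))" for a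
  proof -
    have add: "X \<in> VF p q \<Longrightarrow> Z \<in> VF p q \<Longrightarrow> G a (X + Z) = G a X + G a Z"
      and scale: "X \<in> VF p q \<Longrightarrow> G a (x *\<^sub>R X) = x *\<^sub>R G a X" for X Z x
      using G[of a] by (simp_all add: fields_linear_def)
    have "G a (vpart p a (proj_field p q M)) = G a (proj_sum p q M (\<lambda>r. ?i (par p r) a *\<^sub>R Fminus r)
        (\<lambda>r c. ?i (par p r + par p c) a *\<^sub>R Fzero p r c) (\<lambda>c. ?i (par p c) a *\<^sub>R Fplus p c))"
      using G[of a] vpart_proj_field[of _ p q a M] unfolding fields_linear_def by blast
    also have "\<dots> = proj_sum p q M (\<lambda>r. G a (?i (par p r) a *\<^sub>R Fminus r))
        (\<lambda>r c. G a (?i (par p r + par p c) a *\<^sub>R Fzero p r c)) (\<lambda>c. G a (?i (par p c) a *\<^sub>R Fplus p c))"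
      by (intro proj_sum_map[OF subspace_VF[of p q], where T = "G a"] add scale VF_closed F_VF)
    also have "\<dots> = proj_sum p q M (\<lambda>r. ?i (par p r) a *\<^sub>R G a (Fminus r))
        (\<lambda>r c. ?i (par p r + par p c) a *\<^sub>R G a (Fzero p r c)) (\<lambda>c. ?i (par p c) a *\<^sub>R G a (Fplus p c))"
      by (intro proj_sum_cong scale F_VF)
    finally show ?thesis .
  qed
  have pick: "?i m 0 *\<^sub>R G 0 X + ?i m 1 *\<^sub>R G 1 X = G (m mod 2) X" for m X
    by (cases "even m") (auto simp: mod2_eq_if)
  have par: "par p r mod 2 = par p r" for r
    by (simp add: par_def)
  have "(\<Sum>a\<in>{0,1}. G a (vpart p a (proj_field p q M))) =
      G 0 (vpart p 0 (proj_field p q M)) + G 1 (vpart p 1 (proj_field p q M))"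
    by simp
  also have "\<dots> = proj_sum p q M (\<lambda>r. G (par p r mod 2) (Fminus r))
      (\<lambda>r c. G ((par p r + par p c) mod 2) (Fzero p r c)) (\<lambda>c. G (par p c mod 2) (Fplus p c))"
    unfolding * proj_sum_linear(1)[symmetric] pick ..
  finally show ?thesis
    unfolding par .
qed

section \<open>Action of the basis fields on symbols\<close>

lemma sum_single: "finite A \<Longrightarrow> r \<in> A \<Longrightarrow> (\<And>i. i \<in> A \<Longrightarrow> i \<noteq> r \<Longrightarrow> f i = 0) \<Longrightarrow> sum f A = f r"
  by (metis (no_types, lifting) sum.remove sum.neutral Diff_iff add.right_neutral singletonI)

lemma Lmul_Yop: "Lmul (coord p i) T = Yop p i T"
  by (simp add: Lmul_def Yop_def)

lemma Lmul_sone: "T \<in> Sym p q \<Longrightarrow> Lmul sone T = T"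
  using SymD(1)[of T p q] by (simp add: Lmul_def sprod_sone_left[of _ p q])

lemma Lmul_sprod: "Lmul (sprod f g) T = Lmul f (Lmul g T)"
  by (simp add: Lmul_def sprod_assoc)

lemma Lmul_minus: "Lmul (- f) T = - Lmul f T"
  using Lmul_scaleR(1)[of "-1" f T] by simp

lemma Lmul_diff_left: "Lmul (f - g) T = Lmul f T - Lmul g T"
  using Lmul_add(1)[of f "- g" T] by (simp add: Lmul_minus)

lemma hlie_linear:
  assumes T: "T \<in> Sym p q"
  shows "fields_linear p q (\<lambda>X. hlie p q \<delta> a X T)"
  unfolding fields_linear_def
proof (intro conjI ballI allI impI)
  fix X Z :: vfield and r
  show "hlie p q \<delta> a X T = hlie p q \<delta> a Z T" if "\<forall>i\<in>{1..p+q}. X i = Z i"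
    using that by (simp add: hlie_def jac_def)
  assume X: "X \<in> VF p q"
  show "hlie p q \<delta> a (r *\<^sub>R X) T = r *\<^sub>R hlie p q \<delta> a X T"
  proof -
    have "jac p a (r *\<^sub>R X) i j = r *\<^sub>R jac p a X i j" if "i \<in> {1..p+q}" "j \<in> {1..p+q}" for i j
      using VF_D[OF X that(2)] that by (simp add: jac_def vfield_pointwise sderiv_scaleR[of _ p q])
    then show ?thesis
      by (simp add: hlie_def vfield_pointwise Lmul_scaleR scaleR_add_right scaleR_right.sum)
  qed
  assume Z: "Z \<in> VF p q"
  show "hlie p q \<delta> a (X + Z) T = hlie p q \<delta> a X T + hlie p q \<delta> a Z T"
  proof -
    have "jac p a (X + Z) i j = jac p a X i j + jac p a Z i j" if "i \<in> {1..p+q}" "j \<in> {1..p+q}" for i j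
      using VF_D[OF X that(2)] VF_D[OF Z that(2)] that
      by (simp add: jac_def vfield_pointwise sderiv_add[of _ p q] scaleR_add_right)
    then show ?thesis
      by (simp add: hlie_def vfield_pointwise Lmul_add sum.distrib)
  qed
qed

context
  fixes p q :: nat
begin

interpretation super_weyl "Sym p q" "{1..p+q}" "par p" "Yop p" "Dop p" "Eop p q" "Iop p"
  by (rule super_weyl_Sym)

lemma hlie_Fminus:
  assumes T: "T \<in> Sym p q" and r: "r \<in> {1..p+q}"
  shows "hlie p q \<delta> a (Fminus r) T = Lminus r T"
proof -
  have "jac p a (Fminus r) i j = 0" if "i \<in> {1..p+q}" for i j
    using sderiv_minus[OF sone_SF that] by (simp add: jac_def Fminus_def)
  moreover have "(\<Sum>i\<in>{1..p+q}. Lmul (Fminus r i) (Dop p i T)) = Lmul (Fminus r r) (Dop p r T)"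
    using r by (intro sum_single) (auto simp: Fminus_def)
  ultimately show ?thesis
    using T r by (simp add: hlie_def Lminus_def Fminus_def Lmul_minus Lmul_sone[of _ p q])
qed

lemma hlie_Fzero:
  assumes T: "T \<in> Sym p q" and r: "r \<in> {1..p+q}" and c: "c \<in> {1..p+q}"
  shows "hlie p q \<delta> ((par p r + par p c) mod 2) (Fzero p r c) T = Lzero \<delta> r c T"
proof -
  let ?a = "(par p r + par p c) mod 2"
  \<comment> \<open>The sign in the definition of the linear fields is the one that makes this entry
    equal to 1.\<close>
  have jac: "jac p ?a (Fzero p r c) i j = (if i = c \<and> j = r then sone else 0)"
    if "i \<in> {1..p+q}" for i j
  proof (cases "j = r")
    case True
    have "sderiv p i ((- ((- 1) ^ (par p c * (par p r + par p c)))) *\<^sub>R coord p c) =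
        (if i = c then (- ((- 1) ^ (par p c * (par p r + par p c)))) *\<^sub>R sone else 0)"
      using that c by (simp add: sderiv_minus[of _ p q] sderiv_scaleR[of _ p q] sderiv_coord[of _ p q])
    then show ?thesis
      using True by (auto simp: jac_def Fzero_def) (auto simp: par_def)
  qed (simp add: jac_def Fzero_def)
  let ?t = "\<lambda>i j. Lmul (jac p ?a (Fzero p r c) i j) (Eop p q j (Iop p i T) - (\<delta> * (if i = j then (- 1) ^ par p i else 0)) *\<^sub>R T)"
  have "(\<Sum>i\<in>{1..p+q}. \<Sum>j\<in>{1..p+q}. ?t i j) = (\<Sum>j\<in>{1..p+q}. ?t c j)"
    using c by (intro sum_single) (auto simp: jac)
  also have "\<dots> = ?t c r"
    using r c by (intro sum_single) (auto simp: jac)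
  also have "\<dots> = Eop p q r (Iop p c T) - (\<delta> * (if r = c then (- 1) ^ par p r else 0)) *\<^sub>R T"
    using T r c by (auto simp: jac Lmul_sone[of _ p q])
  finally have 1: "(\<Sum>i\<in>{1..p+q}. \<Sum>j\<in>{1..p+q}. ?t i j) =
    Eop p q r (Iop p c T) - (\<delta> * (if r = c then (- 1) ^ par p r else 0)) *\<^sub>R T" .
  have "(\<Sum>i\<in>{1..p+q}. Lmul (Fzero p r c i) (Dop p i T)) = Lmul (Fzero p r c r) (Dop p r T)"
    using r by (intro sum_single) (auto simp: Fzero_def)
  then show ?thesis
    unfolding hlie_def 1 by (simp add: Lzero_def Fzero_def Lmul_scaleR Lmul_minus Lmul_Yop)
qed

text \<open>The field is y^c times the Euler field up to sign. Its Jacobian has a part from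
  differentiating y^c, concentrated in i = c, and a diagonal part from the Euler field. The former
  yields \<open>YE (Iop p c T)\<close>, the latter \<open>Deg T\<close>; their shares 1 and
  \<open>sdim\<close> in the trace term make up \<open>sdim + 1\<close>.\<close>

lemma hlie_Fplus:
  assumes T: "T \<in> Sym p q" and c: "c \<in> {1..p+q}"
  shows "hlie p q \<delta> (par p c) (Fplus p c) T = Lplus \<delta> c T"
proof -
  let ?s = "(- 1) ^ par p c :: real"
  let ?R = "\<lambda>i j. Eop p q j (Iop p i T) - (\<delta> * (if i = j then (- 1) ^ par p i else 0)) *\<^sub>R T"
  have jac: "jac p (par p c) (Fplus p c) i j =
      - (if i = c then coord p j else 0) - (if i = j then ?s *\<^sub>R coord p c else 0)"
    if "i \<in> {1..p+q}" "j \<in> {1..p+q}" for i j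
  proof -
    have "sderiv p i (sprod (coord p c) (coord p j)) =
        (- 1) ^ (par p i * par p c) *\<^sub>R (if i = j then coord p c else 0) + (if i = c then coord p j else 0)"
      using that c sderiv_coord_mult[OF coord_SF[OF that(2)] that(1) c] sprod_sone_right[OF coord_SF[OF c]] by (simp add: sderiv_coord[of _ p q])
    then show ?thesis
      unfolding jac_def Fplus_def using that c
      by (auto simp: sderiv_scaleR[of _ p q] scaleR_add_right pm)
        (auto simp: minus_one_power_iff)
  qed
  have "(\<Sum>i\<in>{1..p+q}. \<Sum>j\<in>{1..p+q}. Lmul (jac p (par p c) (Fplus p c) i j) (?R i j)) =
      - (\<Sum>i\<in>{1..p+q}. \<Sum>j\<in>{1..p+q}. if i = c then Yop p j (?R i j) else 0)
      - (\<Sum>i\<in>{1..p+q}. \<Sum>j\<in>{1..p+q}. if i = j then ?s *\<^sub>R Yop p c (?R i j) else 0)"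
  proof -
    have "Lmul (jac p (par p c) (Fplus p c) i j) (?R i j) =
      - (if i = c then Yop p j (?R i j) else 0) - (if i = j then ?s *\<^sub>R Yop p c (?R i j) else 0)"
      if "i \<in> {1..p+q}" "j \<in> {1..p+q}" for i j
      unfolding jac[OF that]
      by (cases "i = c"; cases "i = j") (simp_all add: Lmul_diff_left Lmul_minus Lmul_scaleR Lmul_Yop)
    then show ?thesis
      by (simp add: sum_subtractf sum_negf)
  qed
  also have "(\<Sum>i\<in>{1..p+q}. \<Sum>j\<in>{1..p+q}. if i = c then Yop p j (?R i j) else 0) = (\<Sum>j\<in>{1..p+q}. Yop p j (?R c j))"
    using c by (subst sum.swap) simp
  also have "\<dots> = YE (Iop p c T) - (\<delta> * ?s) *\<^sub>R Yop p c T"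
  proof -
    have "Yop p j (?R c j) = Yop p j (Eop p q j (Iop p c T)) - (if j = c then (\<delta> * ?s) *\<^sub>R Yop p c T else 0)"
      if "j \<in> {1..p+q}" for j
      using that T c by (auto)
    then show ?thesis
      using c by (simp add: YE_def sum_subtractf)
  qed
  also have "(\<Sum>i\<in>{1..p+q}. \<Sum>j\<in>{1..p+q}. if i = j then ?s *\<^sub>R Yop p c (?R i j) else 0) =
      (\<Sum>i\<in>{1..p+q}. ?s *\<^sub>R Yop p c (?R i i))"
    by simp
  also have "\<dots> = ?s *\<^sub>R Yop p c (Deg T) - (?s * \<delta> * sdim) *\<^sub>R Yop p c T"
  proof -
    have "?s *\<^sub>R Yop p c (?R i i) = ?s *\<^sub>R Yop p c (Eop p q i (Iop p i T)) - (?s * \<delta> * (- 1) ^ par p i) *\<^sub>R Yop p c T"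
      if "i \<in> {1..p+q}" for i
      using that T c by (simp add: scaleR_diff_right)
    moreover have "Yop p c (Deg T) = (\<Sum>i\<in>{1..p+q}. Yop p c (Eop p q i (Iop p i T)))"
      unfolding Deg_def using T c by (intro gen_sum(1)) simp_all
    ultimately show ?thesis
      using T c by (simp add: sdim_def sum_subtractf scaleR_right.sum sum_distrib_left scaleR_left.sum)
  qed
  finally have 1: "(\<Sum>i\<in>{1..p+q}. \<Sum>j\<in>{1..p+q}. Lmul (jac p (par p c) (Fplus p c) i j) (?R i j)) =
      - (YE (Iop p c T) - (\<delta> * ?s) *\<^sub>R Yop p c T) - (?s *\<^sub>R Yop p c (Deg T) - (?s * \<delta> * sdim) *\<^sub>R Yop p c T)" .
  have 2: "(\<Sum>i\<in>{1..p+q}. Lmul (Fplus p c i) (Dop p i T)) = ?s *\<^sub>R Yop p c (Eul T)"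
  proof -
    have "Yop p c (Eul T) = (\<Sum>i\<in>{1..p+q}. Yop p c (Yop p i (Dop p i T)))"
      unfolding Eul_def using T c by (intro gen_sum(1)) simp_all
    then show ?thesis
      by (simp add: Fplus_def Lmul_scaleR Lmul_sprod Lmul_Yop scaleR_right.sum)
  qed
  show ?thesis
    unfolding hlie_def 1 2 Lplus_def using T c
    by (simp add: algebra_simps)
qed

lemma symbol_lie_proj_field:
  assumes T: "T \<in> Sym p q"
  shows "symbol_lie p q \<delta> (proj_field p q M) T =
    proj_sum p q M (\<lambda>r. Lminus r T) (\<lambda>r c. Lzero \<delta> r c T) (\<lambda>c. Lplus \<delta> c T)"
proof -
  have "symbol_lie p q \<delta> (proj_field p q M) T = (\<Sum>a\<in>{0,1}. hlie p q \<delta> a (vpart p a (proj_field p q M)) T)"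
    using VF_D[OF proj_field_VF] T by (intro symbol_lie_eq) auto
  also have "\<dots> = proj_sum p q M (\<lambda>r. Lminus r T) (\<lambda>r c. Lzero \<delta> r c T) (\<lambda>c. Lplus \<delta> c T)"
    unfolding proj_field_expand[of p q "\<lambda>a X. hlie p q \<delta> a X T", OF hlie_linear[OF T]]
    by (intro proj_sum_cong hlie_Fminus hlie_Fzero hlie_Fplus T)
  finally show ?thesis .
qed

end

section \<open>The action on differential operators\<close>

lemma vact_SF [simp]: "X \<in> VF p q \<Longrightarrow> f \<in> SF p q \<Longrightarrow> vact p q X f \<in> SF p q"
  unfolding vact_def using VF_D[of X p q] by (intro SF_closed(6) sprod_SF sderiv_SF) auto

lemma vdiv_SF [simp]: "X \<in> VF p q \<Longrightarrow> vdiv p q X \<in> SF p q"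
  unfolding vdiv_def using VF_D[of X p q] by (intro SF_closed(6) SF_closed(3) sderiv_SF hpart_SF) auto

lemma density_lie_SF [simp]: "X \<in> VF p q \<Longrightarrow> f \<in> SF p q \<Longrightarrow> density_lie p q lam X f \<in> SF p q"
  unfolding density_lie_def by (intro SF_closed sprod_SF vact_SF vdiv_SF)

lemma density_lie_add:
  "X \<in> VF p q \<Longrightarrow> f \<in> SF p q \<Longrightarrow> g \<in> SF p q \<Longrightarrow>
    density_lie p q lam X (f + g) = density_lie p q lam X f + density_lie p q lam X g"
  using vact_add[of p q X f g] VF_D[of X p q]
  by (simp add: density_lie_def sprod_add_right scaleR_add_right)

lemma density_lie_linear: "f \<in> SF p q \<Longrightarrow> fields_linear p q (\<lambda>X. density_lie p q lam X f)"
  unfolding fields_linear_def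
proof (intro conjI ballI allI impI)
  fix X Z :: vfield and r
  assume f: "f \<in> SF p q"
  show "density_lie p q lam X f = density_lie p q lam Z f" if "\<forall>i\<in>{1..p+q}. X i = Z i"
    using that by (simp add: density_lie_def vact_def vdiv_def)
  assume X: "X \<in> VF p q"
  show "density_lie p q lam (r *\<^sub>R X) f = r *\<^sub>R density_lie p q lam X f"
  proof -
    have "vdiv p q (r *\<^sub>R X) = r *\<^sub>R vdiv p q X"
      unfolding vdiv_def scaleR_right.sum using VF_D[OF X]
      by (intro sum.cong refl) (simp add: vfield_pointwise sderiv_scaleR[of _ p q] mult.commute)
    moreover have "vact p q (r *\<^sub>R X) f = r *\<^sub>R vact p q X f"
      unfolding vact_def scaleR_right.sum by (simp add: vfield_pointwise)
    ultimately show ?thesis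
      by (simp add: density_lie_def scaleR_add_right mult.commute)
  qed
  assume Z: "Z \<in> VF p q"
  show "density_lie p q lam (X + Z) f = density_lie p q lam X f + density_lie p q lam Z f"
  proof -
    have "vdiv p q (X + Z) = vdiv p q X + vdiv p q Z"
      unfolding vdiv_def sum.distrib[symmetric] using VF_D[OF X] VF_D[OF Z]
      by (intro sum.cong refl) (simp add: vfield_pointwise sderiv_add[of _ p q] scaleR_add_right)
    moreover have "vact p q (X + Z) f = vact p q X f + vact p q Z f"
      unfolding vact_def sum.distrib[symmetric] by (simp add: vfield_pointwise sprod_add_left)
    ultimately show ?thesis
      by (simp add: density_lie_def scaleR_add_right sprod_add_left)
  qed
qed

text \<open>Conjugation by \<open>twist a\<close> multiplies the part of parity \<open>b\<close> of an operator by \<open>(-1)\<^bsup>a b\<^esup>\<close>, so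
  this is \<open>\<L>\<^sub>X\<close> applied to \<open>diffop p q c\<close> for \<open>X\<close> of parity \<open>a\<close>.\<close>

definition olie :: "nat \<Rightarrow> nat \<Rightarrow> real \<Rightarrow> real \<Rightarrow> symbol \<Rightarrow> sfun \<Rightarrow> nat \<Rightarrow> vfield \<Rightarrow> sfun" where
  "olie p q lam mu c f a X = density_lie p q mu X (diffop p q c f)
    - twist a (diffop p q c (twist a (density_lie p q lam X f)))"

text \<open>A part of parity b sends parity e to b + e, and (-1)^(ab) is the product of
  (-1)^(a(b+e)) and (-1)^(ae): one twist of the result and one of the argument.\<close>

lemma opart_diffop_sum:
  assumes c: "c \<in> Sym p q" and f: "f \<in> SF p q"
  shows "(\<Sum>b\<in>{0,1}. (- 1) ^ (a * b) *\<^sub>R opart p q b (diffop p q c) f) = twist a (diffop p q c (twist a f))"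
proof -
  have 1: "(\<Sum>b\<in>{0,1}. (- 1) ^ (a * b) *\<^sub>R hpart (b + e) z) = (- 1) ^ (a * e) *\<^sub>R twist a z" for e z
  proof -
    have "(- 1) ^ (a * b) *\<^sub>R hpart (b + e) z = (- 1) ^ (a * e) *\<^sub>R twist a (hpart (b + e) z)" for b
      unfolding twist_hpart[symmetric] by (simp add: add_mult_distrib2 power_add)
    moreover have "(\<Sum>b\<in>{0,1}. hpart (b + e) z) = z"
    proof (cases "even e")
      case True
      then have "hpart (0 + e) z = hpart 0 z" "hpart (1 + e) z = hpart 1 z"
        by (auto intro!: hpart_mod simp: mod2_eq_if)
      then show ?thesis
        using hpart_decomp(1)[of z] by simp
    next
      case False
      then have "hpart (0 + e) z = hpart 1 z" "hpart (1 + e) z = hpart 0 z"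
        by (auto intro!: hpart_mod simp: mod2_eq_if)
      then show ?thesis
        using hpart_decomp(1)[of z] by (simp add: add.commute)
    qed
    ultimately show ?thesis
      unfolding scaleR_right.sum[symmetric] twist_sum[symmetric] by (simp only: scaleR_right.sum[symmetric] twist_sum[symmetric])
  qed
  have "(\<Sum>b\<in>{0,1}. (- 1) ^ (a * b) *\<^sub>R opart p q b (diffop p q c) f) =
      (\<Sum>b\<in>{0,1}. \<Sum>e\<in>{0,1}. (- 1) ^ (a * b) *\<^sub>R hpart (b + e) (diffop p q c (hpart e f)))"
    using f by (simp add: opart_def scaleR_add_right)
  also have "\<dots> = (\<Sum>e\<in>{0,1}. (- 1) ^ (a * e) *\<^sub>R twist a (diffop p q c (hpart e f)))"
    by (subst sum.swap) (simp only: 1)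
  also have "\<dots> = twist a (diffop p q c (\<Sum>e\<in>{0,1}. (- 1) ^ (a * e) *\<^sub>R hpart e f))"
    using f by (simp add: diffop_arg_add diffop_arg_scaleR)
  also have "(\<Sum>e\<in>{0,1}. (- 1) ^ (a * e) *\<^sub>R hpart e f) = twist a f"
    unfolding twist_hpart by (simp add: hpart_decomp flip: twist_linear(1))
  finally show ?thesis .
qed

lemma opart_SF: "c \<in> Sym p q \<Longrightarrow> f \<in> SF p q \<Longrightarrow> opart p q b (diffop p q c) f \<in> SF p q"
  by (simp add: opart_def)

lemma oper_lie_eq:
  assumes X: "X \<in> VF p q" and c: "c \<in> Sym p q" and f: "f \<in> SF p q"
  shows "oper_lie p q lam mu X (diffop p q c) f = (\<Sum>a\<in>{0,1}. olie p q lam mu c f a (vpart p a X))"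
proof -
  have V: "vpart p a X \<in> VF p q" for a
    using X by (simp add: VF_def vpart_SF)
  have "(\<Sum>b\<in>{0,1}. density_lie p q mu (vpart p a X) (opart p q b (diffop p q c) f)
       - (- 1) ^ (a * b) *\<^sub>R opart p q b (diffop p q c) (density_lie p q lam (vpart p a X) f)) =
      olie p q lam mu c f a (vpart p a X)" for a
  proof -
    \<comment> \<open>The sum without signs is the case a = 0 of the signed one.\<close>
    have "(\<Sum>b\<in>{0,1}. density_lie p q mu (vpart p a X) (opart p q b (diffop p q c) f)) =
        density_lie p q mu (vpart p a X) (\<Sum>b\<in>{0,1}. (- 1) ^ (0 * b) *\<^sub>R opart p q b (diffop p q c) f)"
      using V c f by (simp add: density_lie_add opart_SF)
    then show ?thesis
      unfolding opart_diffop_sum[OF c f] using V f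
      by (simp only: sum_subtractf opart_diffop_sum[OF c] density_lie_SF olie_def twist_0)
  qed
  then show ?thesis
    using f unfolding oper_lie_def by simp
qed

lemma olie_linear:
  assumes c: "c \<in> Sym p q" and f: "f \<in> SF p q"
  shows "fields_linear p q (olie p q lam mu c f a)"
proof -
  have 1: "fields_linear p q (\<lambda>X. density_lie p q lam X f)"
    and 2: "fields_linear p q (\<lambda>X. density_lie p q mu X (diffop p q c f))"
    using f c by (simp_all add: density_lie_linear)
  show ?thesis
    unfolding fields_linear_def
  proof (intro conjI ballI allI impI)
    fix X Z :: vfield and r
    show "olie p q lam mu c f a X = olie p q lam mu c f a Z" if "\<forall>i\<in>{1..p+q}. X i = Z i"
    proof -
      have "density_lie p q lam X f = density_lie p q lam Z f"
        "density_lie p q mu X (diffop p q c f) = density_lie p q mu Z (diffop p q c f)"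
        using 1 2 that unfolding fields_linear_def by blast+
      then show ?thesis
        by (simp add: olie_def)
    qed
    assume X: "X \<in> VF p q"
    show "olie p q lam mu c f a (r *\<^sub>R X) = r *\<^sub>R olie p q lam mu c f a X"
    proof -
      have "density_lie p q lam (r *\<^sub>R X) f = r *\<^sub>R density_lie p q lam X f"
        "density_lie p q mu (r *\<^sub>R X) (diffop p q c f) = r *\<^sub>R density_lie p q mu X (diffop p q c f)"
        using 1 2 X unfolding fields_linear_def by blast+
      then show ?thesis
        using X f by (simp add: olie_def diffop_arg_scaleR scaleR_diff_right)
    qed
    assume Z: "Z \<in> VF p q"
    show "olie p q lam mu c f a (X + Z) = olie p q lam mu c f a X + olie p q lam mu c f a Z"
    proof -
      have "density_lie p q lam (X + Z) f = density_lie p q lam X f + density_lie p q lam Z f"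
        "density_lie p q mu (X + Z) (diffop p q c f) =
          density_lie p q mu X (diffop p q c f) + density_lie p q mu Z (diffop p q c f)"
        using 1 2 X Z unfolding fields_linear_def by blast+
      then show ?thesis
        using X Z f by (simp add: olie_def diffop_arg_add)
    qed
  qed
qed

section \<open>Action of the basis fields on densities and on total symbols\<close>

lemma vdiv_homog:
  assumes "X \<in> VF p q" "\<And>i. i \<in> {1..p+q} \<Longrightarrow> homog (a + par p i) (X i)"
  shows "vdiv p q X = (\<Sum>i\<in>{1..p+q}. (- 1) ^ (par p i * (a + par p i)) *\<^sub>R sderiv p i (X i))"
  unfolding vdiv_def
proof (intro sum.cong refl)
  fix i assume i: "i \<in> {1..p+q}"
  show "(\<Sum>b\<in>{0, 1}. (- 1) ^ (par p i * b) *\<^sub>R sderiv p i (hpart b (X i))) =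
      (- 1) ^ (par p i * (a + par p i)) *\<^sub>R sderiv p i (X i)"
    unfolding hpart_homog[OF assms(2)[OF i]]
    by (cases "even (a + par p i)") (auto simp: mod2_eq_if minus_one_power_iff)
qed

lemma density_lie_Fminus:
  assumes f: "f \<in> SF p q" and r: "r \<in> {1..p+q}"
  shows "density_lie p q lam (Fminus r) f = - sderiv p r f"
proof -
  have "vdiv p q (Fminus r) = 0"
    unfolding vdiv_def
  proof (intro sum.neutral ballI)
    fix i a assume "i \<in> {1..p+q}"
    then show "(- 1) ^ (par p i * a) *\<^sub>R sderiv p i (hpart a (Fminus r i)) = 0"
      using sderiv_minus[OF sone_SF, of i p q] by (auto simp: Fminus_def hpart_homog[OF homog_sone])
  qed
  moreover have "vact p q (Fminus r) f = sprod (Fminus r r) (sderiv p r f)"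
    unfolding vact_def using r by (intro sum_single) (auto simp: Fminus_def)
  ultimately show ?thesis
    using f r by (simp add: density_lie_def Fminus_def sprod_sone_left[of _ p q])
qed

lemma density_lie_Fzero:
  assumes f: "f \<in> SF p q" and r: "r \<in> {1..p+q}" and c: "c \<in> {1..p+q}"
  shows "density_lie p q lam (Fzero p r c) f =
    - ((- 1) ^ (par p c * (par p r + par p c)) *\<^sub>R sprod (coord p c) (sderiv p r f))
    - (lam * (if r = c then (- 1) ^ par p r else 0)) *\<^sub>R f"
proof -
  have "homog (par p r + par p c + par p i) (Fzero p r c i)" for i
  proof (cases "i = r")
    case True
    have "(par p r + par p c + par p r) mod 2 = par p c mod 2"
      by (simp add: mod2_eq_if)
    then show ?thesis
      using True homog_cong[of "par p r + par p c + par p r" "par p c"] homog_scaleR[OF homog_coord[of p c], where c = "- ((- 1) ^ (par p c * (par p r + par p c)))"] by (simp add: Fzero_def)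
  qed (simp add: Fzero_def homog_def pointwise)
  from vdiv_homog[OF F_VF(2)[OF c] this] have "vdiv p q (Fzero p r c) =
      (\<Sum>i\<in>{1..p+q}. (- 1) ^ (par p i * (par p r + par p c + par p i)) *\<^sub>R sderiv p i (Fzero p r c i))" .
  also have "\<dots> = (- 1) ^ (par p r * (par p r + par p c + par p r)) *\<^sub>R sderiv p r (Fzero p r c r)"
    using r by (intro sum_single) (auto simp: Fzero_def)
  also have "\<dots> = - (if r = c then (- 1) ^ par p r else 0) *\<^sub>R sone"
    using r c by (auto simp: Fzero_def sderiv_minus[of _ p q] sderiv_scaleR[of _ p q] sderiv_coord[of _ p q]
        minus_one_power_iff)
  finally have 1: "vdiv p q (Fzero p r c) = - (if r = c then (- 1) ^ par p r else 0) *\<^sub>R sone" .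
  have "vact p q (Fzero p r c) f = sprod (Fzero p r c r) (sderiv p r f)"
    unfolding vact_def using r by (intro sum_single) (auto simp: Fzero_def)
  then show ?thesis
    using f unfolding density_lie_def 1 by (simp add: Fzero_def sprod_sone_left[of _ p q])
qed

context
  fixes p q :: nat
begin

interpretation super_weyl "Sym p q" "{1..p+q}" "par p" "Yop p" "Dop p" "Eop p q" "Iop p"
  by (rule super_weyl_Sym)

lemma density_lie_Fplus:
  assumes f: "f \<in> SF p q" and c: "c \<in> {1..p+q}"
  shows "density_lie p q lam (Fplus p c) f = (- 1) ^ par p c *\<^sub>R
    sprod (coord p c) ((\<Sum>i\<in>{1..p+q}. sprod (coord p i) (sderiv p i f)) + (lam * (sdim + 1)) *\<^sub>R f)"
proof -
  let ?s = "(- 1) ^ par p c :: real"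
  have "homog (par p c + par p i) (Fplus p c i)" for i
    unfolding Fplus_def by (intro homog_scaleR homog_sprod homog_coord)
  from vdiv_homog[OF F_VF(3)[OF c] this] have "vdiv p q (Fplus p c) =
      (\<Sum>i\<in>{1..p+q}. (- 1) ^ (par p i * (par p c + par p i)) *\<^sub>R sderiv p i (Fplus p c i))" .
  \<comment> \<open>The first summand is d_c hitting y^c, the second d_i hitting y^i.\<close>
  also have "\<dots> = (\<Sum>i\<in>{1..p+q}. (if i = c then ?s *\<^sub>R coord p c else 0) + (?s * (- 1) ^ par p i) *\<^sub>R coord p c)"
  proof (intro sum.cong refl)
    fix i assume i: "i \<in> {1..p+q}"
    have "sderiv p i (Fplus p c i) = ?s *\<^sub>R ((- 1) ^ (par p i * par p c) *\<^sub>R coord p c + (if i = c then coord p i else 0))"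
      using i c sderiv_coord_mult[OF coord_SF[OF i] i c] sprod_sone_right[OF coord_SF[OF c]]
      by (simp add: Fplus_def sderiv_scaleR[of _ p q] sderiv_coord[of _ p q])
    then show "(- 1) ^ (par p i * (par p c + par p i)) *\<^sub>R sderiv p i (Fplus p c i) =
        (if i = c then ?s *\<^sub>R coord p c else 0) + (?s * (- 1) ^ par p i) *\<^sub>R coord p c"
      by (auto simp: scaleR_add_right minus_one_power_iff)
  qed
  also have "\<dots> = (?s * (sdim + 1)) *\<^sub>R coord p c"
    using c by (simp add: sum.distrib sdim_def algebra_simps sum_distrib_left scaleR_left.sum)
  finally have 1: "vdiv p q (Fplus p c) = (?s * (sdim + 1)) *\<^sub>R coord p c" .
  have "vact p q (Fplus p c) f = ?s *\<^sub>R sprod (coord p c) (\<Sum>i\<in>{1..p+q}. sprod (coord p i) (sderiv p i f))"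
    unfolding vact_def by (simp add: Fplus_def sprod_sum_right sprod_assoc scaleR_right.sum)
  then show ?thesis
    by (simp add: density_lie_def 1 sprod_add_right scaleR_add_right mult_ac)
qed

text \<open>The total symbol of the operator precomposed with y^i and conjugated by the twist, see
  \<open>diffop_coord\<close>.\<close>

definition "Rop i c = Yop p i c + (- 1) ^ par p i *\<^sub>R Iop p i c"

lemma Rop_Sym [simp]: "i \<in> {1..p+q} \<Longrightarrow> c \<in> Sym p q \<Longrightarrow> Rop i c \<in> Sym p q"
  by (simp add: Rop_def)

text \<open>Composition on the right reverses the order: D y^c d_r arises by composing with y^c
  first, so \<open>Rop c\<close> acts before \<open>Eop p q r\<close>.\<close>

lemma diffop_coord_sderiv:
  assumes d: "d \<in> Sym p q" and f: "f \<in> SF p q" and r: "r \<in> {1..p+q}" and c: "c \<in> {1..p+q}"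
  shows "twist (par p r + par p c) (diffop p q d (twist (par p r + par p c) (sprod (coord p c) (sderiv p r f)))) =
    (- 1) ^ (par p r * par p c) *\<^sub>R diffop p q (Eop p q r (Rop c d)) f"
proof -
  have "twist (par p r + par p c) (sprod (coord p c) (sderiv p r f)) =
      twist (par p c) (twist (par p r) (sprod (coord p c) (sderiv p r f)))"
    by (simp add: add.commute)
  also have "\<dots> = (- 1) ^ (par p r * par p c) *\<^sub>R twist (par p c) (sprod (coord p c) (twist (par p r) (sderiv p r f)))"
    by (simp only: twist_coord_mult[of "par p r"] twist_linear)
  finally have "twist (par p r + par p c) (diffop p q d (twist (par p r + par p c) (sprod (coord p c) (sderiv p r f)))) =
      (- 1) ^ (par p r * par p c) *\<^sub>R twist (par p r) (twist (par p c)
        (diffop p q d (twist (par p c) (sprod (coord p c) (twist (par p r) (sderiv p r f))))))"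
    using f r c by (simp add: diffop_arg_scaleR)
  also have "\<dots> = (- 1) ^ (par p r * par p c) *\<^sub>R twist (par p r) (diffop p q (Rop c d) (twist (par p r) (sderiv p r f)))"
    using f r by (subst diffop_coord[OF d _ c]) (simp_all add: Rop_def)
  also have "\<dots> = (- 1) ^ (par p r * par p c) *\<^sub>R diffop p q (Eop p q r (Rop c d)) f"
    using d c by (subst diffop_sderiv[OF _ f r]) simp_all
  finally show ?thesis .
qed

text \<open>Composition with d_r gives D_r + E_r on the left and E_r on the right; only the
  derivative of the coefficients is left.\<close>

lemma olie_Fminus:
  assumes d: "d \<in> Sym p q" and f: "f \<in> SF p q" and r: "r \<in> {1..p+q}"
  shows "olie p q lam mu d f (par p r) (Fminus r) = diffop p q (Lminus r d) f"
  using assms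
  by (simp add: olie_def density_lie_Fminus[of _ p q] diffop_arg_minus sderiv_diffop diffop_sderiv diffop_add
      diffop_minus oper_pointwise Lminus_def)

text \<open>The terms Y_c E_r of the two sides cancel, the contraction in \<open>Rop\<close> yields
  the E_r I_c of \<open>Lzero\<close>, and the two divergence terms combine to the weight \<mu> -
  \<lambda>.\<close>

lemma olie_Fzero:
  assumes d: "d \<in> Sym p q" and f: "f \<in> SF p q" and r: "r \<in> {1..p+q}" and c: "c \<in> {1..p+q}"
  shows "olie p q lam mu d f ((par p r + par p c) mod 2) (Fzero p r c) = diffop p q (Lzero (mu - lam) r c d) f"
proof -
  let ?a = "par p r + par p c"
  let ?k = "(- 1) ^ (par p c * (par p r + par p c)) :: real"
  let ?s = "(- 1) ^ (par p r * par p c) :: real"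
  let ?e = "if r = c then (- 1) ^ par p r else 0 :: real"
  have tw: "twist (?a mod 2) g = twist ?a g" for g
    by (rule twist_cong) simp
  have 1: "density_lie p q mu (Fzero p r c) (diffop p q d f) =
      diffop p q (- (?k *\<^sub>R Yop p c (Dop p r d + Eop p q r d)) - (mu * ?e) *\<^sub>R d) f"
    using d f r c by (simp add: density_lie_Fzero[of _ p q] sderiv_diffop sprod_coord_diffop diffop_diff diffop_minus
        diffop_scaleR oper_pointwise)
  have "twist ?a (diffop p q d (twist ?a (density_lie p q lam (Fzero p r c) f))) =
      - (?k *\<^sub>R twist ?a (diffop p q d (twist ?a (sprod (coord p c) (sderiv p r f)))))
      - (lam * ?e) *\<^sub>R twist ?a (diffop p q d (twist ?a f))"
  proof -
    have "diffop p q d (- (?k *\<^sub>R g) - x *\<^sub>R h) = - (?k *\<^sub>R diffop p q d g) - x *\<^sub>R diffop p q d h"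
      if "g \<in> SF p q" "h \<in> SF p q" for g h x
      using that diffop_arg_add[of "- (?k *\<^sub>R g)" p q "- (x *\<^sub>R h)" d]
      by (simp add: diffop_arg_minus diffop_arg_scaleR)
    then show ?thesis
      using d f r c by (simp add: density_lie_Fzero[of _ p q])
  qed
  also have "(lam * ?e) *\<^sub>R twist ?a (diffop p q d (twist ?a f)) = (lam * ?e) *\<^sub>R diffop p q d f"
    by simp
  also have "twist ?a (diffop p q d (twist ?a (sprod (coord p c) (sderiv p r f)))) =
      ?s *\<^sub>R diffop p q (Eop p q r (Rop c d)) f"
    by (rule diffop_coord_sderiv[OF d f r c])
  also have "- (?k *\<^sub>R ?s *\<^sub>R diffop p q (Eop p q r (Rop c d)) f) - (lam * ?e) *\<^sub>R diffop p q d f =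
      diffop p q (- (?k *\<^sub>R ?s *\<^sub>R Eop p q r (Rop c d)) - (lam * ?e) *\<^sub>R d) f"
    using d r c by (simp add: diffop_diff diffop_minus diffop_scaleR oper_pointwise)
  finally have "olie p q lam mu d f (?a mod 2) (Fzero p r c) =
      diffop p q ((- (?k *\<^sub>R Yop p c (Dop p r d + Eop p q r d)) - (mu * ?e) *\<^sub>R d)
        - (- (?k *\<^sub>R ?s *\<^sub>R Eop p q r (Rop c d)) - (lam * ?e) *\<^sub>R d)) f"
    unfolding olie_def tw 1 using d r c by (simp add: diffop_diff oper_pointwise)
  also have "(- (?k *\<^sub>R Yop p c (Dop p r d + Eop p q r d)) - (mu * ?e) *\<^sub>R d)
        - (- (?k *\<^sub>R ?s *\<^sub>R Eop p q r (Rop c d)) - (lam * ?e) *\<^sub>R d) = Lzero (mu - lam) r c d"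
  proof -
    have "Eop p q r (Rop c d) = ?s *\<^sub>R Yop p c (Eop p q r d) + (- 1) ^ par p c *\<^sub>R Eop p q r (Iop p c d)"
      using d r c EY[of r c d] by (simp add: Rop_def)
    moreover have "?k * ?s * (- 1) ^ par p c = 1"
      by (simp add: minus_one_power_iff)
    ultimately show ?thesis
      using d r c by (simp add: Lzero_def scaleR_add_right mult.assoc) (simp add: algebra_simps)
  qed
  finally show ?thesis .
qed

text \<open>The quadratic field puts two coordinates to the right of the operator. The terms in
  which both are hit by derivatives form \<open>Deg (Iop p c d)\<close>; the coordinate in the
  divergence term of weight \<lambda> is hit once and gives the rest of the deviation from
  \<open>Lplus\<close>.\<close>

lemma olie_Fplus:
  assumes d: "d \<in> Sym p q" and f: "f \<in> SF p q" and c: "c \<in> {1..p+q}"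
  shows "olie p q lam mu d f (par p c) (Fplus p c) =
    diffop p q (Lplus (mu - lam) c d - Deg (Iop p c d) - (lam * (sdim + 1)) *\<^sub>R Iop p c d) f"
proof -
  let ?s = "(- 1) ^ par p c :: real"
  let ?m = "sdim + 1"
  let ?E = "\<lambda>f. \<Sum>i\<in>{1..p+q}. sprod (coord p i) (sderiv p i f)"
  have E: "?E g \<in> SF p q" if "g \<in> SF p q" for g
    using that by (intro SF_closed sprod_SF coord_SF sderiv_SF)
  have "?E (diffop p q d f) = diffop p q (Eul d + YE d) f"
  proof -
    have "diffop p q (Eul d + YE d) = (\<Sum>i\<in>{1..p+q}. diffop p q (Yop p i (Dop p i d + Eop p q i d)))"
    proof -
      have "diffop p q (Eul d) = (\<Sum>i\<in>{1..p+q}. diffop p q (Yop p i (Dop p i d)))"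
        "diffop p q (YE d) = (\<Sum>i\<in>{1..p+q}. diffop p q (Yop p i (Eop p q i d)))"
        unfolding Eul_def YE_def by (intro diffop_sum closed d; assumption)+
      then show ?thesis
        using d by (simp add: diffop_add sum.distrib)
    qed
    then show ?thesis
      using d f by (simp add: sum_apply[of _ _ f] sderiv_diffop sprod_coord_diffop)
  qed
  then have 1: "density_lie p q mu (Fplus p c) (diffop p q d f) =
      diffop p q (?s *\<^sub>R Yop p c (Eul d + YE d + (mu * ?m) *\<^sub>R d)) f"
    using d f c by (simp add: density_lie_Fplus sprod_coord_diffop diffop_add diffop_scaleR oper_pointwise
        sprod_add_right)
  \<comment> \<open>Precomposition with the Euler field: y^i either ends up as a factor, which gives
    \<open>YE\<close>, or is hit, which gives \<open>Deg\<close>.\<close>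
  have 2: "diffop p q (Rop c d) (?E f) = diffop p q (YE (Rop c d) + Deg (Rop c d)) f"
  proof -
    have "diffop p q (Rop c d) (sprod (coord p i) (sderiv p i f)) =
        diffop p q (Yop p i (Eop p q i (Rop c d)) + Eop p q i (Iop p i (Rop c d))) f" if i: "i \<in> {1..p+q}" for i
    proof -
      have "Eop p q i (Rop i z) = (- 1) ^ par p i *\<^sub>R (Yop p i (Eop p q i z) + Eop p q i (Iop p i z))" if "z \<in> Sym p q" for z
        using that i EY[OF i i that] by (simp add: Rop_def[of i] pm scaleR_add_right)
      then show ?thesis
        using diffop_coord_sderiv[of "Rop c d" f i i] i c d f
        by (simp add: pm diffop_scaleR oper_pointwise)
    qed
    then have "diffop p q (Rop c d) (?E f) =
        (\<Sum>i\<in>{1..p+q}. diffop p q (Yop p i (Eop p q i (Rop c d)) + Eop p q i (Iop p i (Rop c d))) f)"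
      using f by (subst diffop_arg_sum) (simp_all)
    also have "\<dots> = diffop p q (YE (Rop c d) + Deg (Rop c d)) f"
    proof -
      have R: "Rop c d \<in> Sym p q"
        using c d by (rule Rop_Sym)
      have "diffop p q (YE (Rop c d)) = (\<Sum>i\<in>{1..p+q}. diffop p q (Yop p i (Eop p q i (Rop c d))))"
        "diffop p q (Deg (Rop c d)) = (\<Sum>i\<in>{1..p+q}. diffop p q (Eop p q i (Iop p i (Rop c d))))"
        unfolding YE_def Deg_def by (intro diffop_sum closed R; assumption)+
      then show ?thesis
        using R by (simp add: diffop_add sum.distrib oper_pointwise sum_apply[of _ _ f])
    qed
    finally show ?thesis .
  qed
  have "twist (par p c) (diffop p q d (twist (par p c) (density_lie p q lam (Fplus p c) f))) =
      ?s *\<^sub>R twist (par p c) (diffop p q d (twist (par p c) (sprod (coord p c) (?E f + (lam * ?m) *\<^sub>R f))))"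
    using d f c E[OF f] by (simp add: density_lie_Fplus diffop_arg_scaleR)
  also have "\<dots> = ?s *\<^sub>R diffop p q (Rop c d) (?E f + (lam * ?m) *\<^sub>R f)"
    using E[OF f] f by (subst diffop_coord[OF d _ c]) (simp_all add: Rop_def)
  also have "\<dots> = diffop p q (?s *\<^sub>R (YE (Rop c d) + Deg (Rop c d) + (lam * ?m) *\<^sub>R Rop c d)) f"
    using E[OF f] f c d 2
    by (simp add: diffop_arg_add diffop_arg_scaleR diffop_add diffop_scaleR oper_pointwise)
  finally have "olie p q lam mu d f (par p c) (Fplus p c) = diffop p q (?s *\<^sub>R Yop p c (Eul d + YE d + (mu * ?m) *\<^sub>R d)
      - ?s *\<^sub>R (YE (Rop c d) + Deg (Rop c d) + (lam * ?m) *\<^sub>R Rop c d)) f"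
    unfolding olie_def 1 using d c by (simp add: diffop_diff oper_pointwise)
  also have "?s *\<^sub>R Yop p c (Eul d + YE d + (mu * ?m) *\<^sub>R d)
      - ?s *\<^sub>R (YE (Rop c d) + Deg (Rop c d) + (lam * ?m) *\<^sub>R Rop c d) =
      Lplus (mu - lam) c d - Deg (Iop p c d) - (lam * ?m) *\<^sub>R Iop p c d"
    using d c by (simp add: Lplus_def Rop_def YE_Y Deg_Y scaleR_add_right scaleR_diff_right)
      (simp add: algebra_simps)
  finally show ?thesis .
qed

lemma oper_lie_proj_field:
  assumes d: "d \<in> Sym p q"
  shows "oper_lie p q lam mu (proj_field p q M) (diffop p q d) = diffop p q (proj_sum p q M
    (\<lambda>r. Lminus r d) (\<lambda>r c. Lzero (mu - lam) r c d)
    (\<lambda>c. Lplus (mu - lam) c d - Deg (Iop p c d) - (lam * (sdim + 1)) *\<^sub>R Iop p c d))"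
  (is "_ = diffop p q (proj_sum p q M ?A ?B ?C)")
proof
  fix f
  show "oper_lie p q lam mu (proj_field p q M) (diffop p q d) f = diffop p q (proj_sum p q M ?A ?B ?C) f"
  proof (cases "f \<in> SF p q")
    case f: True
    have "oper_lie p q lam mu (proj_field p q M) (diffop p q d) f =
        (\<Sum>a\<in>{0,1}. olie p q lam mu d f a (vpart p a (proj_field p q M)))"
      by (rule oper_lie_eq[OF proj_field_VF d f])
    also have "\<dots> = proj_sum p q M (\<lambda>r. diffop p q (?A r) f) (\<lambda>r c. diffop p q (?B r c) f) (\<lambda>c. diffop p q (?C c) f)"
      unfolding proj_field_expand[of p q "olie p q lam mu d f", OF olie_linear[OF d f]]
      by (intro proj_sum_cong olie_Fminus olie_Fzero olie_Fplus d f)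
    also have "\<dots> = diffop p q (proj_sum p q M ?A ?B ?C) f"
      by (intro proj_sum_map[OF subspace_V, where T = "\<lambda>z. diffop p q z f", symmetric])
        (simp_all add: d diffop_add diffop_scaleR oper_pointwise)
    finally show ?thesis .
  qed (simp add: oper_lie_def diffop_outside)
qed

end

section \<open>Existence and uniqueness\<close>

lemma quantization_sum:
  assumes "quantization p q Q" "\<And>a. a \<in> A \<Longrightarrow> F a \<in> Sym p q"
  shows "Q (\<Sum>a\<in>A. F a) = (\<Sum>a\<in>A. Q (F a))"
proof -
  have "Q (0 *\<^sub>R 0) = 0 *\<^sub>R Q 0"
    using assms(1) Sym_closed(1) unfolding quantization_def by blast
  then show ?thesis
    using assms by (intro sum_additive_on[OF subspace_Sym[of p q], where T = Q]) (auto simp: quantization_def)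
qed

lemma kpart_Sym [simp]: "T \<in> Sym p q \<Longrightarrow> kpart p q k T \<in> Sym p q"
  by (rule SymI[of _ p q "{\<alpha>. T \<alpha> \<noteq> 0}"]) (auto simp: kpart_def SymD)

lemma kpart_SymK [simp]: "T \<in> Sym p q \<Longrightarrow> kpart p q k T \<in> SymK p q k"
  by (auto simp: SymK_def) (auto simp: kpart_def split: if_splits)

lemma kpart_linear: "kpart p q k (S + T) = kpart p q k S + kpart p q k T"
  "kpart p q k (c *\<^sub>R T) = c *\<^sub>R kpart p q k T" "kpart p q k 0 = 0"
  by (auto simp: kpart_def fun_eq_iff[where 'a = midx] symbol_pointwise)

lemma kpart_of_SymK: "T \<in> SymK p q k \<Longrightarrow> kpart p q l T = (if l = k then T else 0)"
  by (auto simp: SymK_def kpart_def fun_eq_iff[where 'a = midx] symbol_pointwise)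

lemma kpart_decomp:
  assumes "finite A" "\<And>\<alpha>. T \<alpha> \<noteq> 0 \<Longrightarrow> mdeg p q \<alpha> \<in> A"
  shows "(\<Sum>k\<in>A. kpart p q k T) = T"
proof
  fix \<alpha>
  show "(\<Sum>k\<in>A. kpart p q k T) \<alpha> = T \<alpha>"
    using assms by (cases "T \<alpha> = 0") (auto simp: sum_apply[of _ _ \<alpha>] kpart_def)
qed

lemma SymK_Sym: "T \<in> SymK p q k \<Longrightarrow> T \<in> Sym p q"
  by (simp add: SymK_def)

lemma degrees_finite: "T \<in> Sym p q \<Longrightarrow> finite (mdeg p q ` {\<alpha>. T \<alpha> \<noteq> 0})"
  by (simp add: SymD(3))

definition elem :: "nat \<Rightarrow> nat \<Rightarrow> mat" where
  "elem r c = (\<lambda>i j. if i = r \<and> j = c then 1 else 0)"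

lemma proj_sum_elem:
  shows "r \<in> {1..p+q} \<Longrightarrow> proj_sum p q (elem r 0) a b c = a r"
    and "r \<in> {1..p+q} \<Longrightarrow> s \<in> {1..p+q} \<Longrightarrow> proj_sum p q (elem r s) a b c = b r s"
    and "s \<in> {1..p+q} \<Longrightarrow> proj_sum p q (elem 0 s) a b c = c s"
    and "proj_sum p q (elem 0 0) a b c = - (\<Sum>r\<in>{1..p+q}. b r r)"
proof -
  have single: "(\<Sum>i\<in>{1..p+q}. x i *\<^sub>R F i) = F r" if "r \<in> {1..p+q}" "\<And>i. i \<in> {1..p+q} \<Longrightarrow> x i = (if i = r then 1 else 0)"
    for r x and F :: "nat \<Rightarrow> 'a"
    using that sum_single[of "{1..p+q}" r "\<lambda>i. x i *\<^sub>R F i"] by auto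
  have none: "(\<Sum>i\<in>{1..p+q}. x i *\<^sub>R F i) = 0" if "\<And>i. i \<in> {1..p+q} \<Longrightarrow> x i = 0" for x and F :: "nat \<Rightarrow> 'a"
    using that by (intro sum.neutral) auto
  have none2: "(\<Sum>i\<in>{1..p+q}. \<Sum>j\<in>{1..p+q}. x i j *\<^sub>R F i j) = 0"
    if "\<And>i j. i \<in> {1..p+q} \<Longrightarrow> j \<in> {1..p+q} \<Longrightarrow> x i j = 0" for x and F :: "nat \<Rightarrow> nat \<Rightarrow> 'a"
    using that by (intro sum.neutral ballI) auto
  show "proj_sum p q (elem r 0) a b c = a r" if r: "r \<in> {1..p+q}"
    unfolding proj_sum_def using r by (subst single[OF r], simp add: elem_def, subst none2, auto simp: elem_def none)
  show "proj_sum p q (elem 0 s) a b c = c s" if s: "s \<in> {1..p+q}"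
    unfolding proj_sum_def using s
    by (subst (3) single[OF s], simp add: elem_def, subst none2, auto simp: elem_def none)
  show "proj_sum p q (elem r s) a b c = b r s" if r: "r \<in> {1..p+q}" and s: "s \<in> {1..p+q}"
  proof -
    have e: "elem r s 0 0 = 0" "\<And>i. elem r s i 0 = 0" "\<And>j. elem r s 0 j = 0"
      using r s by (auto simp: elem_def)
    have "(\<Sum>i\<in>{1..p+q}. \<Sum>j\<in>{1..p+q}. elem r s i j *\<^sub>R b i j) = (\<Sum>j\<in>{1..p+q}. elem r s r j *\<^sub>R b r j)"
      using r by (intro sum_single none) (auto simp: elem_def)
    also have "\<dots> = b r s"
      using s by (intro single) (auto simp: elem_def)
    finally show ?thesis
      by (simp add: proj_sum_def e cong: if_cong)
  qed
  \<comment> \<open>Subtracting a = 1 times the identity from a zero block leaves - Id.\<close>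
  have "(\<Sum>j\<in>{1..p+q}. (elem 0 0 i j - (if i = j then elem 0 0 0 0 else 0)) *\<^sub>R b i j) = - b i i" if "i \<in> {1..p+q}" for i
  proof -
    have "(\<Sum>j\<in>{1..p+q}. (elem 0 0 i j - (if i = j then elem 0 0 0 0 else 0)) *\<^sub>R b i j) =
        (\<Sum>j\<in>{1..p+q}. (if j = i then 1 else 0) *\<^sub>R - b i j)"
      using that by (intro sum.cong) (auto simp: elem_def)
    also have "\<dots> = - b i i"
      using that by (intro single) auto
    finally show ?thesis .
  qed
  moreover have "(\<Sum>i\<in>{1..p+q}. elem 0 0 i 0 *\<^sub>R a i) = 0" "(\<Sum>i\<in>{1..p+q}. elem 0 0 0 i *\<^sub>R c i) = 0"
    by (intro none; auto simp: elem_def)+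
  ultimately show "proj_sum p q (elem 0 0) a b c = - (\<Sum>r\<in>{1..p+q}. b r r)"
    by (simp add: proj_sum_def sum_negf)
qed

text \<open>(p-q+1) \<alpha>(k,\<delta>) is quadratic in k with leading coefficient 1, so a
  difference of two values factors. For l = k - j the second factor is the j-th factor of the
  denominator of \<open>C k r\<close>.\<close>

lemma crit_alpha_diff:
  assumes "q \<noteq> p + 1"
  shows "(real p - real q + 1) * (crit_alpha p q k \<delta> - crit_alpha p q l \<delta>) =
    (real k - real l) * (real k + real l + (real p - real q) - (real p - real q + 1) * \<delta>)"
proof -
  define n where "n = real p - real q"
  have "n + 1 \<noteq> 0"
    using assms unfolding n_def by linarith
  then have "(n + 1) * crit_alpha p q i \<delta> =
      (n + 1) * (n / 2 * \<delta>\<^sup>2) - (n + 1) * ((2 * real i + n) / 2 * \<delta>) + real i * (real i + n)" for i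
    unfolding crit_alpha_def add_diff_eq[symmetric] n_def[symmetric] distrib_left[of "n + 1"] right_diff_distrib[of "n + 1"] by simp
  from this[of k] this[of l] show ?thesis
    unfolding right_diff_distrib n_def[symmetric] by (simp add: field_simps power2_eq_square)
qed

lemma not_critical_nonzero:
  assumes "q \<noteq> p + 1" "\<not> critical p q \<delta>" "k \<noteq> l"
  shows "real k + real l + (real p - real q) - (real p - real q + 1) * \<delta> \<noteq> 0"
proof
  assume *: "real k + real l + (real p - real q) - (real p - real q + 1) * \<delta> = 0"
  have "real p - real q + 1 \<noteq> 0"
    using assms(1) by linarith
  then have "crit_alpha p q k \<delta> = crit_alpha p q l \<delta>"
    using crit_alpha_diff[OF assms(1), of k \<delta> l] unfolding * by simp
  \<comment> \<open>\<open>critical\<close> asks for l < k, but the equation is symmetric in k and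
    l.\<close>
  then show False
    using assms(2,3) unfolding critical_def by (metis linorder_neqE_nat)
qed

context
  fixes p q :: nat
begin

interpretation super_weyl "Sym p q" "{1..p+q}" "par p" "Yop p" "Dop p" "Eop p q" "Iop p"
  by (rule super_weyl_Sym)

section \<open>Degrees of symbols as eigenvalues\<close>

lemma sdim_eq: "sdim = real p - real q"
proof -
  have "{1..p+q} = {1..p} \<union> {p+1..p+q}" "{1..p} \<inter> {p+1..p+q} = {}"
    by auto
  then have "sdim = (\<Sum>i\<in>{1..p}. (- 1) ^ par p i) + (\<Sum>i\<in>{p+1..p+q}. (- 1) ^ par p i)"
    unfolding sdim_def by (metis finite_atLeastAtMost sum.union_disjoint)
  also have "(\<Sum>i\<in>{1..p}. (- 1) ^ par p i) = (\<Sum>i\<in>{1..p}. 1 :: real)"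
    by (intro sum.cong) (auto simp: par_def)
  also have "(\<Sum>i\<in>{p+1..p+q}. (- 1) ^ par p i) = (\<Sum>i\<in>{p+1..p+q}. - 1 :: real)"
    by (intro sum.cong) (auto simp: par_def)
  finally show ?thesis
    by simp
qed

lemma Deg_apply: "T \<in> Sym p q \<Longrightarrow> Deg T \<alpha> = real (mdeg p q \<alpha>) *\<^sub>R T \<alpha>"
  unfolding Deg_def degree_op by simp

text \<open>Homogeneity as an eigenvalue equation, the form in which the Weyl algebra computations
  use it.\<close>

lemma SymK_iff: "T \<in> SymK p q k \<longleftrightarrow> T \<in> Sym p q \<and> Deg T = real k *\<^sub>R T"
proof -
  have "Deg T = real k *\<^sub>R T \<longleftrightarrow> (\<forall>\<alpha>. T \<alpha> \<noteq> 0 \<longrightarrow> mdeg p q \<alpha> = k)" if "T \<in> Sym p q"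
    unfolding fun_eq_iff[where 'a = midx] Deg_apply[OF that] symbol_pointwise by auto
  then show ?thesis
    by (auto simp: SymK_def)
qed

lemma Deg_eigen_kpart: "T \<in> Sym p q \<Longrightarrow> Deg T = c *\<^sub>R T \<Longrightarrow> real l \<noteq> c \<Longrightarrow> kpart p q l T = 0"
proof
  fix \<alpha> assume T: "T \<in> Sym p q" and "Deg T = c *\<^sub>R T" and l: "real l \<noteq> c"
  then have "Deg T \<alpha> = c *\<^sub>R T \<alpha>"
    by (simp add: symbol_pointwise)
  then show "kpart p q l T \<alpha> = 0 \<alpha>"
    using l unfolding Deg_apply[OF T] by (auto simp: kpart_def symbol_pointwise)
qed

text \<open>-1 is not a degree; this is applied to a contraction of a symbol of degree 0.\<close>

lemma Deg_eigen_neg: "T \<in> Sym p q \<Longrightarrow> Deg T = - T \<Longrightarrow> T = 0"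
proof
  fix \<alpha> assume T: "T \<in> Sym p q" and "Deg T = - T"
  then have "real (mdeg p q \<alpha>) *\<^sub>R T \<alpha> = (- 1) *\<^sub>R T \<alpha>"
    using Deg_apply[OF T, of \<alpha>] by (simp add: symbol_pointwise)
  then show "T \<alpha> = 0 \<alpha>"
    by (auto simp only: scaleR_cancel_right symbol_pointwise)
qed

lemma Div_pow_eq: "T \<in> Sym p q \<Longrightarrow> (symbol_div p q ^^ r) T = (Div ^^ r) T"
proof (induction r)
  case (Suc r)
  have "symbol_div p q U = Div U" if "U \<in> Sym p q" for U
    using symbol_div_eq[OF that] by (simp add: Div_def)
  then show ?case
    using Suc by simp
qed simp

lemma Deg_Lminus: "i \<in> {1..p+q} \<Longrightarrow> x \<in> Sym p q \<Longrightarrow> Deg (Lminus i x) = Lminus i (Deg x)"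
  by (simp add: Lminus_def Deg_D)

lemma Deg_Lzero:
  assumes "i \<in> {1..p+q}" "j \<in> {1..p+q}" "x \<in> Sym p q" "Deg x = k *\<^sub>R x"
  shows "Deg (Lzero \<delta> i j x) = k *\<^sub>R Lzero \<delta> i j x"
proof -
  have "Deg (Eop p q i (Iop p j x)) = k *\<^sub>R Eop p q i (Iop p j x)"
    using assms by (simp add: Deg_E Deg_I[OF assms(2-4)] scaleR_diff_left)
  then show ?thesis
    using assms by (simp add: Lzero_def Deg_Y Deg_D scaleR_diff_right mult.commute)
qed

lemma Deg_Lplus:
  assumes "j \<in> {1..p+q}" "x \<in> Sym p q" "Deg x = k *\<^sub>R x"
  shows "Deg (Lplus \<delta> j x) = k *\<^sub>R Lplus \<delta> j x"
proof -
  have Eul: "Deg (Eul z) = Eul (Deg z)" and YE: "Deg (YE z) = YE (Deg z) + YE z" if "z \<in> Sym p q" for z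
  proof -
    have "Deg (Eul z) = (\<Sum>i\<in>{1..p+q}. Deg (Yop p i (Dop p i z)))"
      unfolding Eul_def by (intro gen_sum closed that)
    then show "Deg (Eul z) = Eul (Deg z)"
      using that by (simp add: Eul_def Deg_Y Deg_D)
    have "Deg (YE z) = (\<Sum>i\<in>{1..p+q}. Deg (Yop p i (Eop p q i z)))"
      unfolding YE_def by (intro gen_sum closed that)
    then show "Deg (YE z) = YE (Deg z) + YE z"
      using that by (simp add: YE_def Deg_Y Deg_E sum.distrib)
  qed
  have "Deg (YE (Iop p j x)) = k *\<^sub>R YE (Iop p j x)"
    using assms YE[of "Iop p j x"] by (simp add: Deg_I[OF assms] scaleR_diff_left)
  moreover have "Deg (Eul x) = k *\<^sub>R Eul x"
    using assms Eul[of x] by simp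
  ultimately show ?thesis
    using assms by (simp add: Lplus_def Deg_Y) (simp add: algebra_simps)
qed

text \<open>\<open>Lact\<close> is the action of the class of M on symbols, \<open>Oact\<close> the
  one on operators read off from total symbols; only their g_1 parts differ.\<close>

definition "Lact \<delta> M x = proj_sum p q M (\<lambda>r. Lminus r x) (\<lambda>r c. Lzero \<delta> r c x) (\<lambda>c. Lplus \<delta> c x)"

definition "Oact \<delta> lam M x = proj_sum p q M (\<lambda>r. Lminus r x) (\<lambda>r c. Lzero \<delta> r c x)
  (\<lambda>c. Lplus \<delta> c x - Deg (Iop p c x) - (lam * (sdim + 1)) *\<^sub>R Iop p c x)"

lemma linop_L: "i \<in> {1..p+q} \<Longrightarrow> linop (Lminus i)" "i \<in> {1..p+q} \<Longrightarrow> j \<in> {1..p+q} \<Longrightarrow> linop (Lzero \<delta> i j)"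
  "j \<in> {1..p+q} \<Longrightarrow> linop (Lplus \<delta> j)"
  by (simp_all add: linop_def Lminus_def Lzero_def Lplus_def scaleR_add_right scaleR_diff_right
      algebra_simps)

lemma linop_comp: "linop F \<Longrightarrow> linop G \<Longrightarrow> linop (\<lambda>x. F (G x))"
  by (simp add: linop_def)

lemma linop_proj_sum:
  assumes "\<And>r. r \<in> {1..p+q} \<Longrightarrow> linop (a r)" "\<And>r s. r \<in> {1..p+q} \<Longrightarrow> s \<in> {1..p+q} \<Longrightarrow> linop (b r s)"
    and "\<And>s. s \<in> {1..p+q} \<Longrightarrow> linop (c s)"
  shows "linop (\<lambda>x. proj_sum p q M (\<lambda>r. a r x) (\<lambda>r s. b r s x) (\<lambda>s. c s x))"
  unfolding linop_def
proof (intro conjI ballI allI)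
  fix x y t assume x: "x \<in> Sym p q"
  show "proj_sum p q M (\<lambda>r. a r x) (\<lambda>r s. b r s x) (\<lambda>s. c s x) \<in> Sym p q"
    by (intro proj_sum_in[OF subspace_V] linopD(1)[OF assms(1)] linopD(1)[OF assms(2)] linopD(1)[OF assms(3)] x)
  show "proj_sum p q M (\<lambda>r. a r (t *\<^sub>R x)) (\<lambda>r s. b r s (t *\<^sub>R x)) (\<lambda>s. c s (t *\<^sub>R x)) =
      t *\<^sub>R proj_sum p q M (\<lambda>r. a r x) (\<lambda>r s. b r s x) (\<lambda>s. c s x)"
    unfolding proj_sum_linear(2)[symmetric]
    by (intro proj_sum_cong linopD(3)[OF assms(1)] linopD(3)[OF assms(2)] linopD(3)[OF assms(3)] x)
  assume y: "y \<in> Sym p q"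
  show "proj_sum p q M (\<lambda>r. a r (x + y)) (\<lambda>r s. b r s (x + y)) (\<lambda>s. c s (x + y)) =
      proj_sum p q M (\<lambda>r. a r x) (\<lambda>r s. b r s x) (\<lambda>s. c s x) + proj_sum p q M (\<lambda>r. a r y) (\<lambda>r s. b r s y) (\<lambda>s. c s y)"
    unfolding proj_sum_linear(1)[symmetric]
    by (intro proj_sum_cong linopD(2)[OF assms(1)] linopD(2)[OF assms(2)] linopD(2)[OF assms(3)] x y)
qed

lemma linop_proj_sum_apply:
  assumes "linop F" "\<And>r. r \<in> {1..p+q} \<Longrightarrow> a r \<in> Sym p q" "\<And>s. s \<in> {1..p+q} \<Longrightarrow> c s \<in> Sym p q"
    and "\<And>r s. r \<in> {1..p+q} \<Longrightarrow> s \<in> {1..p+q} \<Longrightarrow> b r s \<in> Sym p q"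
  shows "F (proj_sum p q M a b c) = proj_sum p q M (\<lambda>r. F (a r)) (\<lambda>r s. F (b r s)) (\<lambda>s. F (c s))"
  by (rule proj_sum_map[OF subspace_V]) (use assms in \<open>simp_all add: linopD[OF assms(1)]\<close>)

lemma linop_Lact: "linop (Lact \<delta> M)"
  unfolding Lact_def by (rule linop_proj_sum) (rule linop_L; assumption)+

lemma linop_Oact: "linop (Oact \<delta> lam M)"
proof -
  have "linop (\<lambda>x. Lplus \<delta> c x - Deg (Iop p c x) - (lam * (sdim + 1)) *\<^sub>R Iop p c x)" if "c \<in> {1..p+q}" for c
    using that linopD[OF linop_L(3)[OF that, of \<delta>]] by (simp add: linop_def scaleR_add_right scaleR_diff_right mult.commute)
  then show ?thesis
    unfolding Oact_def by (intro linop_proj_sum linop_L)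
qed

lemma linop_Div_pow: "linop (Div ^^ r)"
proof (induction r)
  case 0
  then show ?case
    by (simp add: linop_def)
next
  case (Suc r)
  have "linop (\<lambda>x. Div ((Div ^^ r) x))"
    by (rule linop_comp[OF linop_quad(4) Suc])
  then show ?case
    by (simp add: comp_def)
qed

lemma Deg_Lact:
  assumes "x \<in> Sym p q" "Deg x = k *\<^sub>R x"
  shows "Deg (Lact \<delta> M x) = k *\<^sub>R Lact \<delta> M x"
proof -
  have "Deg (Lact \<delta> M x) = proj_sum p q M (\<lambda>r. Deg (Lminus r x)) (\<lambda>r c. Deg (Lzero \<delta> r c x)) (\<lambda>c. Deg (Lplus \<delta> c x))"
    unfolding Lact_def by (rule linop_proj_sum_apply[where F = Deg, OF linop_quad(2)]; rule L_in; (assumption | rule assms)?)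
  also have "\<dots> = proj_sum p q M (\<lambda>r. k *\<^sub>R Lminus r x) (\<lambda>r c. k *\<^sub>R Lzero \<delta> r c x) (\<lambda>c. k *\<^sub>R Lplus \<delta> c x)"
    by (rule proj_sum_cong)
      (use assms in \<open>simp_all add: Deg_Lminus linopD(3)[OF linop_L(1)] Deg_Lzero[OF _ _ assms] Deg_Lplus[OF _ assms]\<close>)
  finally show ?thesis
    by (simp only: proj_sum_linear(2) Lact_def)
qed

lemma Lact_SymK: "x \<in> SymK p q k \<Longrightarrow> Lact \<delta> M x \<in> SymK p q k"
  using Deg_Lact linopD(1)[OF linop_Lact] by (auto simp: SymK_iff)

section \<open>The candidate quantization on total symbols\<close>

definition Phi :: "(nat \<Rightarrow> nat \<Rightarrow> real) \<Rightarrow> symbol \<Rightarrow> symbol" where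
  "Phi C S = (\<Sum>k\<in>mdeg p q ` {\<alpha>. S \<alpha> \<noteq> 0}. \<Sum>r=0..k. C k r *\<^sub>R (Div ^^ r) (kpart p q k S))"

lemma Div_pow_zero [simp]: "(Div ^^ r) 0 = 0"
  by (rule linopD(4)[OF linop_Div_pow])

text \<open>Provides a common index set for several symbols, as additivity requires.\<close>

lemma Phi_superset:
  assumes "finite A" "mdeg p q ` {\<alpha>. S \<alpha> \<noteq> 0} \<subseteq> A"
  shows "Phi C S = (\<Sum>k\<in>A. \<Sum>r=0..k. C k r *\<^sub>R (Div ^^ r) (kpart p q k S))"
  unfolding Phi_def
proof (rule sum.mono_neutral_left[OF assms], intro ballI)
  fix k assume "k \<in> A - mdeg p q ` {\<alpha>. S \<alpha> \<noteq> 0}"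
  then have "kpart p q k S = 0"
    by (auto simp: kpart_def fun_eq_iff[where 'a = midx] symbol_pointwise)
  then show "(\<Sum>r=0..k. C k r *\<^sub>R (Div ^^ r) (kpart p q k S)) = 0"
    by simp
qed

lemma Phi_SymK:
  assumes "S \<in> SymK p q k"
  shows "Phi C S = (\<Sum>r=0..k. C k r *\<^sub>R (Div ^^ r) S)"
proof -
  have "mdeg p q ` {\<alpha>. S \<alpha> \<noteq> 0} \<subseteq> {k}"
    using assms by (auto simp: SymK_def)
  from Phi_superset[OF _ this] show ?thesis
    by (simp add: kpart_of_SymK[OF assms])
qed

lemma linop_Phi: "linop (Phi C)"
  unfolding linop_def
proof (intro conjI ballI allI)
  fix S c assume S: "S \<in> Sym p q"
  show "Phi C S \<in> Sym p q"
    unfolding Phi_def by (intro V_closed Div_pow_in kpart_Sym S)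
  have "mdeg p q ` {\<alpha>. (c *\<^sub>R S) \<alpha> \<noteq> 0} \<subseteq> mdeg p q ` {\<alpha>. S \<alpha> \<noteq> 0}"
    by (auto simp: symbol_pointwise)
  from Phi_superset[OF degrees_finite[OF S] this] show "Phi C (c *\<^sub>R S) = c *\<^sub>R Phi C S"
    using S by (simp add: Phi_def kpart_linear linopD(3)[OF linop_Div_pow] scaleR_right.sum mult.commute)
  fix T assume T: "T \<in> Sym p q"
  let ?A = "mdeg p q ` {\<alpha>. S \<alpha> \<noteq> 0} \<union> mdeg p q ` {\<alpha>. T \<alpha> \<noteq> 0}"
  have "finite ?A" "mdeg p q ` {\<alpha>. (S + T) \<alpha> \<noteq> 0} \<subseteq> ?A"
    "mdeg p q ` {\<alpha>. S \<alpha> \<noteq> 0} \<subseteq> ?A" "mdeg p q ` {\<alpha>. T \<alpha> \<noteq> 0} \<subseteq> ?A"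
    using degrees_finite[OF S] degrees_finite[OF T] by (auto simp: symbol_pointwise)
  note sup = Phi_superset[OF this(1,2)] Phi_superset[OF this(1,3)] Phi_superset[OF this(1,4)]
  show "Phi C (S + T) = Phi C S + Phi C T"
    using S T unfolding sup by (simp add: kpart_linear linopD(2)[OF linop_Div_pow] scaleR_add_right sum.distrib)
qed

lemma div_map_eq:
  assumes S: "S \<in> Sym p q"
  shows "div_map p q C S = diffop p q (Phi C S)"
proof
  fix f
  have "diffop p q (Phi C S) f =
      (\<Sum>k\<in>mdeg p q ` {\<alpha>. S \<alpha> \<noteq> 0}. \<Sum>r=0..k. C k r *\<^sub>R diffop p q ((Div ^^ r) (kpart p q k S)) f)"
    unfolding Phi_def using S
    by (simp add: diffop_sum diffop_scaleR sum_apply[of _ _ f] oper_pointwise)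
  then show "div_map p q C S f = diffop p q (Phi C S) f"
    using S by (simp add: div_map_def Div_pow_eq Q_Aff_eq)
qed

text \<open>The divergence lowers the degree and \<open>C k 0 = 1\<close>, so \<open>Phi\<close> is
  the identity up to terms of lower degree.\<close>

lemma kpart_Phi:
  assumes "S \<in> SymK p q k" "C k 0 = 1"
  shows "kpart p q k (Phi C S) = S" "k < l \<Longrightarrow> kpart p q l (Phi C S) = 0"
proof -
  have S: "S \<in> Sym p q" "Deg S = real k *\<^sub>R S"
    using assms(1) by (auto simp: SymK_iff)
  have "kpart p q l (Phi C S) = (\<Sum>r=0..k. C k r *\<^sub>R kpart p q l ((Div ^^ r) S))" for l
    unfolding Phi_SymK[OF assms(1)]
    using sum_comp_morphism[of "kpart p q l" "\<lambda>r. C k r *\<^sub>R (Div ^^ r) S"] by (simp add: comp_def kpart_linear)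
  moreover have "kpart p q l ((Div ^^ r) S) = (if r = 0 \<and> l = k then S else 0)" if "k \<le> l" for l r
    using that Deg_eigen_kpart[OF Div_pow_in[OF S(1)] Deg_Div[OF S], of l r] kpart_of_SymK[OF assms(1)]
    by (cases "r = 0") auto
  note calculation = calculation(1) this
  have *: "kpart p q l (Phi C S) = (\<Sum>r=0..k. if r = 0 then if l = k then S else 0 else 0)" if "k \<le> l" for l
  proof -
    have "kpart p q l (Phi C S) = (\<Sum>r=0..k. C k r *\<^sub>R (if r = 0 \<and> l = k then S else 0))"
      using calculation(1)[of l] calculation(2)[OF that] by simp
    also have "\<dots> = (\<Sum>r=0..k. if r = 0 then if l = k then S else 0 else 0)"
      using assms(2) by (intro sum.cong refl) auto
    finally show ?thesis .
  qed
  from *[of k] show "kpart p q k (Phi C S) = S"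
    by simp
  from *[of l] show "k < l \<Longrightarrow> kpart p q l (Phi C S) = 0"
    by simp
qed

lemma Phi_degree_le:
  assumes "S \<in> SymK p q k" "C k 0 = 1" "Phi C S \<alpha> \<noteq> 0"
  shows "mdeg p q \<alpha> \<le> k"
proof (rule ccontr)
  assume "\<not> mdeg p q \<alpha> \<le> k"
  then have "kpart p q (mdeg p q \<alpha>) (Phi C S) = 0"
    using kpart_Phi(2)[where C = C, OF assms(1,2)] by simp
  then have "kpart p q (mdeg p q \<alpha>) (Phi C S) \<alpha> = 0"
    by (simp add: symbol_pointwise)
  with assms(3) show False
    by (simp add: kpart_def)
qed

text \<open>\<open>Phi\<close> is unitriangular with respect to the degree: it is injective because
  the component of highest degree is unchanged, and surjective because the highest component can be
  removed step by step.\<close>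

lemma Phi_bij:
  assumes C: "\<And>k. C k 0 = 1"
  shows "bij_betw (Phi C) (Sym p q) (Sym p q)"
  unfolding bij_betw_def
proof
  note Phi = linopD[OF linop_Phi[of C]]
  have zero: "S = 0" if S: "S \<in> Sym p q" "Phi C S = 0" for S
  proof (rule ccontr)
    assume "S \<noteq> 0"
    let ?A = "mdeg p q ` {\<alpha>. S \<alpha> \<noteq> 0}"
    have A: "finite ?A" "?A \<noteq> {}"
      using degrees_finite[OF S(1)] \<open>S \<noteq> 0\<close> by (auto simp: fun_eq_iff[where 'a = midx] symbol_pointwise)
    define k where "k = Max ?A"
    have "k \<in> ?A"
      unfolding k_def by (rule Max_in[OF A])
    have "Phi C S = Phi C (\<Sum>l\<in>?A. kpart p q l S)"
      by (subst kpart_decomp[OF A(1)]) auto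
    also have "\<dots> = (\<Sum>l\<in>?A. Phi C (kpart p q l S))"
      by (intro linop_sum[OF linop_Phi] kpart_Sym S)
    finally have "kpart p q k (Phi C S) = (\<Sum>l\<in>?A. kpart p q k (Phi C (kpart p q l S)))"
      using sum_comp_morphism[of "kpart p q k" "\<lambda>l. Phi C (kpart p q l S)"] by (simp add: comp_def kpart_linear)
    also have "\<dots> = kpart p q k (Phi C (kpart p q k S))"
    proof (rule sum_single[OF A(1) \<open>k \<in> ?A\<close>])
      fix l assume "l \<in> ?A" "l \<noteq> k"
      then have "l < k"
        using Max_ge[OF A(1), of l] by (simp add: k_def)
      then show "kpart p q k (Phi C (kpart p q l S)) = 0"
        using kpart_Phi(2)[where C = C, OF kpart_SymK[OF S(1)] C] by simp
    qed
    also have "\<dots> = kpart p q k S"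
      by (rule kpart_Phi(1)[where C = C, OF kpart_SymK[OF S(1)] C])
    finally have "kpart p q k S = 0"
      using S(2) by (simp add: kpart_linear)
    moreover obtain \<alpha> where "S \<alpha> \<noteq> 0" "mdeg p q \<alpha> = k"
      using \<open>k \<in> ?A\<close> by auto
    ultimately show False
      by (metis kpart_def symbol_pointwise(2))
  qed
  show "inj_on (Phi C) (Sym p q)"
  proof (rule inj_onI)
    fix S T assume *: "S \<in> Sym p q" "T \<in> Sym p q" "Phi C S = Phi C T"
    have "S - T = 0"
      by (rule zero) (use * in \<open>simp_all add: Phi(6)\<close>)
    then show "S = T"
      by simp
  qed
  \<comment> \<open>Induction on a strict bound for the degrees; subtracting \<open>Phi\<close> of
    the component of degree n lowers the bound.\<close>
  have surj: "\<exists>S\<in>Sym p q. Phi C S = T" if "T \<in> Sym p q" "\<And>\<alpha>. T \<alpha> \<noteq> 0 \<Longrightarrow> mdeg p q \<alpha> < n" for T n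
    using that
  proof (induction n arbitrary: T)
    case 0
    then have "T = 0"
      by (auto simp: fun_eq_iff[where 'a = midx] symbol_pointwise)
    then show ?case
      using Phi(4) by (intro bexI[of _ 0]) simp_all
  next
    case (Suc n)
    let ?K = "kpart p q n T"
    have K: "?K \<in> SymK p q n" "?K \<in> Sym p q"
      using Suc.prems(1) by simp_all
    have "\<exists>S\<in>Sym p q. Phi C S = T - Phi C ?K"
    proof (rule Suc.IH)
      show "T - Phi C ?K \<in> Sym p q"
        using Suc.prems(1) K(2) Phi(1) by simp
      fix \<alpha> assume nz: "(T - Phi C ?K) \<alpha> \<noteq> 0"
      have "mdeg p q \<alpha> \<le> n"
      proof (rule ccontr)
        assume "\<not> mdeg p q \<alpha> \<le> n"
        then have "T \<alpha> = 0" "Phi C ?K \<alpha> = 0"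
          using Suc.prems(2)[of \<alpha>] Phi_degree_le[of ?K n C \<alpha>, OF K(1) C] by auto
        with nz show False
          by (simp add: symbol_pointwise)
      qed
      moreover have "mdeg p q \<alpha> \<noteq> n"
      proof
        assume n: "mdeg p q \<alpha> = n"
        have "Phi C ?K \<alpha> = kpart p q n (Phi C ?K) \<alpha>"
          using n by (simp add: kpart_def)
        also have "\<dots> = T \<alpha>"
          unfolding kpart_Phi(1)[where C = C, OF K(1) C] using n by (simp add: kpart_def)
        finally show False
          using nz by (simp add: symbol_pointwise)
      qed
      ultimately show "mdeg p q \<alpha> < n"
        by simp
    qed
    then obtain S where "S \<in> Sym p q" "Phi C S = T - Phi C ?K"
      by blast
    then show ?case
      using K(2) Phi(2) by (intro bexI[of _ "S + ?K"]) simp_all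
  qed
  have "T \<in> Phi C ` Sym p q" if T: "T \<in> Sym p q" for T
  proof -
    have "mdeg p q \<alpha> < Suc (Max (mdeg p q ` {\<alpha>. T \<alpha> \<noteq> 0}))" if "T \<alpha> \<noteq> 0" for \<alpha>
      using that degrees_finite[OF T] by (simp add: less_Suc_eq_le)
    from surj[OF T this] show ?thesis
      by blast
  qed
  then show "Phi C ` Sym p q = Sym p q"
    using Phi(1) by blast
qed

lemma div_map_quantization:
  assumes C: "\<And>k. C k 0 = 1"
  shows "quantization p q (div_map p q C)"
  unfolding quantization_def
proof (intro conjI ballI allI)
  note Phi = linopD[OF linop_Phi[of C]]
  fix T c assume T: "T \<in> Sym p q"
  show "div_map p q C (c *\<^sub>R T) = c *\<^sub>R div_map p q C T"
    using T Phi(1,3) by (simp add: div_map_eq diffop_scaleR)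
  fix S assume S: "S \<in> Sym p q"
  show "div_map p q C (T + S) = div_map p q C T + div_map p q C S"
    using S T Phi(1,2) by (simp add: div_map_eq diffop_add)
next
  have "bij_betw (diffop p q) (Sym p q) (DO p q)"
    using diffop_inj_on by (simp add: bij_betw_def DO_def)
  from bij_betw_trans[OF Phi_bij[where C = C, OF C] this]
  have "bij_betw (diffop p q \<circ> Phi C) (Sym p q) (DO p q)" .
  then show "bij_betw (div_map p q C) (Sym p q) (DO p q)"
    by (rule bij_betw_cong[THEN iffD1, rotated]) (simp add: div_map_eq)
next
  fix k T assume T: "T \<in> SymK p q k"
  have "Phi C T \<in> Sym p q"
    using linopD(1)[OF linop_Phi] SymK_Sym[OF T] by simp
  then show "div_map p q C T \<in> DOK p q k"
    using Phi_degree_le[where C = C, OF T C] SymK_Sym[OF T] by (auto simp: DOK_def div_map_eq)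
  show "principal_symbol p q k (div_map p q C T) = T"
    using \<open>Phi C T \<in> Sym p q\<close> kpart_Phi(1)[where C = C, OF T C] SymK_Sym[OF T]
    by (simp add: principal_symbol_def div_map_eq total_symbol_diffop)
qed

text \<open>Apart from the terms with \<open>Lplus\<close>, both sides are combinations of the
  contractions of Div^r T. Commuting past \<open>Lplus\<close> produces them with index r - 1, the
  action on operators with index r, and the recursion matches the coefficients after a
  shift.\<close>

lemma Phi_Lplus:
  assumes T: "T \<in> SymK p q k" and j: "j \<in> {1..p+q}"
    and C: "\<And>r. r < k \<Longrightarrow> C k (Suc r) * (real (Suc r) * (sdim + 2 * real k - real (Suc r) - (sdim + 1) * \<delta>)) =
      C k r * (real k - real (Suc r) + lam * (sdim + 1))"
  shows "(\<Sum>r=0..k. C k r *\<^sub>R (Div ^^ r) (Lplus \<delta> j T)) =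
    (\<Sum>r=0..k. C k r *\<^sub>R (Lplus \<delta> j ((Div ^^ r) T) - Deg (Iop p j ((Div ^^ r) T))
      - (lam * (sdim + 1)) *\<^sub>R Iop p j ((Div ^^ r) T)))"
proof -
  have S: "T \<in> Sym p q" "Deg T = real k *\<^sub>R T"
    using T by (auto simp: SymK_iff)
  define z where "z r = Iop p j ((Div ^^ r) T)" for r
  have z: "z r \<in> Sym p q" "Deg (z r) = (real k - real r - 1) *\<^sub>R z r" for r
    using S j Deg_I[OF j Div_pow_in[OF S(1)] Deg_Div[OF S]] by (simp_all add: z_def)
  \<comment> \<open>A contraction of the degree 0 symbol Div^k T.\<close>
  have "z k = 0"
    using Deg_eigen_neg[OF z(1)] z(2)[of k] by simp
  let ?d = "\<lambda>r. real r * (sdim + 2 * real k - real r - (sdim + 1) * \<delta>)"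
  \<comment> \<open>The summand for r = 0 has the factor 0, so its truncated index r - 1 does no
    harm.\<close>
  have "(\<Sum>r=0..k. (C k r * ?d r) *\<^sub>R z (r - 1)) = (\<Sum>r<k. (C k (Suc r) * ?d (Suc r)) *\<^sub>R z r)"
    by (simp add: atLeast0AtMost sum.atMost_shift)
  also have "\<dots> = (\<Sum>r<k. (C k r * (real k - real (Suc r) + lam * (sdim + 1))) *\<^sub>R z r)"
    by (intro sum.cong refl) (simp only: C lessThan_iff)
  \<comment> \<open>The recursion holds for r < k; since \<open>z k = 0\<close>, the range can be
    extended to k.\<close>
  also have "\<dots> = (\<Sum>r=0..k. (C k r * (real k - real (Suc r) + lam * (sdim + 1))) *\<^sub>R z r)"
    using \<open>z k = 0\<close> by (simp add: atLeast0AtMost lessThan_Suc_atMost[symmetric])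
  finally have 1: "(\<Sum>r=0..k. (C k r * ?d r) *\<^sub>R z (r - 1)) =
      (\<Sum>r=0..k. (C k r * (real k - real (Suc r) + lam * (sdim + 1))) *\<^sub>R z r)" .
  have "(\<Sum>r=0..k. C k r *\<^sub>R (Div ^^ r) (Lplus \<delta> j T)) =
      (\<Sum>r=0..k. C k r *\<^sub>R Lplus \<delta> j ((Div ^^ r) T)) - (\<Sum>r=0..k. (C k r * ?d r) *\<^sub>R z (r - 1))"
    unfolding sum_subtractf[symmetric] using Div_pow_Lplus[OF j S]
    by (intro sum.cong refl) (simp add: scaleR_diff_right z_def)
  also have "\<dots> = (\<Sum>r=0..k. C k r *\<^sub>R (Lplus \<delta> j ((Div ^^ r) T) - Deg (z r) - (lam * (sdim + 1)) *\<^sub>R z r))"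
    unfolding 1 sum_subtractf[symmetric] z(2)
    by (intro sum.cong refl) (simp add: algebra_simps)
  finally show ?thesis
    by (simp only: z_def)
qed

lemma Phi_Lact:
  assumes T: "T \<in> SymK p q k"
    and C: "\<And>r. r < k \<Longrightarrow> C k (Suc r) * (real (Suc r) * (sdim + 2 * real k - real (Suc r) - (sdim + 1) * \<delta>)) =
      C k r * (real k - real (Suc r) + lam * (sdim + 1))"
  shows "Phi C (Lact \<delta> M T) = Oact \<delta> lam M (Phi C T)"
proof -
  have S: "T \<in> Sym p q"
    using T by (rule SymK_Sym)
  let ?z = "\<lambda>s. (Div ^^ s) T"
  let ?G = "\<lambda>s c. Lplus \<delta> c (?z s) - Deg (Iop p c (?z s)) - (lam * (sdim + 1)) *\<^sub>R Iop p c (?z s)"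
  have Div_Lact: "(Div ^^ s) (Lact \<delta> M T) =
      proj_sum p q M (\<lambda>r. Lminus r (?z s)) (\<lambda>r c. Lzero \<delta> r c (?z s)) (\<lambda>c. (Div ^^ s) (Lplus \<delta> c T))" for s
  proof -
    have "(Div ^^ s) (Lact \<delta> M T) = proj_sum p q M (\<lambda>r. (Div ^^ s) (Lminus r T))
        (\<lambda>r c. (Div ^^ s) (Lzero \<delta> r c T)) (\<lambda>c. (Div ^^ s) (Lplus \<delta> c T))"
      unfolding Lact_def by (rule linop_proj_sum_apply[where F = "Div ^^ s", OF linop_Div_pow]; rule L_in; (assumption | rule S)?)
    also have "\<dots> = proj_sum p q M (\<lambda>r. Lminus r (?z s)) (\<lambda>r c. Lzero \<delta> r c (?z s)) (\<lambda>c. (Div ^^ s) (Lplus \<delta> c T))"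
      by (intro proj_sum_cong Div_pow_Lminus Div_pow_Lzero S refl)
    finally show ?thesis .
  qed
  have "Phi C (Lact \<delta> M T) = proj_sum p q M (\<lambda>r. \<Sum>s=0..k. C k s *\<^sub>R Lminus r (?z s))
      (\<lambda>r c. \<Sum>s=0..k. C k s *\<^sub>R Lzero \<delta> r c (?z s)) (\<lambda>c. \<Sum>s=0..k. C k s *\<^sub>R (Div ^^ s) (Lplus \<delta> c T))"
    unfolding Phi_SymK[OF Lact_SymK[OF T]] Div_Lact by (rule proj_sum_sum)
  also have "\<dots> = proj_sum p q M (\<lambda>r. \<Sum>s=0..k. C k s *\<^sub>R Lminus r (?z s))
      (\<lambda>r c. \<Sum>s=0..k. C k s *\<^sub>R Lzero \<delta> r c (?z s)) (\<lambda>c. \<Sum>s=0..k. C k s *\<^sub>R ?G s c)"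
    by (intro proj_sum_cong refl Phi_Lplus[where C = C and lam = lam, OF T _ C])
  also have "\<dots> = (\<Sum>s=0..k. C k s *\<^sub>R Oact \<delta> lam M (?z s))"
    unfolding Oact_def by (rule proj_sum_sum[symmetric])
  also have "\<dots> = (\<Sum>s=0..k. Oact \<delta> lam M (C k s *\<^sub>R (Div ^^ s) T))"
    using S by (simp add: linopD(3)[OF linop_Oact])
  also have "\<dots> = Oact \<delta> lam M (\<Sum>s=0..k. C k s *\<^sub>R (Div ^^ s) T)"
    by (intro linop_sum[OF linop_Oact, symmetric] V_closed Div_pow_in S)
  finally show ?thesis
    unfolding Phi_SymK[OF T] .
qed

lemma div_map_equivariant:
  assumes C: "\<And>k r. r < k \<Longrightarrow> C k (Suc r) * (real (Suc r) * (sdim + 2 * real k - real (Suc r) - (sdim + 1) * (mu - lam))) =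
      C k r * (real k - real (Suc r) + lam * (sdim + 1))"
  shows "sl_equivariant p q lam mu (div_map p q C)"
  unfolding sl_equivariant_def
proof (intro allI ballI)
  fix M T assume T: "T \<in> Sym p q"
  have L: "symbol_lie p q (mu - lam) (proj_field p q M) T = Lact (mu - lam) M T"
    unfolding Lact_def by (rule symbol_lie_proj_field[OF T])
  let ?A = "mdeg p q ` {\<alpha>. T \<alpha> \<noteq> 0}"
  have dec: "(\<Sum>k\<in>?A. kpart p q k T) = T"
    by (rule kpart_decomp) (use degrees_finite[OF T] in auto)
  have "Phi C (Lact (mu - lam) M T) = Phi C (Lact (mu - lam) M (\<Sum>k\<in>?A. kpart p q k T))"
    by (simp only: dec)
  also have "\<dots> = (\<Sum>k\<in>?A. Phi C (Lact (mu - lam) M (kpart p q k T)))"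
    by (intro linop_sum[OF linop_comp[OF linop_Phi linop_Lact]] kpart_Sym T)
  also have "\<dots> = (\<Sum>k\<in>?A. Oact (mu - lam) lam M (Phi C (kpart p q k T)))"
    by (intro sum.cong refl Phi_Lact[OF kpart_SymK[OF T]] C)
  also have "\<dots> = Oact (mu - lam) lam M (Phi C (\<Sum>k\<in>?A. kpart p q k T))"
    by (intro linop_sum[OF linop_comp[OF linop_Oact linop_Phi], symmetric] kpart_Sym T)
  finally have "Phi C (Lact (mu - lam) M T) = Oact (mu - lam) lam M (Phi C T)"
    by (simp only: dec)
  moreover have "oper_lie p q lam mu (proj_field p q M) (diffop p q (Phi C T)) = diffop p q (Oact (mu - lam) lam M (Phi C T))"
    unfolding Oact_def by (rule oper_lie_proj_field[OF linopD(1)[OF linop_Phi T]])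
  ultimately show "oper_lie p q lam mu (proj_field p q M) (div_map p q C T) =
      div_map p q C (symbol_lie p q (mu - lam) (proj_field p q M) T)"
    using T linopD(1)[OF linop_Lact T] by (simp add: L div_map_eq)
qed

section \<open>Uniqueness by the Casimir operator\<close>

lemma Lact_elem:
  shows "r \<in> {1..p+q} \<Longrightarrow> Lact \<delta> (elem r 0) T = Lminus r T"
    and "r \<in> {1..p+q} \<Longrightarrow> c \<in> {1..p+q} \<Longrightarrow> Lact \<delta> (elem r c) T = Lzero \<delta> r c T"
    and "c \<in> {1..p+q} \<Longrightarrow> Lact \<delta> (elem 0 c) T = Lplus \<delta> c T"
    and "Lact \<delta> (elem 0 0) T = Lid \<delta> T"
  by (simp_all add: Lact_def proj_sum_elem Lid_def)

text \<open>The counterpart of \<open>casimir\<close> built from the action on operators alone. It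
  involves no quantization, so it can be used to compare two of them.\<close>

definition "ocas lam mu D =
  (let l = (\<lambda>r c. oper_lie p q lam mu (proj_field p q (elem r c))) in
   2 *\<^sub>R (\<Sum>j\<in>{1..p+q}. (- 1) ^ par p j *\<^sub>R l 0 j (l j 0 D))
   + (\<Sum>i\<in>{1..p+q}. \<Sum>j\<in>{1..p+q}. (- 1) ^ par p j *\<^sub>R l i j (l j i D))
   + l 0 0 (l 0 0 D) - (sdim + 1) *\<^sub>R l 0 0 D)"

text \<open>Every matrix unit represents a class of the projective superalgebra, so equivariance
  moves both factors of each quadratic term through Q.\<close>

lemma quantization_casimir:
  assumes Q: "quantization p q Q" "sl_equivariant p q lam mu Q" and T: "T \<in> Sym p q"
  shows "ocas lam mu (Q T) = Q (casimir (mu - lam) T)"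
proof -
  let ?l = "\<lambda>r c. oper_lie p q lam mu (proj_field p q (elem r c))"
  have add: "Q (A + B) = Q A + Q B" and scale: "Q (x *\<^sub>R A) = x *\<^sub>R Q A" if "A \<in> Sym p q" "B \<in> Sym p q" for A B x
    using Q(1) that by (auto simp: quantization_def)
  have diff: "Q (A - B) = Q A - Q B" if "A \<in> Sym p q" "B \<in> Sym p q" for A B
    using add[of A "(- 1) *\<^sub>R B"] scale[of B B "- 1"] that by simp
  have eq: "?l r c (Q A) = Q (Lact (mu - lam) (elem r c) A)" if "A \<in> Sym p q" for r c A
    using Q(2) that symbol_lie_proj_field[OF that] unfolding sl_equivariant_def Lact_def by metis
  have Lid_in: "Lid \<delta> A \<in> Sym p q" if "A \<in> Sym p q" for A \<delta>
    unfolding Lid_def by (intro V_closed L_in that)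
  have "?l 0 j (?l j 0 (Q T)) = Q (Lplus (mu - lam) j (Lminus j T))" if "j \<in> {1..p+q}" for j
    using that T by (simp add: eq Lact_elem)
  then have 1: "(\<Sum>j\<in>{1..p+q}. (- 1) ^ par p j *\<^sub>R ?l 0 j (?l j 0 (Q T))) =
      Q (\<Sum>j\<in>{1..p+q}. (- 1) ^ par p j *\<^sub>R Lplus (mu - lam) j (Lminus j T))"
    using T by (subst quantization_sum[OF Q(1)]) (auto simp: scale)
  have "?l i j (?l j i (Q T)) = Q (Lzero (mu - lam) i j (Lzero (mu - lam) j i T))" if "i \<in> {1..p+q}" "j \<in> {1..p+q}" for i j
    using that T by (simp add: eq Lact_elem)
  then have "(\<Sum>j\<in>{1..p+q}. (- 1) ^ par p j *\<^sub>R ?l i j (?l j i (Q T))) =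
      Q (\<Sum>j\<in>{1..p+q}. (- 1) ^ par p j *\<^sub>R Lzero (mu - lam) i j (Lzero (mu - lam) j i T))" if "i \<in> {1..p+q}" for i
    using T that by (subst quantization_sum[OF Q(1)]) (auto simp: scale)
  moreover have "Q (\<Sum>i\<in>{1..p+q}. \<Sum>j\<in>{1..p+q}. (- 1) ^ par p j *\<^sub>R Lzero (mu - lam) i j (Lzero (mu - lam) j i T)) =
      (\<Sum>i\<in>{1..p+q}. Q (\<Sum>j\<in>{1..p+q}. (- 1) ^ par p j *\<^sub>R Lzero (mu - lam) i j (Lzero (mu - lam) j i T)))"
    by (intro quantization_sum[OF Q(1)] V_closed L_in T)
  ultimately have 2: "(\<Sum>i\<in>{1..p+q}. \<Sum>j\<in>{1..p+q}. (- 1) ^ par p j *\<^sub>R ?l i j (?l j i (Q T))) =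
      Q (\<Sum>i\<in>{1..p+q}. \<Sum>j\<in>{1..p+q}. (- 1) ^ par p j *\<^sub>R Lzero (mu - lam) i j (Lzero (mu - lam) j i T))"
    by simp
  have V: "(\<Sum>j\<in>{1..p+q}. (- 1) ^ par p j *\<^sub>R Lplus (mu - lam) j (Lminus j T)) \<in> Sym p q"
    "(\<Sum>i\<in>{1..p+q}. \<Sum>j\<in>{1..p+q}. (- 1) ^ par p j *\<^sub>R Lzero (mu - lam) i j (Lzero (mu - lam) j i T)) \<in> Sym p q"
    by (intro V_closed L_in T; assumption)+
  show ?thesis
    unfolding ocas_def Let_def casimir_def 1 2 using T V
    by (simp only: eq Lact_elem Lid_in add diff scale V_closed)
qed

text \<open>A nonzero T of degree k fixes the eigenvalue; a coefficient of S in another degree would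
  belong to a different one.\<close>

lemma casimir_SymK:
  assumes crit: "q \<noteq> p + 1" "\<not> critical p q \<delta>"
    and T: "T \<in> SymK p q k" and S: "S \<in> Sym p q" and eig: "\<And>c. casimir \<delta> T = c *\<^sub>R T \<Longrightarrow> T \<noteq> 0 \<Longrightarrow> casimir \<delta> S = c *\<^sub>R S"
    and "T \<noteq> 0"
  shows "S \<in> SymK p q k"
proof -
  define n where "n = real p - real q"
  define g where "g x = 2 * x\<^sup>2 + 2 * (n - (n + 1) * \<delta>) * x + ((n + n\<^sup>2) * \<delta>\<^sup>2 - (n + 1) * \<delta> * n)" for x :: real
  have T': "T \<in> Sym p q" "Deg T = real k *\<^sub>R T"
    using T by (auto simp: SymK_iff)
  have "casimir \<delta> T = g (real k) *\<^sub>R T"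
    using casimir_eq[OF T'(1), of \<delta>] T'
    by (simp add: g_def n_def sdim_eq power2_eq_square scaleR_add_left mult_ac)
  then have *: "casimir \<delta> S = g (real k) *\<^sub>R S"
    using eig \<open>T \<noteq> 0\<close> by blast
  have "mdeg p q \<alpha> = k" if "S \<alpha> \<noteq> 0" for \<alpha>
  proof (rule ccontr)
    assume ne: "mdeg p q \<alpha> \<noteq> k"
    have "casimir \<delta> S \<alpha> = g (real (mdeg p q \<alpha>)) *\<^sub>R S \<alpha>"
      unfolding casimir_eq[OF S] using S
      by (simp add: symbol_pointwise Deg_apply g_def n_def sdim_eq power2_eq_square scaleR_add_left mult_ac)
    moreover have "casimir \<delta> S \<alpha> = g (real k) *\<^sub>R S \<alpha>"
      unfolding * by (simp add: symbol_pointwise)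
    ultimately have "g (real (mdeg p q \<alpha>)) = g (real k)"
      using that by simp
    \<comment> \<open>g(x) - g(y) = 2 (x - y) (x + y + n - (n + 1) \<delta>), whose last factor is
      nonzero for distinct degrees.\<close>
    then have "(real (mdeg p q \<alpha>) - real k) * (real (mdeg p q \<alpha>) + real k + n - (n + 1) * \<delta>) = 0"
      unfolding g_def by (simp add: algebra_simps power2_eq_square)
    then show False
      using not_critical_nonzero[OF crit ne] ne by (simp add: n_def)
  qed
  then show ?thesis
    using S by (simp add: SymK_def)
qed

lemma equivariant_quantization_unique:
  assumes crit: "q \<noteq> p + 1" "\<not> critical p q (mu - lam)"
    and Q: "quantization p q Q" "sl_equivariant p q lam mu Q"
    and Q': "quantization p q Q'" "sl_equivariant p q lam mu Q'"
    and S: "S \<in> Sym p q"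
  shows "Q' S = Q S"
proof -
  have K: "Q' T = Q T" if T: "T \<in> SymK p q k" for T k
  proof (cases "T = 0")
    case True
    then show ?thesis
      using quantization_sum[OF Q(1), of "{}"] quantization_sum[OF Q'(1), of "{}"] by simp
  next
    case False
    have T': "T \<in> Sym p q"
      using T by (rule SymK_Sym)
    have bij: "bij_betw Q (Sym p q) (DO p q)" "bij_betw Q' (Sym p q) (DO p q)"
      using Q(1) Q'(1) by (auto simp: quantization_def)
    then have "Q' T \<in> Q ` Sym p q"
      using T' by (auto simp: bij_betw_def)
    \<comment> \<open>U is the preimage of Q' T under Q. Once U is known to be homogeneous of degree
      k, both U and T are the principal symbol of the same operator.\<close>
    then obtain U where U: "U \<in> Sym p q" "Q' T = Q U"
      by auto
    have cas_in: "casimir (mu - lam) U \<in> Sym p q"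
      unfolding casimir_eq[OF U(1)] by (intro V_closed Deg_in U)
    have "U \<in> SymK p q k"
    proof (rule casimir_SymK[OF crit T U(1) _ False])
      fix c assume c: "casimir (mu - lam) T = c *\<^sub>R T"
      have "Q (casimir (mu - lam) U) = ocas lam mu (Q U)"
        by (rule quantization_casimir[OF Q U(1), symmetric])
      also have "\<dots> = ocas lam mu (Q' T)"
        by (simp only: U(2))
      also have "\<dots> = Q' (c *\<^sub>R T)"
        unfolding quantization_casimir[OF Q' T'] c ..
      also have "\<dots> = c *\<^sub>R Q U"
        using Q'(1) T' U(2) by (simp add: quantization_def)
      also have "\<dots> = Q (c *\<^sub>R U)"
        using Q(1) U(1) by (simp add: quantization_def)
      finally show "casimir (mu - lam) U = c *\<^sub>R U"
        using bij(1) cas_in U(1) by (auto simp: bij_betw_def dest!: inj_onD)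
    qed
    then have "principal_symbol p q k (Q U) = U"
      using Q(1) by (simp add: quantization_def)
    moreover have "principal_symbol p q k (Q' T) = T"
      using Q'(1) T by (simp add: quantization_def)
    ultimately have "U = T"
      using U(2) by simp
    then show ?thesis
      using U(2) by simp
  qed
  have dec: "(\<Sum>k\<in>mdeg p q ` {\<alpha>. S \<alpha> \<noteq> 0}. kpart p q k S) = S"
    by (rule kpart_decomp) (use degrees_finite[OF S] in auto)
  have "Q' S = (\<Sum>k\<in>mdeg p q ` {\<alpha>. S \<alpha> \<noteq> 0}. Q' (kpart p q k S))"
    using quantization_sum[OF Q'(1), of "mdeg p q ` {\<alpha>. S \<alpha> \<noteq> 0}" "\<lambda>k. kpart p q k S"] S by (simp add: dec)
  also have "\<dots> = (\<Sum>k\<in>mdeg p q ` {\<alpha>. S \<alpha> \<noteq> 0}. Q (kpart p q k S))"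
    using S by (intro sum.cong refl K[OF kpart_SymK])
  also have "\<dots> = Q S"
    using quantization_sum[OF Q(1), of "mdeg p q ` {\<alpha>. S \<alpha> \<noteq> 0}" "\<lambda>k. kpart p q k S"] S by (simp add: dec)
  finally show ?thesis .
qed

end

theorem theorem4p2p4:
  fixes p q :: nat and lam mu \<delta> :: real
    and C :: "nat \<Rightarrow> nat \<Rightarrow> real" and Q :: "symbol \<Rightarrow> oper"
  assumes "q \<noteq> p + 1"
    and "\<delta> = mu - lam"
    and "\<not> critical p q \<delta>"
    and "\<And>k. C k 0 = 1"
    and "\<And>k r. r \<ge> 1 \<Longrightarrow>
      C k r = (\<Prod>j=1..r. (real p - real q + 1) * lam + real k - real j) /
              (fact r * (\<Prod>j=1..r. real p - real q + 2 * real k - real j - (real p - real q + 1) * \<delta>))"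
    and "Q = div_map p q C"
  shows "quantization p q Q \<and> sl_equivariant p q lam mu Q \<and>
    (\<forall>Q'. quantization p q Q' \<and> sl_equivariant p q lam mu Q' \<longrightarrow> (\<forall>S\<in>Sym p q. Q' S = Q S))"
proof -
  \<comment> \<open>For r = 0 all products are empty, so a single formula covers both cases.\<close>
  have Cr: "C k r = (\<Prod>j=1..r. (real p - real q + 1) * lam + real k - real j) /
      (fact r * (\<Prod>j=1..r. real p - real q + 2 * real k - real j - (real p - real q + 1) * \<delta>))" for k r
    using assms(4)[of k] assms(5)[of r k] by (cases "r = 0") auto
  have rec: "C k (Suc r) * (real (Suc r) * (real p - real q + 2 * real k - real (Suc r) - (real p - real q + 1) * \<delta>)) =
      C k r * (real k - real (Suc r) + lam * (real p - real q + 1))" if "r < k" for k r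
  proof -
    \<comment> \<open>Non-criticality is applied to k and l = k - (r + 1), where r < k keeps the
      subtraction exact.\<close>
    have "real k + real (k - Suc r) + (real p - real q) - (real p - real q + 1) * \<delta> \<noteq> 0"
      using that by (intro not_critical_nonzero[OF assms(1,3)]) simp
    then have nz: "real p - real q + 2 * real k - real (Suc r) - (real p - real q + 1) * \<delta> \<noteq> 0"
      using that by (simp add: of_nat_diff algebra_simps)
    have "C k (Suc r) = C k r * (((real p - real q + 1) * lam + real k - real (Suc r)) /
        (real (Suc r) * (real p - real q + 2 * real k - real (Suc r) - (real p - real q + 1) * \<delta>)))"
      unfolding Cr by (simp add: mult_ac del: of_nat_Suc)
    moreover have "x * (a / (s * d)) * (s * d) = x * a" if "s \<noteq> 0" "d \<noteq> 0" for x a s d :: real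
      using that by simp
    moreover have "(real p - real q + 1) * lam + real k - real (Suc r) = real k - real (Suc r) + lam * (real p - real q + 1)"
      by (simp add: algebra_simps)
    ultimately show ?thesis
      using nz by (simp del: of_nat_Suc)
  qed
  have quant: "quantization p q Q"
    unfolding assms(6) by (rule div_map_quantization[where C = C, OF assms(4)])
  moreover have equiv: "sl_equivariant p q lam mu Q"
    unfolding assms(6) using rec unfolding assms(2) by (intro div_map_equivariant) (simp only: sdim_eq)
  moreover have "\<not> critical p q (mu - lam)"
    using assms(2,3) by simp
  ultimately show ?thesis
    using equivariant_quantization_unique[OF assms(1)] by blast
qed

end
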